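(* Let $G$ be a finite non-abelian metacyclic group given by $$G = \langle a, b \mid a^{n} = 1,\ b^{t} = a^{\ell},\ b^{-1}ab = a^{r} \rangle,$$ where $n, t, r, \ell$ are natural numbers such that $r^{t} \equiv 1 \pmod n$, $\ell r \equiv \ell \pmod n$ and $\ell$ divides $n$. Then $G$ has the cut-property if, and only if, $G$ is isomorphic to one of the following groups (where, in each line, every combination of the listed parameter values is allowed): 1. $\langle a,b \mid a^{n}=1,\ b^{t}=1,\ b^{-1}ab=a^{n-1}\rangle$, $t=2,4,6$, $n=3,4,6$; 2. $\langle a,b \mid a^{4}=1,\ b^{t}=a^{2},\ b^{-1}ab=a^{3}\rangle$, $t=2,4,6$; 3. $\langle a,b \mid a^{6}=1,\ b^{2}=a^{3},\ b^{-1}ab=a^{5}\rangle$; 4. $\langle a,b \mid a^{n}=1,\ b^{\varphi(n)}=1,\ b^{-1}ab=a^{\lambda_n}\rangle$, $n=5,7,9,10,14,18$; 5. $\langle a,b \mid a^{n}=1,\ b^{\varphi(n)/j}=1,\ b^{-1}ab=a^{\lambda_n^{2}}\rangle$, $j=1,2$, $n=7,9,14,18$; 6. $\langle a,b \mid a^{8}=1,\ b^{t}=1,\ b^{-1}ab=a^{r}\rangle$, $t=2,4$, $r=3,5$; 7. $\langle a,b \mid a^{12}=1,\ b^{t}=1,\ b^{-1}ab=a^{5}\rangle$, $t=2,4$; 8. $\langle a,b \mid a^{12}=1,\ b^{t}=a^{\ell},\ b^{-1}ab=a^{7}\rangle$, $t=2,6$, $\ell=t,12$; 9. $\langle a,b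 \mid a^{15}=1,\ b^{4}=1,\ b^{-1}ab=a^{2}\rangle$; 10. $\langle a,b \mid a^{16}=1,\ b^{4}=1,\ b^{-1}ab=a^{r}\rangle$, $r=3,5$; 11. $\langle a,b \mid a^{20}=1,\ b^{4}=1,\ b^{-1}ab=a^{r}\rangle$, $r=3,13$; 12. $\langle a,b \mid a^{20}=1,\ b^{4}=a^{10},\ b^{-1}ab=a^{3}\rangle$; 13. $\langle a,b \mid a^{21}=1,\ b^{6}=1,\ b^{-1}ab=a^{r}\rangle$, $r=2,10$; 14. $\langle a,b \mid a^{28}=1,\ b^{6}=a^{\ell},\ b^{-1}ab=a^{11}\rangle$, $\ell=14,28$; 15. $\langle a,b \mid a^{30}=1,\ b^{4}=1,\ b^{-1}ab=a^{17}\rangle$; 16. $\langle a,b \mid a^{36}=1,\ b^{6}=a^{\ell},\ b^{-1}ab=a^{7}\rangle$, $\ell=6,36$; 17. $\langle a,b \mid a^{42}=1,\ b^{6}=1,\ b^{-1}ab=a^{r}\rangle$, $r=11,19$; where $\lambda_n$ is a generator of the (cyclic) group $\mathcal{U}(\mathbb{Z}/n\mathbb{Z})$ of units of $\mathbb{Z}/n\mathbb{Z}$ and $\varphi$ denotes Euler's phi function.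
   Context: For a finite group $G$, let $\mathcal{U}(\mathbb{Z}[G])$ denote the group of units of the integral group ring $\mathbb{Z}[G]$ and $\mathcal{Z}(\cdot)$ the centre of a group. A finite group $G$ has the cut-property if all central units of $\mathbb{Z}[G]$ are trivial, i.e. $\mathcal{Z}(\mathcal{U}(\mathbb{Z}[G])) = \pm\mathcal{Z}(G) = \{\pm g : g \in \mathcal{Z}(G)\}$. *)

theory Defs
  imports "HOL-Algebra.Algebra" "HOL-Number_Theory.Number_Theory"
begin

section \<open>The integral group ring and the cut-property\<close>

text \<open>
  Elements are formal integer combinations of elements of \<open>G\<close>, as in
  \<^const>\<open>free_Abelian_group\<close>; the product is the bilinear extension of the product of \<open>G\<close>.
\<close>

definition integral_group_ring :: "('a, 'm) monoid_scheme \<Rightarrow> ('a \<Rightarrow>\<^sub>0 int) ring" where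
  "integral_group_ring G =
     \<lparr>carrier = {c. Poly_Mapping.keys c \<subseteq> carrier G},
      monoid.mult = (\<lambda>p q. frag_extend (\<lambda>x. frag_extend (\<lambda>y. frag_of (x \<otimes>\<^bsub>G\<^esub> y)) q) p),
      monoid.one = frag_of \<one>\<^bsub>G\<^esub>,
      ring.zero = 0,
      ring.add = (+)\<rparr>"

definition group_center :: "('a, 'm) monoid_scheme \<Rightarrow> 'a set" where
  "group_center G = {z \<in> carrier G. \<forall>g \<in> carrier G. g \<otimes>\<^bsub>G\<^esub> z = z \<otimes>\<^bsub>G\<^esub> g}"

definition cut_property :: "('a, 'm) monoid_scheme \<Rightarrow> bool" where
  "cut_property G \<longleftrightarrow>
     group_center (units_of (integral_group_ring G)) =
       {frag_of g | g. g \<in> group_center G} \<union> {- frag_of g | g. g \<in> group_center G}"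

lemma frag_extend_in_carrier:
  assumes "Poly_Mapping.keys c \<subseteq> B" and "\<And>x. x \<in> B \<Longrightarrow> Poly_Mapping.keys (f x) \<subseteq> A"
  shows "Poly_Mapping.keys (frag_extend f c) \<subseteq> A"
  using keys_frag_extend[of f c] assms by blast

lemma frag_extend_cong:
  assumes "Poly_Mapping.keys c \<subseteq> B" and "\<And>x. x \<in> B \<Longrightarrow> f x = g x"
  shows "frag_extend f c = frag_extend g c"
  by (rule frag_extend_eq) (use assms in blast)

lemma frag_extend_fun_add:
  "frag_extend (\<lambda>x. f x + g x) c = frag_extend f c + frag_extend g c"
  by (simp add: frag_extend_def frag_cmul_distrib2 sum.distrib)

lemma frag_extend_comp:
  "frag_extend f (frag_extend g c) = frag_extend (\<lambda>x. frag_extend f (g x)) c"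
proof -
  have "Poly_Mapping.keys c \<subseteq> UNIV" by simp
  then show ?thesis
    by (induction c rule: frag_induction) (simp_all add: frag_extend_diff)
qed

lemma (in group) ring_integral_group_ring: "ring (integral_group_ring G)"
proof (rule ringI)
  let ?R = "integral_group_ring G"
  have carr: "x \<in> carrier ?R \<longleftrightarrow> Poly_Mapping.keys x \<subseteq> carrier G" for x
    by (simp add: integral_group_ring_def)
  have mult: "x \<otimes>\<^bsub>?R\<^esub> y = frag_extend (\<lambda>g. frag_extend (\<lambda>h. frag_of (g \<otimes> h)) y) x" for x y
    by (simp add: integral_group_ring_def)
  have add: "x \<oplus>\<^bsub>?R\<^esub> y = x + y" for x y
    by (simp add: integral_group_ring_def)
  have one: "\<one>\<^bsub>?R\<^esub> = frag_of \<one>" and zero: "\<zero>\<^bsub>?R\<^esub> = 0"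
    by (simp_all add: integral_group_ring_def)
  show "abelian_group ?R"
  proof (rule abelian_groupI)
    fix x assume "x \<in> carrier ?R"
    then show "\<exists>y\<in>carrier ?R. y \<oplus>\<^bsub>?R\<^esub> x = \<zero>\<^bsub>?R\<^esub>"
      by (intro bexI[of _ "- x"]) (simp_all add: carr add zero)
  next
    fix x y assume "x \<in> carrier ?R" "y \<in> carrier ?R"
    then show "x \<oplus>\<^bsub>?R\<^esub> y \<in> carrier ?R"
      unfolding carr add using keys_add[of x y] by blast
  qed (simp_all add: carr add zero algebra_simps)
  show "monoid ?R"
  proof (rule monoidI)
    fix x y assume "x \<in> carrier ?R" "y \<in> carrier ?R"
    then have k: "Poly_Mapping.keys x \<subseteq> carrier G" "Poly_Mapping.keys y \<subseteq> carrier G"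
      by (simp_all add: carr)
    show "x \<otimes>\<^bsub>?R\<^esub> y \<in> carrier ?R"
      unfolding carr mult by (intro frag_extend_in_carrier[OF k(1)] frag_extend_in_carrier[OF k(2)]) simp
  next
    fix x y z assume "x \<in> carrier ?R" "y \<in> carrier ?R" "z \<in> carrier ?R"
    then have k: "Poly_Mapping.keys x \<subseteq> carrier G" "Poly_Mapping.keys y \<subseteq> carrier G"
       "Poly_Mapping.keys z \<subseteq> carrier G" by (simp_all add: carr)
    show "x \<otimes>\<^bsub>?R\<^esub> y \<otimes>\<^bsub>?R\<^esub> z = x \<otimes>\<^bsub>?R\<^esub> (y \<otimes>\<^bsub>?R\<^esub> z)"
      unfolding mult frag_extend_comp frag_extend_of
      by (intro frag_extend_cong[OF k(1)] frag_extend_cong[OF k(2)] frag_extend_cong[OF k(3)])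
         (simp add: m_assoc)
  next
    fix x assume "x \<in> carrier ?R"
    then have k: "Poly_Mapping.keys x \<subseteq> carrier G" by (simp add: carr)
    have "frag_extend (\<lambda>y. frag_of (\<one> \<otimes> y)) x = frag_extend frag_of x"
         "frag_extend (\<lambda>y. frag_of (y \<otimes> \<one>)) x = frag_extend frag_of x"
      by (rule frag_extend_cong[OF k], simp)+
    then show "\<one>\<^bsub>?R\<^esub> \<otimes>\<^bsub>?R\<^esub> x = x" "x \<otimes>\<^bsub>?R\<^esub> \<one>\<^bsub>?R\<^esub> = x"
      unfolding mult one frag_extend_of using frag_expansion[of x] by simp_all
  qed (simp add: carr one)
  fix x y z
  show "(x \<oplus>\<^bsub>?R\<^esub> y) \<otimes>\<^bsub>?R\<^esub> z = x \<otimes>\<^bsub>?R\<^esub> z \<oplus>\<^bsub>?R\<^esub> y \<otimes>\<^bsub>?R\<^esub> z"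
    unfolding mult add by (rule frag_extend_add)
  show "z \<otimes>\<^bsub>?R\<^esub> (x \<oplus>\<^bsub>?R\<^esub> y) = z \<otimes>\<^bsub>?R\<^esub> x \<oplus>\<^bsub>?R\<^esub> z \<otimes>\<^bsub>?R\<^esub> y"
    unfolding mult add frag_extend_add by (rule frag_extend_fun_add)
qed


section \<open>Group presentations\<close>

text \<open>
  The letter \<open>(x, True)\<close> stands for the generator \<open>x\<close> and \<open>(x, False)\<close> for its formal inverse.
  A set \<open>R\<close> of pairs of words is read as the set of defining relations \<open>u = v\<close>,
  \<open>(u, v) \<in> R\<close>, and every element of the type \<open>'g\<close> is a generator.
\<close>

inductive pres_eq :: "(('g \<times> bool) list \<times> ('g \<times> bool) list) set
    \<Rightarrow> ('g \<times> bool) list \<Rightarrow> ('g \<times> bool) list \<Rightarrow> bool"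
  for R where
  refl: "pres_eq R u u"
| sym: "pres_eq R u v \<Longrightarrow> pres_eq R v u"
| trans: "pres_eq R u v \<Longrightarrow> pres_eq R v w \<Longrightarrow> pres_eq R u w"
| cancel: "pres_eq R (p @ [(x, e), (x, \<not> e)] @ q) (p @ q)"
| relation: "(u, v) \<in> R \<Longrightarrow> pres_eq R (p @ u @ q) (p @ v @ q)"

definition pres_class :: "(('g \<times> bool) list \<times> ('g \<times> bool) list) set
    \<Rightarrow> ('g \<times> bool) list \<Rightarrow> ('g \<times> bool) list set" where
  "pres_class R u = {v. pres_eq R u v}"

definition presented_group :: "(('g \<times> bool) list \<times> ('g \<times> bool) list) set
    \<Rightarrow> ('g \<times> bool) list set monoid" where
  "presented_group R =
     \<lparr>carrier = range (pres_class R),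
      monoid.mult = (\<lambda>A B. \<Union>u\<in>A. \<Union>v\<in>B. pres_class R (u @ v)),
      monoid.one = pres_class R []\<rparr>"

lemma pres_eq_context: "pres_eq R u v \<Longrightarrow> pres_eq R (p @ u @ q) (p @ v @ q)"
proof (induction rule: pres_eq.induct)
  case (refl u)
  show ?case by (rule pres_eq.refl)
next
  case (sym u v)
  from pres_eq.sym[OF sym.IH] show ?case .
next
  case (trans u v w)
  from pres_eq.trans[OF trans.IH] show ?case .
next
  case (cancel p' x e q')
  then show ?case using pres_eq.cancel[of R "p @ p'" x e "q' @ q"] by simp
next
  case (relation u v p' q')
  then show ?case using pres_eq.relation[of u v R "p @ p'" "q' @ q"] by simp
qed

lemma pres_eq_append:
  assumes "pres_eq R u u'" "pres_eq R v v'"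
  shows "pres_eq R (u @ v) (u' @ v')"
proof (rule pres_eq.trans)
  show "pres_eq R (u @ v) (u' @ v)"
    using pres_eq_context[OF assms(1), of "[]" v] by simp
  show "pres_eq R (u' @ v) (u' @ v')"
    using pres_eq_context[OF assms(2), of u' "[]"] by simp
qed

lemma pres_class_eq_iff: "pres_class R u = pres_class R v \<longleftrightarrow> pres_eq R u v"
proof
  assume "pres_class R u = pres_class R v"
  then have "v \<in> pres_class R u" by (simp add: pres_class_def pres_eq.refl)
  then show "pres_eq R u v" by (simp add: pres_class_def)
next
  assume uv: "pres_eq R u v"
  show "pres_class R u = pres_class R v"
    unfolding pres_class_def
    using pres_eq.trans[OF uv] pres_eq.trans[OF pres_eq.sym[OF uv]] by blast
qed

lemma presented_group_mult:
  "pres_class R u \<otimes>\<^bsub>presented_group R\<^esub> pres_class R v = pres_class R (u @ v)"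
proof -
  have eq: "pres_class R (u' @ v') = pres_class R (u @ v)"
    if "u' \<in> pres_class R u" "v' \<in> pres_class R v" for u' v'
    unfolding pres_class_eq_iff
    using that pres_eq_append[of R u' u v' v] pres_eq.sym[of R u u'] pres_eq.sym[of R v v']
    by (simp add: pres_class_def)
  have "u \<in> pres_class R u" "v \<in> pres_class R v"
    by (simp_all add: pres_class_def pres_eq.refl)
  then have "(\<Union>u'\<in>pres_class R u. \<Union>v'\<in>pres_class R v. pres_class R (u' @ v')) = pres_class R (u @ v)"
    using eq by blast
  then show ?thesis by (simp add: presented_group_def)
qed

lemma pres_eq_inverse: "pres_eq R (rev (map (\<lambda>(x, e). (x, \<not> e)) u) @ u) []"
proof (induction u)
  case (Cons y u)
  obtain x e where [simp]: "y = (x, e)" by force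
  let ?i = "rev (map (\<lambda>(x, e). (x, \<not> e)) u)"
  have "pres_eq R (?i @ [(x, \<not> e), (x, \<not> \<not> e)] @ u) (?i @ u)"
    by (rule pres_eq.cancel)
  from pres_eq.trans[OF this Cons.IH] show ?case by simp
qed (simp add: pres_eq.refl)

lemma group_presented_group: "group (presented_group R)"
proof (rule groupI)
  let ?P = "presented_group R"
  have carr: "carrier ?P = range (pres_class R)" and one: "\<one>\<^bsub>?P\<^esub> = pres_class R []"
    by (simp_all add: presented_group_def)
  show "\<And>x y. x \<in> carrier ?P \<Longrightarrow> y \<in> carrier ?P \<Longrightarrow> x \<otimes>\<^bsub>?P\<^esub> y \<in> carrier ?P"
       "\<one>\<^bsub>?P\<^esub> \<in> carrier ?P"
       "\<And>x y z. x \<in> carrier ?P \<Longrightarrow> y \<in> carrier ?P \<Longrightarrow> z \<in> carrier ?P \<Longrightarrow>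
          x \<otimes>\<^bsub>?P\<^esub> y \<otimes>\<^bsub>?P\<^esub> z = x \<otimes>\<^bsub>?P\<^esub> (y \<otimes>\<^bsub>?P\<^esub> z)"
       "\<And>x. x \<in> carrier ?P \<Longrightarrow> \<one>\<^bsub>?P\<^esub> \<otimes>\<^bsub>?P\<^esub> x = x"
    by (auto simp: carr one presented_group_mult)
  show "\<exists>y\<in>carrier ?P. y \<otimes>\<^bsub>?P\<^esub> x = \<one>\<^bsub>?P\<^esub>" if "x \<in> carrier ?P" for x
  proof -
    from that obtain u where u: "x = pres_class R u" by (auto simp: carr)
    show ?thesis
      by (rule bexI[of _ "pres_class R (rev (map (\<lambda>(x, e). (x, \<not> e)) u))"])
         (use pres_eq_inverse in \<open>auto simp: u carr one presented_group_mult pres_class_eq_iff\<close>)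
  qed
qed

text \<open>The group \<open>\<langle>a, b | a\<^sup>n = 1, b\<^sup>t = a\<^sup>\<ell>, b\<^sup>-\<^sup>1 a b = a\<^sup>r\<rangle>\<close>, with arguments in the order \<open>n t \<ell> r\<close>.\<close>

datatype gen = Gen_a | Gen_b

definition metacyclic_pres :: "nat \<Rightarrow> nat \<Rightarrow> nat \<Rightarrow> nat \<Rightarrow> (gen \<times> bool) list set monoid" where
  "metacyclic_pres n t l r =
     presented_group
       {(replicate n (Gen_a, True), []),
        (replicate t (Gen_b, True), replicate l (Gen_a, True)),
        ([(Gen_b, False), (Gen_a, True), (Gen_b, True)], replicate r (Gen_a, True))}"

definition metacyclic :: "('a, 'm) monoid_scheme \<Rightarrow> bool" where
  "metacyclic G \<longleftrightarrow>
     (\<exists>N. N \<lhd> G \<and> cyclic_group (G\<lparr>carrier := N\<rparr>) \<and> cyclic_group (G Mod N))"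

end

theory Submission
  imports Defs "Jordan_Normal_Form.Schur_Decomposition" "HOL-Library.Code_Binary_Nat"
begin

text \<open>
  Call a finite group inverse semi-rational if \<open>x\<^sup>k\<close> is conjugate to \<open>x\<close> or to the inverse of \<open>x\<close>
  whenever \<open>k\<close> is prime to the order of the group. The proof rests on the fact that a finite group
  has the cut-property if and only if it is inverse semi-rational
  (\<open>cut_property_iff_inverse_semirational\<close>); for a metacyclic group the second property is a
  family of congruences between the parameters, and these leave finitely many cases.

  Both directions of the equivalence study a class function \<open>K\<close> with integer values that is
  invariant under inversion, as an element of the centre of the group algebra. Such a \<open>K\<close> behaves
  like a real symmetric matrix: a polynomial in \<open>K\<close> is zero as soon as it vanishes at every
  eigenvalue \<open>\<alpha>\<close> that has an idempotent \<open>e\<close> with \<open>K e = \<alpha> e\<close> among the polynomials in \<open>K\<close>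
  (\<open>spectral_theorem\<close>). These idempotents take the place of the irreducible characters.

  Let the group be inverse semi-rational, let \<open>u\<close> be a central unit and \<open>u\<^sup>*\<close> its image under
  inversion of the group elements. Every idempotent as above is constant on \<open>x\<^sup>k\<close>, \<open>k\<close> prime to the
  group order, and has therefore rational values (\<open>idempotent_rational\<close>). So the eigenvalues of the
  unit \<open>V = u u\<^sup>*\<close> are rational, they are algebraic integers together with their inverses, hence
  \<open>1\<close> or \<open>-1\<close>. This gives \<open>V\<^sup>2 = 1\<close>, and comparing the coefficients at the neutral element, first
  in \<open>V\<^sup>2\<close> and then in \<open>V\<close>, shows that exactly one coefficient of \<open>u\<close> is not zero.

  Conversely let all central units be trivial, and let \<open>K\<close> be the indicator function of the union
  of the conjugacy classes of \<open>x\<close> and of its inverse. If an eigenvalue \<open>\<alpha>\<close> of \<open>K\<close> were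
  irrational, then the order generated by \<open>\<alpha>\<close>, which has a real embedding and rank at least two,
  would contain a unit of infinite order, as in Dirichlet's unit theorem
  (\<open>exists_unit_of_infinite_order\<close>); it would produce a central unit of infinite order. Hence all
  eigenvalues are integers, and Fermat's little theorem, applied to each of them, gives
  \<open>K\<^sup>p \<equiv> K\<close> modulo almost all primes \<open>p\<close>. On the other hand \<open>K\<^sup>p(z\<^sup>p) \<equiv> K(z)\<close> modulo
  \<open>p\<close>, as one sees by rotating words of length \<open>p\<close>. So \<open>K(z\<^sup>p) = K(z)\<close>, which is the claim for
  large primes and, by iteration, for all exponents without small prime factors; each residue class
  prime to the group order contains such exponents.

  In a metacyclic group every element has a unique normal form \<open>b\<^sup>j a\<^sup>i\<close>, and conjugacy becomes a
  congruence (\<open>inverse_semirational_iff\<close>). The element \<open>a\<close> shows that every unit modulo \<open>n\<close> is, up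
  to sign, a power of \<open>r\<close>; the element \<open>b\<close> shows that \<open>1\<close> and \<open>-1\<close> are the only units modulo \<open>t\<close>.
  So \<open>t\<close> is \<open>2\<close>, \<open>3\<close>, \<open>4\<close> or \<open>6\<close>, the exponent of the unit group modulo \<open>n\<close> divides \<open>2\<close>, \<open>6\<close>,
  \<open>4\<close> or \<open>6\<close> respectively, and \<open>n\<close> divides \<open>24\<close>, \<open>504\<close>, \<open>240\<close> or \<open>504\<close>. Each of the remaining
  quadruples either violates one of the congruences or belongs to a group isomorphic to a listed one;
  the isomorphism is given by images of the generators and their words in the inverse direction
  (\<open>iso_check_sound\<close>). That the listed groups qualify is again a finite set of congruences.
\<close>

section \<open>The group algebra as convolution of functions\<close>

locale finite_group = group +
  assumes finite_carrier: "finite (carrier G)"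
begin

text \<open>The product of the group algebra with an arbitrary commutative coefficient ring. Functions that
  vanish off the carrier (\<open>supported\<close>) represent its elements, so that coefficients can change
  between \<open>int\<close>, \<open>real\<close> and \<open>complex\<close> by composition.\<close>

definition conv :: "('a \<Rightarrow> 'c::comm_ring_1) \<Rightarrow> ('a \<Rightarrow> 'c) \<Rightarrow> 'a \<Rightarrow> 'c" (infixl "\<star>" 70) where
  "(f \<star> g) x = (if x \<in> carrier G then \<Sum>y\<in>carrier G. f y * g (inv y \<otimes> x) else 0)"

definition delta :: "'a \<Rightarrow> 'c::comm_ring_1" where
  "delta x = (if x = \<one> then 1 else 0)"

definition supported :: "('a \<Rightarrow> 'c::comm_ring_1) \<Rightarrow> bool" where
  "supported f \<longleftrightarrow> (\<forall>x. x \<notin> carrier G \<longrightarrow> f x = 0)"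

definition class_fun :: "('a \<Rightarrow> 'c::comm_ring_1) \<Rightarrow> bool" where
  "class_fun f \<longleftrightarrow> supported f \<and> (\<forall>x\<in>carrier G. \<forall>y\<in>carrier G. f (x \<otimes> y) = f (y \<otimes> x))"

text \<open>Invariance under inversion makes left multiplication by a real-valued function self-adjoint.\<close>

definition sym_class_fun :: "('a \<Rightarrow> 'c::comm_ring_1) \<Rightarrow> bool" where
  "sym_class_fun f \<longleftrightarrow> class_fun f \<and> (\<forall>x\<in>carrier G. f (inv x) = f x)"

lemma inv_cancel_left [simp]:
  "x \<in> carrier G \<Longrightarrow> y \<in> carrier G \<Longrightarrow> x \<otimes> (inv x \<otimes> y) = y"
  "x \<in> carrier G \<Longrightarrow> y \<in> carrier G \<Longrightarrow> inv x \<otimes> (x \<otimes> y) = y"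
  by (simp_all add: m_assoc[symmetric])

lemma sum_left_translate:
  assumes "z \<in> carrier G"
  shows "(\<Sum>y\<in>carrier G. h y) = (\<Sum>y\<in>carrier G. h (z \<otimes> y))"
  by (rule sum.reindex_bij_witness[of _ "\<lambda>y. z \<otimes> y" "\<lambda>y. inv z \<otimes> y"])
     (use assms in auto)

lemma sum_inv_translate:
  assumes "z \<in> carrier G"
  shows "(\<Sum>y\<in>carrier G. h y) = (\<Sum>y\<in>carrier G. h (z \<otimes> inv y))"
  by (rule sum.reindex_bij_witness[of _ "\<lambda>y. z \<otimes> inv y" "\<lambda>y. inv y \<otimes> z"])
     (use assms in \<open>auto simp: m_assoc inv_mult_group\<close>)

lemma conv_assoc: "f \<star> g \<star> h = f \<star> (g \<star> h)"
proof
  fix x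
  show "(f \<star> g \<star> h) x = (f \<star> (g \<star> h)) x"
  proof (cases "x \<in> carrier G")
    case x: True
    have "(f \<star> g \<star> h) x = (\<Sum>y\<in>carrier G. \<Sum>z\<in>carrier G. f z * g (inv z \<otimes> y) * h (inv y \<otimes> x))"
      using x by (simp add: conv_def sum_distrib_right)
    also have "\<dots> = (\<Sum>z\<in>carrier G. \<Sum>y\<in>carrier G. f z * g (inv z \<otimes> y) * h (inv y \<otimes> x))"
      by (rule sum.swap)
    also have "\<dots> = (\<Sum>z\<in>carrier G. \<Sum>y\<in>carrier G. f z * g (inv z \<otimes> (z \<otimes> y)) * h (inv (z \<otimes> y) \<otimes> x))"
      by (intro sum.cong[OF HOL.refl] sum_left_translate)
    also have "\<dots> = (\<Sum>z\<in>carrier G. \<Sum>y\<in>carrier G. f z * (g y * h (inv y \<otimes> (inv z \<otimes> x))))"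
      using x by (intro sum.cong HOL.refl) (simp add: m_assoc inv_mult_group mult.assoc)
    also have "\<dots> = (f \<star> (g \<star> h)) x"
      using x by (simp add: conv_def sum_distrib_left)
    finally show ?thesis .
  qed (simp add: conv_def)
qed

lemma supported_conv: "supported (f \<star> g)"
  by (simp add: supported_def conv_def)

lemma delta_conv: "supported f \<Longrightarrow> delta \<star> f = f"
  by (auto simp: fun_eq_iff conv_def delta_def supported_def if_distrib[of "\<lambda>c. c * _"] sum.delta finite_carrier
      cong: if_cong)

lemma conv_delta: "supported f \<Longrightarrow> f \<star> delta = f"
proof
  fix x assume f: "supported f"
  show "(f \<star> delta) x = f x"
  proof (cases "x \<in> carrier G")
    case x: True
    have "(f \<star> delta) x = (\<Sum>y\<in>carrier G. if y = x then f y else 0)"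
      unfolding conv_def delta_def using x
      by (auto intro!: sum.cong simp: l_inv) (metis inv_closed inv_equality inv_inv r_inv x)+
    then show ?thesis using x by (simp add: finite_carrier)
  qed (use f in \<open>simp add: conv_def supported_def\<close>)
qed

lemma conv_add_left: "(\<lambda>x. f x + g x) \<star> h = (\<lambda>x. (f \<star> h) x + (g \<star> h) x)"
  by (auto simp: fun_eq_iff conv_def distrib_right sum.distrib)

lemma conv_add_right: "h \<star> (\<lambda>x. f x + g x) = (\<lambda>x. (h \<star> f) x + (h \<star> g) x)"
  by (auto simp: fun_eq_iff conv_def distrib_left sum.distrib)

lemma conv_diff_left: "(\<lambda>x. f x - g x) \<star> h = (\<lambda>x. (f \<star> h) x - (g \<star> h) x)"
  by (auto simp: fun_eq_iff conv_def left_diff_distrib sum_subtractf)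

lemma conv_scale_left: "(\<lambda>x. c * f x) \<star> h = (\<lambda>x. c * (f \<star> h) x)"
  by (auto simp: fun_eq_iff conv_def sum_distrib_left mult.assoc)

lemma conv_scale_right: "h \<star> (\<lambda>x. c * f x) = (\<lambda>x. c * (h \<star> f) x)"
  by (auto simp: fun_eq_iff conv_def sum_distrib_left mult_ac)

lemma conv_zero_left [simp]: "(\<lambda>x. 0) \<star> h = (\<lambda>x. 0)"
  by (auto simp: fun_eq_iff conv_def)

lemma conv_zero_right [simp]: "h \<star> (\<lambda>x. 0) = (\<lambda>x. 0)"
  by (auto simp: fun_eq_iff conv_def)

lemma conv_sum_right: "h \<star> (\<lambda>x. \<Sum>i\<in>I. f i x) = (\<lambda>x. \<Sum>i\<in>I. (h \<star> f i) x)"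
  by (auto simp: fun_eq_iff conv_def sum_distrib_left intro: sum.swap)

lemma conv_of_int: "(\<lambda>x. of_int (f x)) \<star> (\<lambda>x. of_int (g x)) = (\<lambda>x. of_int ((f \<star> g) x))"
  by (auto simp: fun_eq_iff conv_def)

lemma conv_cnj: "(\<lambda>x. cnj (f x)) \<star> (\<lambda>x. cnj (g x)) = (\<lambda>x. cnj ((f \<star> g) x))"
  by (auto simp: fun_eq_iff conv_def cnj_sum)

text \<open>Class functions are exactly the central elements.\<close>

lemma conv_commute:
  assumes "class_fun f"
  shows "f \<star> g = g \<star> f"
proof
  fix x
  show "(f \<star> g) x = (g \<star> f) x"
  proof (cases "x \<in> carrier G")
    case x: True
    have "(f \<star> g) x = (\<Sum>y\<in>carrier G. f (x \<otimes> inv y) * g (inv (x \<otimes> inv y) \<otimes> x))"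
      unfolding conv_def using x sum_inv_translate[OF x, of "\<lambda>y. f y * g (inv y \<otimes> x)"] by simp
    also have "\<dots> = (\<Sum>y\<in>carrier G. g y * f (inv y \<otimes> x))"
      using x assms by (intro sum.cong HOL.refl) (simp add: inv_mult_group m_assoc class_fun_def mult.commute)
    finally show ?thesis using x by (simp add: conv_def)
  qed (simp add: conv_def)
qed

lemma class_funD:
  assumes "class_fun f" "x \<in> carrier G" "y \<in> carrier G"
  shows "f (inv y \<otimes> x \<otimes> y) = f x"
proof -
  have "f (inv y \<otimes> (x \<otimes> y)) = f ((x \<otimes> y) \<otimes> inv y)"
    using assms unfolding class_fun_def by simp
  then show ?thesis using assms by (simp add: m_assoc)
qed

lemma class_funI:
  assumes "supported f" "\<And>x y. x \<in> carrier G \<Longrightarrow> y \<in> carrier G \<Longrightarrow> f (inv y \<otimes> x \<otimes> y) = f x"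
  shows "class_fun f"
  unfolding class_fun_def
proof (intro conjI ballI)
  fix x y assume xy: "x \<in> carrier G" "y \<in> carrier G"
  show "f (x \<otimes> y) = f (y \<otimes> x)" using xy assms(2)[of "x \<otimes> y" x] by (simp add: m_assoc)
qed (rule assms)

lemma class_fun_conv:
  assumes "class_fun f" "class_fun g"
  shows "class_fun (f \<star> g)"
proof (rule class_funI)
  fix x y assume xy: "x \<in> carrier G" "y \<in> carrier G"
  have "(f \<star> g) (inv y \<otimes> x \<otimes> y) = (\<Sum>z\<in>carrier G. f z * g (inv z \<otimes> (inv y \<otimes> x \<otimes> y)))"
    using xy by (simp add: conv_def)
  also have "\<dots> = (\<Sum>z\<in>carrier G. f (inv y \<otimes> z \<otimes> y) * g (inv (inv y \<otimes> z \<otimes> y) \<otimes> (inv y \<otimes> x \<otimes> y)))"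
    by (rule sum.reindex_bij_witness[of _ "\<lambda>z. inv y \<otimes> z \<otimes> y" "\<lambda>z. y \<otimes> z \<otimes> inv y"])
       (use xy in \<open>auto simp: m_assoc inv_solve_left\<close>)
  also have "\<dots> = (\<Sum>z\<in>carrier G. f (inv y \<otimes> z \<otimes> y) * g (inv y \<otimes> (inv z \<otimes> x) \<otimes> y))"
  proof (intro sum.cong HOL.refl)
    fix z assume z: "z \<in> carrier G"
    have "y \<otimes> (inv y \<otimes> (x \<otimes> y)) = x \<otimes> y" using xy by (simp add: m_assoc[symmetric])
    then have "inv (inv y \<otimes> z \<otimes> y) \<otimes> (inv y \<otimes> x \<otimes> y) = inv y \<otimes> (inv z \<otimes> x) \<otimes> y"
      using z xy by (simp add: inv_mult_group m_assoc)
    then show "f (inv y \<otimes> z \<otimes> y) * g (inv (inv y \<otimes> z \<otimes> y) \<otimes> (inv y \<otimes> x \<otimes> y))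
        = f (inv y \<otimes> z \<otimes> y) * g (inv y \<otimes> (inv z \<otimes> x) \<otimes> y)" by simp
  qed
  also have "\<dots> = (f \<star> g) x"
    using xy by (auto simp: conv_def class_funD[OF assms(1)] class_funD[OF assms(2)] intro!: sum.cong)
  finally show "(f \<star> g) (inv y \<otimes> x \<otimes> y) = (f \<star> g) x" .
qed (rule supported_conv)

lemma conv_inv:
  assumes "x \<in> carrier G"
  shows "(f \<star> g) (inv x) = ((\<lambda>x. g (inv x)) \<star> (\<lambda>x. f (inv x))) x"
proof -
  have "(f \<star> g) (inv x) = (\<Sum>y\<in>carrier G. f y * g (inv y \<otimes> inv x))"
    using assms by (simp add: conv_def)
  also have "\<dots> = (\<Sum>y\<in>carrier G. f (inv x \<otimes> y) * g (inv (inv x \<otimes> y) \<otimes> inv x))"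
    using assms by (intro sum_left_translate) simp
  also have "\<dots> = (\<Sum>y\<in>carrier G. g (inv y) * f (inv (inv y \<otimes> x)))"
    using assms by (intro sum.cong HOL.refl) (simp add: inv_mult_group m_assoc mult.commute)
  finally show ?thesis using assms by (simp add: conv_def)
qed

lemma sym_class_fun_conv:
  assumes "sym_class_fun f" "sym_class_fun g"
  shows "sym_class_fun (f \<star> g)"
  unfolding sym_class_fun_def
proof (intro conjI ballI)
  show "class_fun (f \<star> g)" using assms class_fun_conv by (auto simp: sym_class_fun_def)
  fix x assume x: "x \<in> carrier G"
  have "(f \<star> g) (inv x) = ((\<lambda>x. g (inv x)) \<star> (\<lambda>x. f (inv x))) x" by (rule conv_inv[OF x])
  also have "\<dots> = (g \<star> f) x"
    using x assms by (auto simp: conv_def sym_class_fun_def intro!: sum.cong)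
  also have "\<dots> = (f \<star> g) x" using conv_commute[of f g] assms by (simp add: sym_class_fun_def)
  finally show "(f \<star> g) (inv x) = (f \<star> g) x" .
qed

lemma sym_class_fun_delta: "sym_class_fun delta"
  unfolding sym_class_fun_def
proof (intro conjI ballI class_funI)
  show "supported delta" by (auto simp: supported_def delta_def)
  show "delta (inv y \<otimes> x \<otimes> y) = delta x" if "x \<in> carrier G" "y \<in> carrier G" for x y
  proof -
    have "inv y \<otimes> x \<otimes> y = \<one> \<longleftrightarrow> x = \<one>"
    proof
      assume "inv y \<otimes> x \<otimes> y = \<one>"
      then have "inv y \<otimes> x = inv y" using that by (metis inv_closed inv_equality inv_inv m_closed)
      then show "x = \<one>" using that by simp
    qed (use that in simp)
    then show ?thesis by (simp add: delta_def)
  qed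
  show "delta (inv x) = delta x" if "x \<in> carrier G" for x
    using that by (auto simp: delta_def)
qed

lemma sym_class_fun_add: "sym_class_fun f \<Longrightarrow> sym_class_fun g \<Longrightarrow> sym_class_fun (\<lambda>x. f x + g x)"
  by (auto simp: sym_class_fun_def class_fun_def supported_def)

lemma sym_class_fun_scale: "sym_class_fun f \<Longrightarrow> sym_class_fun (\<lambda>x. c * f x)"
  by (auto simp: sym_class_fun_def class_fun_def supported_def)

lemma sym_class_fun_supported: "sym_class_fun f \<Longrightarrow> supported f"
  by (auto simp: sym_class_fun_def class_fun_def)

lemma sym_class_fun_commute: "sym_class_fun f \<Longrightarrow> f \<star> g = g \<star> f"
  using conv_commute by (auto simp: sym_class_fun_def)


section \<open>Polynomials in a central element and its spectrum\<close>

definition conv_power :: "('a \<Rightarrow> 'c::comm_ring_1) \<Rightarrow> nat \<Rightarrow> 'a \<Rightarrow> 'c" where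
  "conv_power K n = ((\<lambda>f. K \<star> f) ^^ n) delta"

definition peval :: "'c::comm_ring_1 poly \<Rightarrow> ('a \<Rightarrow> 'c) \<Rightarrow> 'a \<Rightarrow> 'c" where
  "peval p K x = (\<Sum>i\<le>degree p. coeff p i * conv_power K i x)"

lemma conv_power_0 [simp]: "conv_power K 0 = delta"
  and conv_power_Suc: "conv_power K (Suc n) = K \<star> conv_power K n"
  by (simp_all add: conv_power_def)

lemma peval_eq_sum:
  assumes "degree p \<le> n"
  shows "peval p K x = (\<Sum>i\<le>n. coeff p i * conv_power K i x)"
  unfolding peval_def
  by (rule sum.mono_neutral_left) (use assms in \<open>auto simp: coeff_eq_0\<close>)

lemma peval_0 [simp]: "peval 0 K = (\<lambda>x. 0)"
  by (simp add: peval_def fun_eq_iff)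

lemma peval_add: "peval (p + q) K = (\<lambda>x. peval p K x + peval q K x)"
proof
  fix x
  let ?n = "max (degree p) (degree q)"
  have "peval (p + q) K x = (\<Sum>i\<le>?n. coeff (p + q) i * conv_power K i x)"
    by (rule peval_eq_sum) (rule degree_add_le_max)
  then show "peval (p + q) K x = peval p K x + peval q K x"
    using peval_eq_sum[of p ?n K x] peval_eq_sum[of q ?n K x]
    by (simp add: algebra_simps sum.distrib)
qed

lemma peval_smult: "peval (smult c p) K = (\<lambda>x. c * peval p K x)"
proof
  fix x
  have "peval (smult c p) K x = (\<Sum>i\<le>degree p. coeff (smult c p) i * conv_power K i x)"
    by (rule peval_eq_sum) (rule degree_smult_le)
  then show "peval (smult c p) K x = c * peval p K x"
    by (simp add: peval_def sum_distrib_left mult.assoc)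
qed

lemma peval_pCons: "peval (pCons c p) K = (\<lambda>x. c * delta x + (K \<star> peval p K) x)"
proof
  fix x
  have "peval (pCons c p) K x = (\<Sum>i\<le>Suc (degree p). coeff (pCons c p) i * conv_power K i x)"
    by (rule peval_eq_sum) (rule degree_pCons_le)
  also have "\<dots> = c * delta x + (\<Sum>i\<le>degree p. coeff p i * (K \<star> conv_power K i) x)"
    by (subst sum.atMost_Suc_shift) (simp add: conv_power_Suc)
  also have "(\<Sum>i\<le>degree p. coeff p i * (K \<star> conv_power K i) x) = (K \<star> peval p K) x"
    unfolding peval_def conv_sum_right conv_scale_right ..
  finally show "peval (pCons c p) K x = c * delta x + (K \<star> peval p K) x" .
qed

lemma peval_const: "peval [:c:] K = (\<lambda>x. c * delta x)"
  by (simp add: peval_pCons)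

lemma peval_1: "peval 1 K = delta"
  by (simp add: peval_pCons one_pCons)

lemma peval_X: "supported K \<Longrightarrow> peval [:0, 1:] K = K"
  by (simp add: peval_pCons one_pCons conv_delta)

lemma peval_diff: "peval (p - q) K = (\<lambda>x. peval p K x - peval q K x)"
  using peval_add[of p "-q" K] peval_smult[of "-1" q K] by simp

lemma supported_peval: "supported (peval p K)"
  by (induction p) (auto simp: peval_pCons supported_def conv_def delta_def)

lemma peval_mult: "peval (p * q) K = peval p K \<star> peval q K"
proof (induction p)
  case (pCons c p)
  have "peval (pCons c p * q) K = (\<lambda>x. c * peval q K x + (K \<star> (peval p K \<star> peval q K)) x)"
    by (simp add: peval_add peval_smult peval_pCons pCons.IH)
  also have "\<dots> = peval (pCons c p) K \<star> peval q K"
    by (simp add: peval_pCons conv_add_left conv_scale_left delta_conv[OF supported_peval] conv_assoc)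
  finally show ?case .
qed simp

lemma peval_power: "peval ([:0, 1:] ^ n) K = conv_power K n" if "supported K"
  by (induction n) (simp_all add: peval_1 peval_mult peval_X[OF that] conv_power_Suc del: mult_pCons_left mult_pCons_right)

lemma sym_class_fun_peval:
  assumes "sym_class_fun K"
  shows "sym_class_fun (peval p K)"
proof (induction p)
  case 0
  then show ?case by (simp add: sym_class_fun_def class_fun_def supported_def)
next
  case (pCons c p)
  then show ?case unfolding peval_pCons
    by (intro sym_class_fun_add sym_class_fun_scale sym_class_fun_delta sym_class_fun_conv assms)
qed

lemma peval_of_int:
  "peval (map_poly of_int p :: 'c::comm_ring_1 poly) (\<lambda>x. of_int (K x)) = (\<lambda>x. of_int (peval p K x))"
proof (induction p)
  case (pCons c p)
  have "(map_poly of_int (pCons c p) :: 'c poly) = pCons (of_int c) (map_poly of_int p)"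
    by (intro poly_eqI) (simp add: coeff_map_poly coeff_pCons split: nat.split)
  then show ?case by (simp only: peval_pCons pCons.IH conv_of_int) (auto simp: delta_def)
qed simp

lemma map_poly_cnj_pCons: "map_poly cnj (pCons c p) = pCons (cnj c) (map_poly cnj p)"
  by (intro poly_eqI) (simp add: coeff_map_poly coeff_pCons split: nat.split)

lemma poly_map_poly_cnj: "poly (map_poly cnj p) z = cnj (poly p (cnj z))"
  by (induction p) (simp_all add: map_poly_cnj_pCons)

lemma peval_cnj: "peval (map_poly cnj p) (\<lambda>x. cnj (K x)) = (\<lambda>x. cnj (peval p K x))"
proof (induction p)
  case (pCons c p)
  show ?case by (simp only: map_poly_cnj_pCons peval_pCons pCons.IH conv_cnj) (auto simp: delta_def)
qed simp

lemma peval_eigenvector: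
  assumes "K \<star> w = (\<lambda>x. \<alpha> * w x)" "supported w"
  shows "peval p K \<star> w = (\<lambda>x. poly p \<alpha> * w x)"
proof (induction p)
  case (pCons c p)
  show ?case
    by (simp add: peval_pCons conv_add_left conv_scale_left delta_conv[OF assms(2)] conv_assoc pCons.IH
        conv_scale_right assms(1)) (simp add: algebra_simps)
qed simp

end

text \<open>Gaussian elimination on the coordinates: more vectors than coordinates are linearly dependent.\<close>

lemma exists_linear_relation:
  fixes v :: "'i \<Rightarrow> 'b \<Rightarrow> 'c::field"
  assumes "finite S" "finite I" "card I > card S"
  shows "\<exists>c. (\<exists>i\<in>I. c i \<noteq> 0) \<and> (\<forall>x\<in>S. (\<Sum>i\<in>I. c i * v i x) = 0)"
  using assms
proof (induction S arbitrary: I v rule: finite_induct)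
  case empty
  then have "I \<noteq> {}" by auto
  then show ?case by (intro exI[of _ "\<lambda>_. 1"]) auto
next
  case (insert x0 S)
  show ?case
  proof (cases "\<forall>i\<in>I. v i x0 = 0")
    case True
    obtain c where "\<exists>i\<in>I. c i \<noteq> 0" "\<forall>x\<in>S. (\<Sum>i\<in>I. c i * v i x) = 0"
      using insert.IH[of I v] insert.prems insert.hyps by auto
    with True show ?thesis by (intro exI[of _ c]) auto
  next
    case False
    then obtain i0 where i0: "i0 \<in> I" "v i0 x0 \<noteq> 0" by auto
    define J where "J = I - {i0}"
    have J: "finite J" "card J > card S" "i0 \<notin> J" "I = insert i0 J"
      using insert.prems insert.hyps i0 by (auto simp: J_def)
    obtain c where c: "\<exists>i\<in>J. c i \<noteq> 0"
      "\<forall>x\<in>S. (\<Sum>i\<in>J. c i * (v i x - v i x0 / v i0 x0 * v i0 x)) = 0"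
      using insert.IH[OF J(1,2), of "\<lambda>i x. v i x - v i x0 / v i0 x0 * v i0 x"] by auto
    define d where "d = c(i0 := - (\<Sum>i\<in>J. c i * v i x0) / v i0 x0)"
    have sum_d: "(\<Sum>i\<in>I. d i * v i x) = d i0 * v i0 x + (\<Sum>i\<in>J. c i * v i x)" for x
    proof -
      have "(\<Sum>i\<in>J. d i * v i x) = (\<Sum>i\<in>J. c i * v i x)"
        using J(3) by (intro sum.cong HOL.refl) (auto simp: d_def)
      then show ?thesis using J by simp
    qed
    have "(\<Sum>i\<in>I. d i * v i x) = (\<Sum>i\<in>J. c i * (v i x - v i x0 / v i0 x0 * v i0 x))" for x
      unfolding sum_d
      by (simp add: d_def algebra_simps sum_subtractf sum_distrib_left sum_distrib_right sum_divide_distrib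
          sum_negf)
    then have "\<forall>x\<in>insert x0 S. (\<Sum>i\<in>I. d i * v i x) = 0"
      using c(2) i0(2) by auto
    moreover have "\<exists>i\<in>I. d i \<noteq> 0" using c(1) J by (auto simp: d_def)
    ultimately show ?thesis by blast
  qed
qed

context finite_group
begin

text \<open>The projections onto the eigenspaces of \<open>K\<close>, restricted to those that are polynomials in \<open>K\<close> and
  have a real eigenvalue; \<open>spectral_theorem\<close> shows that they suffice.\<close>

definition spectral_idempotent :: "('a \<Rightarrow> int) \<Rightarrow> complex \<Rightarrow> ('a \<Rightarrow> complex) \<Rightarrow> bool" where
  "spectral_idempotent K \<alpha> e \<longleftrightarrow> (\<exists>p. e = peval p (\<lambda>x. of_int (K x))) \<and> e \<noteq> (\<lambda>x. 0) \<and> e \<star> e = e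
     \<and> (\<lambda>x. of_int (K x)) \<star> e = (\<lambda>x. \<alpha> * e x) \<and> \<alpha> \<in> \<real>"

lemma peval_annihilator_exists:
  fixes K :: "'a \<Rightarrow> 'c::field"
  shows "\<exists>q. q \<noteq> 0 \<and> peval q K = (\<lambda>x. 0)"
proof -
  have "card {..card (carrier G)} > card (carrier G)" by simp
  from exists_linear_relation[OF finite_carrier _ this, of "conv_power K"]
  obtain c where c: "\<exists>i\<in>{..card (carrier G)}. c i \<noteq> 0"
    "\<forall>x\<in>carrier G. (\<Sum>i\<le>card (carrier G). c i * conv_power K i x) = 0" by auto
  define q where "q = Poly (map c [0..<Suc (card (carrier G))])"
  have co: "coeff q i = (if i \<le> card (carrier G) then c i else 0)" for i
    by (auto simp: q_def nth_default_def simp del: upt_Suc)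
  have "degree q \<le> card (carrier G)" by (rule degree_le) (simp add: co)
  then have "peval q K x = 0" for x
    using c(2) peval_eq_sum[of q "card (carrier G)" K x] supported_peval[of q K]
    by (cases "x \<in> carrier G") (auto simp: co supported_def)
  moreover have "q \<noteq> 0" using c(1) co by (metis atMost_iff coeff_0)
  ultimately show ?thesis by blast
qed

text \<open>If \<open>z = Z(K)\<close> is not zero, a polynomial \<open>q\<close> of least degree with \<open>q(K) z = 0\<close> has a root \<open>\<alpha>\<close>, and
  cancelling the factor of \<open>\<alpha>\<close> turns \<open>z\<close> into an eigenvector \<open>w\<close>. The positive number
  \<open>(w' w)(1)\<close>, with \<open>w'\<close> the complex conjugate of \<open>w\<close>, plays the role of the norm of \<open>w\<close>: as for
  symmetric matrices it makes \<open>\<alpha>\<close> real and prevents \<open>w\<close> from being nilpotent, so that a multiple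
  of \<open>w\<close> is an idempotent.\<close>

lemma spectral_theorem:
  fixes K :: "'a \<Rightarrow> int" and Z :: "complex poly"
  assumes K: "sym_class_fun K"
    and Z: "\<And>\<alpha> e. spectral_idempotent K \<alpha> e \<Longrightarrow> poly Z \<alpha> = 0"
  shows "peval Z (\<lambda>x. of_int (K x)) = (\<lambda>x. 0)"
proof (rule ccontr)
  let ?K = "\<lambda>x. of_int (K x) :: complex"
  define z where "z = peval Z ?K"
  assume "peval Z (\<lambda>x. of_int (K x)) \<noteq> (\<lambda>x. 0)"
  then have z: "z \<noteq> (\<lambda>x. 0)" by (simp add: z_def)
  have symK: "sym_class_fun ?K" using K by (auto simp: sym_class_fun_def class_fun_def supported_def)
  have sym: "sym_class_fun (peval p ?K)" for p by (rule sym_class_fun_peval[OF symK])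
  define Q where "Q = {q. q \<noteq> 0 \<and> peval q ?K \<star> z = (\<lambda>x. 0)}"
  obtain q0 where "q0 \<noteq> 0" "peval q0 ?K = (\<lambda>x. 0)" using peval_annihilator_exists[of ?K] by blast
  then have "q0 \<in> Q" by (simp add: Q_def)
  then obtain q where q: "q \<in> Q" and qmin: "\<And>q'. q' \<in> Q \<Longrightarrow> degree q \<le> degree q'"
    using ex_has_least_nat[of "\<lambda>q. q \<in> Q" q0 degree] by auto
  have "degree q \<noteq> 0"
  proof
    assume "degree q = 0"
    then obtain c where c: "q = [:c:]" by (rule degree_eq_zeroE)
    then have "(\<lambda>x. c * z x) = (\<lambda>x. 0)" "c \<noteq> 0"
      using q by (auto simp: Q_def peval_const conv_scale_left delta_conv supported_peval z_def)
    with z show False by (auto simp: fun_eq_iff)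
  qed
  then have "\<not> constant (poly q)" by (simp add: constant_degree)
  then obtain \<alpha> where "poly q \<alpha> = 0" using fundamental_theorem_of_algebra by blast
  then obtain s where s: "q = [:-\<alpha>, 1:] * s" by (auto simp: poly_eq_0_iff_dvd)
  define P where "P = s * Z"
  define w where "w = peval P ?K"
  have w_s: "w = peval s ?K \<star> z" by (simp add: w_def P_def z_def peval_mult)
  have "s \<noteq> 0" using s q by (auto simp: Q_def)
  then have "degree q = Suc (degree s)" unfolding s by (subst degree_mult_eq) auto
  then have "s \<notin> Q" using qmin[of s] by auto
  then have w: "w \<noteq> (\<lambda>x. 0)" using \<open>s \<noteq> 0\<close> by (auto simp: Q_def w_s)
  have supp: "supported w" by (simp add: w_def supported_peval)
  have "peval [:-\<alpha>, 1:] ?K \<star> w = (\<lambda>x. 0)"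
  proof -
    have "peval [:-\<alpha>, 1:] ?K \<star> w = peval q ?K \<star> z"
      unfolding s w_s by (simp only: peval_mult conv_assoc)
    then show ?thesis using q by (simp add: Q_def)
  qed
  then have Kw: "?K \<star> w = (\<lambda>x. \<alpha> * w x)"
    using sym_class_fun_supported[OF symK]
    by (simp add: peval_pCons one_pCons conv_diff_left conv_scale_left delta_conv[OF supp] conv_delta fun_eq_iff)
  define w' where "w' = (\<lambda>x. cnj (w x))"
  have w'_peval: "w' = peval (map_poly cnj P) ?K"
    using peval_cnj[of P ?K] by (simp add: w'_def w_def)
  define c where "c = poly (map_poly cnj P) \<alpha>"
  have v: "w' \<star> w = (\<lambda>x. c * w x)"
    unfolding w'_peval c_def by (rule peval_eigenvector[OF Kw supp])
  \<comment> \<open>Since \<open>w\<close> is invariant under inversion, the coefficient at the neutral element is the squared norm.\<close>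
  have "(w' \<star> w) \<one> = (\<Sum>y\<in>carrier G. of_real ((cmod (w y))\<^sup>2))"
    using sym[of P]
    by (auto simp: conv_def w'_def w_def sym_class_fun_def complex_norm_square[symmetric] mult.commute[of "cnj _"] intro!: sum.cong)
  also have "\<dots> = of_real (\<Sum>y\<in>carrier G. (cmod (w y))\<^sup>2)" by simp
  also have "\<dots> \<noteq> 0"
  proof -
    obtain x where x: "w x \<noteq> 0" using w by (auto simp: fun_eq_iff)
    then have "x \<in> carrier G" using supp by (auto simp: supported_def)
    then have "(\<Sum>y\<in>carrier G. (cmod (w y))\<^sup>2) > 0"
      using x by (intro sum_pos2[OF finite_carrier]) auto
    then show ?thesis by (metis of_real_eq_0_iff less_irrefl)
  qed
  finally have v1: "(w' \<star> w) \<one> \<noteq> 0" .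
  then have c: "c \<noteq> 0" by (simp add: v)
  have Kw': "?K \<star> w' = (\<lambda>x. cnj \<alpha> * w' x)"
  proof -
    have "?K \<star> w' = (\<lambda>x. cnj ((?K \<star> w) x))" using conv_cnj[of ?K w] by (simp add: w'_def)
    then show ?thesis by (simp add: Kw w'_def)
  qed
  \<comment> \<open>\<open>w'\<close> is an eigenvector for \<open>cnj \<alpha>\<close>, and \<open>w' \<star> w\<close> is one for both eigenvalues.\<close>
  have "cnj \<alpha> * (w' \<star> w) \<one> = (?K \<star> (w' \<star> w)) \<one>"
    by (simp add: conv_assoc[symmetric] Kw' conv_scale_left)
  also have "\<dots> = \<alpha> * (w' \<star> w) \<one>"
    by (simp add: v conv_scale_right Kw)
  finally have real: "cnj \<alpha> = \<alpha>" using v1 by simp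
  have P\<alpha>: "poly P \<alpha> \<noteq> 0"
  proof -
    have "c = cnj (poly P (cnj \<alpha>))" unfolding c_def by (rule poly_map_poly_cnj)
    with c real show ?thesis by auto
  qed
  have ww: "w \<star> w = (\<lambda>x. poly P \<alpha> * w x)"
    by (subst (1) w_def) (rule peval_eigenvector[OF Kw supp])
  define e where "e = (\<lambda>x. inverse (poly P \<alpha>) * w x)"
  have "spectral_idempotent K \<alpha> e"
    unfolding spectral_idempotent_def
  proof (intro conjI)
    show "\<exists>p. e = peval p ?K"
      by (rule exI[of _ "smult (inverse (poly P \<alpha>)) P"]) (simp add: e_def peval_smult w_def)
    show "e \<noteq> (\<lambda>x. 0)" using w P\<alpha> by (auto simp: e_def fun_eq_iff)
    show "e \<star> e = e" using P\<alpha> by (simp add: e_def conv_scale_left conv_scale_right ww fun_eq_iff)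
    show "?K \<star> e = (\<lambda>x. \<alpha> * e x)" unfolding e_def conv_scale_right Kw by (simp add: mult_ac)
    show "\<alpha> \<in> \<real>" using real by (simp add: Reals_cnj_iff)
  qed
  from Z[OF this] P\<alpha> show False by (simp add: P_def)
qed

end

section \<open>Units of infinite order in orders of number fields with a real embedding\<close>

text \<open>Coprime integer polynomials generate an ideal that contains a nonzero constant. An element \<open>s\<close> of
  least degree in the ideal divides, up to constants, every other one by pseudo-division; were it not
  constant, \<open>f\<close> would divide \<open>c\<close> up to a constant.\<close>

lemma prime_poly_bezout_constant:
  fixes f c :: "int poly"
  assumes f: "prime_elem f" and deg: "degree f > 0" and ndvd: "\<not> f dvd c"
  shows "\<exists>a b R. R \<noteq> 0 \<and> a * c + b * f = [:R:]"
proof -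
  define I where "I = {s. \<exists>a b. s = a * c + b * f}"
  have I_add: "s - s' \<in> I" if "s \<in> I" "s' \<in> I" for s s'
  proof -
    from that obtain a b a' b' where "s = a * c + b * f" "s' = a' * c + b' * f" by (auto simp: I_def)
    then have "s - s' = (a - a') * c + (b - b') * f" by (simp add: algebra_simps)
    then show ?thesis unfolding I_def by blast
  qed
  have I_mult: "s * q \<in> I" if "s \<in> I" for s q
  proof -
    from that obtain a b where "s = a * c + b * f" by (auto simp: I_def)
    then have "s * q = (a * q) * c + (b * q) * f" by (simp add: algebra_simps)
    then show ?thesis unfolding I_def by blast
  qed
  have fI: "f \<in> I" unfolding I_def by (rule CollectI, rule exI[of _ 0], rule exI[of _ 1]) simp
  have cI: "c \<in> I" unfolding I_def by (rule CollectI, rule exI[of _ 1], rule exI[of _ 0]) simp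
  have f0: "f \<noteq> 0" using f by auto
  obtain s where s: "s \<in> I" "s \<noteq> 0" and smin: "\<And>s'. s' \<in> I \<Longrightarrow> s' \<noteq> 0 \<Longrightarrow> degree s \<le> degree s'"
    using ex_has_least_nat[of "\<lambda>s. s \<in> I \<and> s \<noteq> 0" f degree] fI f0 by auto
  have divides: "\<exists>k q. k \<noteq> 0 \<and> smult k g = s * q" if "g \<in> I" for g
  proof -
    obtain k q where k: "k \<noteq> 0" "smult k g = s * q + pseudo_mod g s"
      using pseudo_mod(1)[OF s(2), of g] by auto
    have "g * [:k:] - s * q \<in> I" by (intro I_add I_mult that s)
    then have "pseudo_mod g s \<in> I" using k(2) by (simp add: mult.commute[of g])
    then have "pseudo_mod g s = 0"
      using smin[of "pseudo_mod g s"] pseudo_mod(2)[OF s(2), of g] by force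
    with k show ?thesis by auto
  qed
  have "degree s = 0"
  proof (rule ccontr)
    assume ds: "degree s \<noteq> 0"
    obtain k q where k: "k \<noteq> 0" "smult k f = s * q" using divides[OF fI] by auto
    obtain k' q' where k': "k' \<noteq> 0" "smult k' c = s * q'" using divides[OF cI] by auto
    have "f dvd s * q" using k(2) by (metis dvd_smult dvd_refl)
    then consider "f dvd s" | "f dvd q" using f by (auto simp: prime_elem_dvd_mult_iff)
    then show False
    proof cases
      case 1
      then have "f dvd [:k':] * c" using k'(2) by auto
      then have "f dvd [:k':]" using f ndvd by (simp only: prime_elem_dvd_mult_iff) blast
      then have "degree f \<le> degree [:k':]" using k'(1) by (intro dvd_imp_degree_le) auto
      then show False using deg by simp
    next
      case 2
      then obtain q2 where "q = f * q2" by auto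
      then have "f * [:k:] = f * (s * q2)" using k(2) by (simp add: mult_ac)
      then have eq: "[:k:] = s * q2" using f0 by (simp only: mult_cancel_left) simp
      then have "q2 \<noteq> 0" using k(1) by auto
      then have "degree [:k:] = degree s + degree q2" unfolding eq using s(2) by (intro degree_mult_eq)
      then show False using ds by simp
    qed
  qed
  then obtain R where "s = [:R:]" by (rule degree_eq_zeroE)
  then show ?thesis using s by (auto simp: I_def) metis
qed

lemma det_abs_bound:
  fixes A :: "real mat"
  assumes A: "A \<in> carrier_mat n n" and E: "\<And>i j. i < n \<Longrightarrow> j < n \<Longrightarrow> \<bar>A $$ (i, j)\<bar> \<le> E"
  shows "\<bar>det A\<bar> \<le> fact n * E ^ n"
proof -
  have "\<bar>det A\<bar> = \<bar>\<Sum>p | p permutes {0..<n}. of_int (sign p) * (\<Prod>i = 0..<n. A $$ (i, p i))\<bar>"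
    using A by (simp add: det_def)
  also have "\<dots> \<le> (\<Sum>p | p permutes {0..<n}. E ^ n)"
  proof (rule order.trans[OF sum_abs sum_mono])
    fix p assume "p \<in> {p. p permutes {0..<n}}"
    then have p: "p permutes {0..<n}" by simp
    have "\<bar>\<Prod>i = 0..<n. A $$ (i, p i)\<bar> \<le> (\<Prod>i = 0..<n. E)"
      unfolding abs_prod by (intro prod_mono) (use p permutes_in_image[OF p] E in auto)
    then show "\<bar>of_int (sign p) * (\<Prod>i = 0..<n. A $$ (i, p i))\<bar> \<le> E ^ n"
      by (simp add: abs_mult sign_def)
  qed
  also have "\<dots> = fact n * E ^ n"
    by (simp add: card_permutations[of _ n])
  finally show ?thesis .
qed

abbreviation ieval :: "int poly \<Rightarrow> 'c::comm_ring_1 \<Rightarrow> 'c" where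
  "ieval p x \<equiv> poly (map_poly of_int p) x"

lemma ieval_simps [simp]:
  "ieval (p + q) x = ieval p x + ieval q x"
  "ieval (p - q) x = ieval p x - ieval q x"
  "ieval (p * q) x = ieval p x * ieval q x"
  "ieval (smult c p) x = of_int c * ieval p x"
  "ieval (monom c n) x = of_int c * x ^ n"
  "ieval (1 :: int poly) x = 1"
  "ieval [:c:] x = of_int c"
proof -
  have pc: "ieval (pCons a s) x = of_int a + x * ieval s x" for a s
    by (simp add: of_int_hom.map_poly_pCons_hom)
  show add: "ieval (p + q) x = ieval p x + ieval q x" for p q
  proof (induction p q rule: poly_induct2)
    case (pCons a p b q)
    then show ?case by (simp add: pc algebra_simps)
  qed simp
  show sm: "ieval (smult c p) x = of_int c * ieval p x" for c p
    by (induction p) (simp_all add: pc algebra_simps)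
  show "ieval (p - q) x = ieval p x - ieval q x"
    using add[of p "smult (-1) q"] sm[of "-1" q] by simp
  show "ieval (p * q) x = ieval p x * ieval q x"
    by (induction p) (simp_all add: pc algebra_simps add sm)
  show "ieval (monom c n) x = of_int c * x ^ n"
    by (simp add: map_poly_monom poly_monom)
  show "ieval (1 :: int poly) x = 1" by (simp add: one_pCons pc)
  show "ieval [:c:] x = of_int c" by (simp add: pc)
qed

lemma ieval_sum: "ieval (\<Sum>i\<in>I. p i) x = (\<Sum>i\<in>I. ieval (p i) x)"
  by (induction I rule: infinite_finite_induct) auto

lemma poly_eq_sum_monoms:
  assumes "degree c < d"
  shows "c = (\<Sum>k<d. monom (coeff c k) k)"
proof -
  have "c = (\<Sum>k\<le>degree c. monom (coeff c k) k)" by (rule poly_as_sum_of_monoms[symmetric])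
  also have "\<dots> = (\<Sum>k<d. monom (coeff c k) k)"
    by (rule sum.mono_neutral_left) (use assms in \<open>auto simp: coeff_eq_0\<close>)
  finally show ?thesis .
qed

text \<open>The ring of integer polynomials modulo the monic prime polynomial \<open>f\<close> is an order of rank \<open>d\<close> in a
  number field, and evaluation at \<open>\<alpha>\<close> is a real embedding. Elements are represented by
  polynomials of degree less than \<open>d\<close>.\<close>

locale real_order =
  fixes f :: "int poly" and d :: nat and \<alpha> :: real
  assumes prime_f: "prime_elem f" and monic: "lead_coeff f = 1"
    and deg_f: "degree f = d" and d2: "d \<ge> 2" and root: "ieval f \<alpha> = 0"
begin

definition xrem :: "nat \<Rightarrow> int poly" where
  "xrem s = pseudo_mod (monom 1 s) f"

text \<open>The matrix of multiplication by \<open>c\<close> in the basis \<open>1, x, \<dots>, x\<^sup>d\<^sup>-\<^sup>1\<close>; its determinant is the norm.\<close>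

definition mult_mat :: "int poly \<Rightarrow> int mat" where
  "mult_mat c = mat d d (\<lambda>(i, j). \<Sum>k<d. coeff c k * coeff (xrem (i + k)) j)"

lemma f0: "f \<noteq> 0" using prime_f by auto

lemma not_dvd_small: "c \<noteq> 0 \<Longrightarrow> degree c < d \<Longrightarrow> \<not> f dvd c"
  using dvd_imp_degree_le[of f c] deg_f by auto

lemma dvd_ieval: "f dvd p \<Longrightarrow> ieval p \<alpha> = 0"
  using root by (auto simp: dvd_def)

lemma xrem: "f dvd monom 1 s - xrem s" "degree (xrem s) < d"
proof -
  obtain q r where qr: "pseudo_divmod (monom 1 s) f = (q, r)" by force
  have "monom 1 s = f * q + r" using pseudo_divmod(1)[OF f0 qr] monic by simp
  then show "f dvd monom 1 s - xrem s" using qr by (simp add: xrem_def pseudo_mod_def)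
  show "degree (xrem s) < d" using pseudo_mod(2)[OF f0, of "monom 1 s"] deg_f d2
    by (auto simp: xrem_def)
qed

lemma mult_mat_carrier: "mult_mat c \<in> carrier_mat d d"
  by (simp add: mult_mat_def)

lemma mult_mat_row:
  assumes c: "degree c < d" and i: "i < d"
  shows "f dvd monom 1 i * c - (\<Sum>j<d. monom (mult_mat c $$ (i, j)) j)"
proof -
  have "(\<Sum>j<d. monom (mult_mat c $$ (i, j)) j) = (\<Sum>j<d. \<Sum>k<d. smult (coeff c k) (monom (coeff (xrem (i + k)) j) j))"
    using i by (simp add: mult_mat_def smult_monom monom_sum)
  also have "\<dots> = (\<Sum>k<d. smult (coeff c k) (\<Sum>j<d. monom (coeff (xrem (i + k)) j) j))"
    by (subst sum.swap) (simp add: smult_sum2)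
  also have "\<dots> = (\<Sum>k<d. smult (coeff c k) (xrem (i + k)))"
    using poly_eq_sum_monoms[OF xrem(2), symmetric] by simp
  finally have rhs: "(\<Sum>j<d. monom (mult_mat c $$ (i, j)) j) = (\<Sum>k<d. smult (coeff c k) (xrem (i + k)))" .
  have "monom 1 i * c = (\<Sum>k<d. smult (coeff c k) (monom 1 (i + k)))"
    by (subst poly_eq_sum_monoms[OF c]) (simp add: sum_distrib_left mult_monom smult_monom)
  then have "monom 1 i * c - (\<Sum>j<d. monom (mult_mat c $$ (i, j)) j)
      = (\<Sum>k<d. smult (coeff c k) (monom 1 (i + k) - xrem (i + k)))"
    by (simp add: rhs sum_subtractf smult_diff_right)
  then show ?thesis by (simp add: dvd_sum dvd_smult xrem(1))
qed

lemma row_combination: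
  assumes c: "degree c < d"
  shows "f dvd (\<Sum>i<d. monom (v i) i) * c - (\<Sum>j<d. monom (\<Sum>i<d. v i * mult_mat c $$ (i, j)) j)"
proof -
  have "(\<Sum>j<d. monom (\<Sum>i<d. v i * mult_mat c $$ (i, j)) j)
      = (\<Sum>i<d. smult (v i) (\<Sum>j<d. monom (mult_mat c $$ (i, j)) j))"
    by (simp add: monom_sum smult_sum2 smult_monom) (rule sum.swap)
  moreover have "(\<Sum>i<d. monom (v i) i) * c = (\<Sum>i<d. smult (v i) (monom 1 i * c))"
    by (simp add: sum_distrib_right smult_monom flip: mult_smult_left)
  ultimately have "(\<Sum>i<d. monom (v i) i) * c - (\<Sum>j<d. monom (\<Sum>i<d. v i * mult_mat c $$ (i, j)) j)
      = (\<Sum>i<d. smult (v i) (monom 1 i * c - (\<Sum>j<d. monom (mult_mat c $$ (i, j)) j)))"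
    by (simp add: sum_subtractf smult_diff_right)
  then show ?thesis using mult_mat_row[OF c] by (auto intro!: dvd_sum dvd_smult)
qed

text \<open>A vector in the kernel would be a polynomial of degree less than \<open>d\<close> that is annihilated by \<open>c\<close>
  modulo the prime polynomial \<open>f\<close>.\<close>

lemma norm_nonzero:
  assumes c: "degree c < d" "c \<noteq> 0"
  shows "det (mult_mat c) \<noteq> 0"
proof
  let ?M = "mult_mat c"
  assume "det ?M = 0"
  then have "det (transpose_mat ?M) = 0" using det_transpose[OF mult_mat_carrier] by simp
  then obtain v where v: "v \<in> carrier_vec d" "v \<noteq> 0\<^sub>v d" "transpose_mat ?M *\<^sub>v v = 0\<^sub>v d"
    using det_0_iff_vec_prod_zero[of "transpose_mat ?M" d] mult_mat_carrier[of c] by auto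
  have "(\<Sum>i<d. v $ i * ?M $$ (i, j)) = 0" if "j < d" for j
  proof -
    have "(transpose_mat ?M *\<^sub>v v) $ j = 0" using v(3) that by simp
    then show ?thesis using that v(1) mult_mat_carrier[of c]
      by (simp add: scalar_prod_def atLeast0LessThan mult.commute)
  qed
  then have "f dvd (\<Sum>i<d. monom (v $ i) i) * c"
    using row_combination[OF c(1), of "\<lambda>i. v $ i"] by simp
  moreover have "\<not> f dvd c" using c by (intro not_dvd_small)
  moreover have "\<not> f dvd (\<Sum>i<d. monom (v $ i) i)"
  proof (rule not_dvd_small)
    have co: "coeff (\<Sum>i<d. monom (v $ i) i) k = (if k < d then v $ k else 0)" for k
      by (simp add: coeff_sum sum.delta)
    show "(\<Sum>i<d. monom (v $ i) i) \<noteq> 0"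
    proof
      assume "(\<Sum>i<d. monom (v $ i) i) = 0"
      then have "v $ k = 0" if "k < d" for k using co[of k] that by simp
      then have "v = 0\<^sub>v d" using v(1) by (intro eq_vecI) auto
      then show False using v(2) by simp
    qed
    have "degree (\<Sum>i<d. monom (v $ i) i) \<le> d - 1"
      by (rule degree_le) (use co in auto)
    then show "degree (\<Sum>i<d. monom (v $ i) i) < d" using d2 by simp
  qed
  ultimately show False using prime_f by (simp add: prime_elem_dvd_mult_iff)
qed

text \<open>The first row of the adjugate matrix consists of the coefficients of a cofactor: every element divides its norm.\<close>

lemma cofactor_multiple:
  assumes c: "degree c < d"
  shows "\<exists>c'. f dvd c' * c - [:det (mult_mat c):]"
proof -
  let ?M = "mult_mat c"
  define v where "v i = adj_mat ?M $$ (0, i)" for i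
  have "(\<Sum>i<d. v i * ?M $$ (i, j)) = (if j = 0 then det ?M else 0)" if "j < d" for j
  proof -
    have "(adj_mat ?M * ?M) $$ (0, j) = (det ?M \<cdot>\<^sub>m 1\<^sub>m d) $$ (0, j)"
      using adj_mat(3)[OF mult_mat_carrier] by simp
    then show ?thesis
      using that d2 mult_mat_carrier[of c] adj_mat(1)[OF mult_mat_carrier[of c]]
      by (auto simp: scalar_prod_def atLeast0LessThan v_def)
  qed
  then have "(\<Sum>j<d. monom (\<Sum>i<d. v i * ?M $$ (i, j)) j) = (\<Sum>j<d. if j = 0 then [:det ?M:] else 0)"
    by (intro sum.cong HOL.refl) (auto simp: monom_0)
  then have "(\<Sum>j<d. monom (\<Sum>i<d. v i * ?M $$ (i, j)) j) = [:det ?M:]" using d2 by simp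
  then show ?thesis using row_combination[OF c, of v] by metis
qed

definition geo :: real where "geo = (\<Sum>i<d. \<bar>\<alpha>\<bar> ^ i)"

definition xrem_bound :: real where
  "xrem_bound = (\<Sum>s<2 * d. \<Sum>j<d. \<bar>of_int (coeff (xrem s) j)\<bar>)"

lemma geo_pos: "geo \<ge> 1"
proof -
  have "(\<Sum>i\<in>{0}. \<bar>\<alpha>\<bar> ^ i) \<le> geo" unfolding geo_def by (rule sum_mono2) (use d2 in auto)
  then show ?thesis by simp
qed

lemma mult_mat_bound:
  assumes "\<And>k. \<bar>coeff c k\<bar> \<le> int Q" and ij: "i < d" "j < d"
  shows "\<bar>of_int (mult_mat c $$ (i, j))\<bar> \<le> real d * real Q * xrem_bound"
proof -
  have "\<bar>of_int (mult_mat c $$ (i, j))\<bar> \<le> (\<Sum>k<d. \<bar>real_of_int (coeff c k * coeff (xrem (i + k)) j)\<bar>)"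
    using ij sum_abs[of "\<lambda>k. real_of_int (coeff c k * coeff (xrem (i + k)) j)" "{..<d}"]
    by (simp add: mult_mat_def)
  also have "\<dots> \<le> (\<Sum>k<d. real Q * xrem_bound)"
  proof (rule sum_mono)
    fix k assume k: "k \<in> {..<d}"
    have "\<bar>real_of_int (coeff (xrem (i + k)) j)\<bar> \<le> (\<Sum>j<d. \<bar>real_of_int (coeff (xrem (i + k)) j)\<bar>)"
      by (rule member_le_sum) (use ij in auto)
    also have "\<dots> \<le> xrem_bound" unfolding xrem_bound_def
      by (rule member_le_sum[of "i + k"]) (use ij k in \<open>auto intro: sum_nonneg\<close>)
    finally have 1: "\<bar>real_of_int (coeff (xrem (i + k)) j)\<bar> \<le> xrem_bound" .
    have 2: "\<bar>real_of_int (coeff c k)\<bar> \<le> real Q" using assms(1)[of k] by linarith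
    show "\<bar>real_of_int (coeff c k * coeff (xrem (i + k)) j)\<bar> \<le> real Q * xrem_bound"
      unfolding of_int_mult abs_mult by (rule mult_mono[OF 2 1]) auto
  qed
  finally show ?thesis by (simp add: mult.assoc)
qed

text \<open>Column operations replace the first column of the matrix of \<open>c\<close> by the values \<open>\<alpha>\<^sup>i c(\<alpha>)\<close>, as
  \<open>(1, \<alpha>, \<dots>, \<alpha>\<^sup>d\<^sup>-\<^sup>1)\<close> is an eigenvector. So the norm is \<open>c(\<alpha>)\<close> times a factor of size
  \<open>Q\<^sup>d\<^sup>-\<^sup>1\<close>, which usually comes from the product of the other conjugates of \<open>c\<close>.\<close>

lemma norm_bound:
  assumes c: "degree c < d" and Q: "\<And>k. \<bar>coeff c k\<bar> \<le> int Q"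
  shows "\<bar>of_int (det (mult_mat c))\<bar>
    \<le> geo * \<bar>ieval c \<alpha>\<bar> * (fact (d - 1) * (real d * real Q * xrem_bound) ^ (d - 1))"
proof -
  define A where "A = map_mat real_of_int (mult_mat c)"
  define U where "U = mat d d (\<lambda>(i, j). if j = 0 then \<alpha> ^ i else if i = j then 1 else 0)"
  have A: "A \<in> carrier_mat d d" by (simp add: A_def mult_mat_def)
  have U: "U \<in> carrier_mat d d" by (simp add: U_def)
  have A_entry: "A $$ (i, j) = of_int (mult_mat c $$ (i, j))" if "i < d" "j < d" for i j
    using that mult_mat_carrier[of c] by (simp add: A_def)
  have "det U = prod_list (diag_mat U)"
    by (rule det_lower_triangular[OF _ U]) (auto simp: U_def)
  also have "diag_mat U = map (\<lambda>_. 1) [0..<d]"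
    unfolding diag_mat_def using U by (auto simp: U_def)
  also have "prod_list \<dots> = 1" by (induction d) auto
  finally have "det U = 1" .
  then have det_AU: "det (A * U) = of_int (det (mult_mat c))"
    using det_mult[OF A U] by (simp add: A_def)
  have AU: "A * U \<in> carrier_mat d d" using A U by simp
  have AU_entry: "(A * U) $$ (i, j) = (if j = 0 then \<alpha> ^ i * ieval c \<alpha> else A $$ (i, j))"
    if "i < d" "j < d" for i j
  proof -
    have *: "(A * U) $$ (i, j) = (\<Sum>k<d. A $$ (i, k) * U $$ (k, j))"
      using that A U by (simp add: scalar_prod_def atLeast0LessThan)
    show ?thesis
    proof (cases "j = 0")
      case True
      have "ieval (monom 1 i * c - (\<Sum>j<d. monom (mult_mat c $$ (i, j)) j)) \<alpha> = 0"
        by (rule dvd_ieval[OF mult_mat_row[OF c that(1)]])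
      then have "\<alpha> ^ i * ieval c \<alpha> = (\<Sum>k<d. A $$ (i, k) * \<alpha> ^ k)"
        using that by (simp add: ieval_sum A_entry poly_monom)
      with True * that show ?thesis by (simp add: U_def)
    next
      case False
      have "(\<Sum>k<d. A $$ (i, k) * U $$ (k, j)) = (\<Sum>k<d. if k = j then A $$ (i, k) else 0)"
        using that False by (intro sum.cong HOL.refl) (simp add: U_def)
      with * False that show ?thesis by simp
    qed
  qed
  have cof: "\<bar>cofactor (A * U) i 0\<bar> \<le> fact (d - 1) * (real d * real Q * xrem_bound) ^ (d - 1)"
    if i: "i < d" for i
  proof -
    have "\<bar>det (mat_delete (A * U) i 0)\<bar> \<le> fact (d - 1) * (real d * real Q * xrem_bound) ^ (d - 1)"
    proof (rule det_abs_bound)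
      show "mat_delete (A * U) i 0 \<in> carrier_mat (d - 1) (d - 1)"
        using AU by (rule mat_delete_carrier)
      fix i' j' assume ij: "i' < d - 1" "j' < d - 1"
      have "mat_delete (A * U) i 0 $$ (i', j') = (A * U) $$ (if i' < i then i' else Suc i', Suc j')"
        unfolding mat_delete_def using ij AU A U by simp
      also have "\<dots> = of_int (mult_mat c $$ (if i' < i then i' else Suc i', Suc j'))"
        using ij by (subst AU_entry) (auto simp: A_entry)
      finally show "\<bar>mat_delete (A * U) i 0 $$ (i', j')\<bar> \<le> real d * real Q * xrem_bound"
        using mult_mat_bound[OF Q, of "if i' < i then i' else Suc i'" "Suc j'"] ij by auto
    qed
    then show ?thesis by (simp add: cofactor_def abs_mult power_abs)
  qed
  have "det (A * U) = (\<Sum>i<d. (A * U) $$ (i, 0) * cofactor (A * U) i 0)"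
    by (rule laplace_expansion_column[OF AU]) (use d2 in auto)
  also have "\<bar>\<dots>\<bar> \<le> (\<Sum>i<d. \<bar>\<alpha>\<bar> ^ i * \<bar>ieval c \<alpha>\<bar> * (fact (d - 1) * (real d * real Q * xrem_bound) ^ (d - 1)))"
  proof (rule order.trans[OF sum_abs sum_mono])
    fix i assume i: "i \<in> {..<d}"
    then show "\<bar>(A * U) $$ (i, 0) * cofactor (A * U) i 0\<bar>
      \<le> \<bar>\<alpha>\<bar> ^ i * \<bar>ieval c \<alpha>\<bar> * (fact (d - 1) * (real d * real Q * xrem_bound) ^ (d - 1))"
      using cof[of i] d2 AU_entry[of i 0]
      by (simp add: abs_mult power_abs mult_left_mono)
  qed
  finally show ?thesis unfolding det_AU by (simp add: geo_def sum_distrib_right)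
qed

text \<open>Minkowski's argument in the form of the pigeonhole principle: there are more than \<open>(2 Q)\<^sup>d\<close>
  coefficient vectors, and their values at \<open>\<alpha>\<close> fall into few intervals of length about
  \<open>1 / Q\<^sup>d\<^sup>-\<^sup>1\<close>.\<close>

lemma small_element:
  assumes Q: "Q \<ge> 1"
  shows "\<exists>c. c \<noteq> 0 \<and> degree c < d \<and> (\<forall>k. \<bar>coeff c k\<bar> \<le> int (2 * Q))
    \<and> \<bar>ieval c \<alpha>\<bar> \<le> 2 * geo / real Q ^ (d - 1)"
proof -
  define F where "F = {..<d} \<rightarrow>\<^sub>E {0..2 * Q}"
  define val where "val g = (\<Sum>i<d. real (g i) * \<alpha> ^ i)" for g :: "nat \<Rightarrow> nat"
  define T where "T = real Q ^ (d - 1) / (2 * geo)"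
  define box where "box g = \<lfloor>val g * T\<rfloor>" for g
  have Tpos: "T > 0" using geo_pos Q by (simp add: T_def)
  have Qd: "real Q ^ d = real Q * real Q ^ (d - 1)" using d2 by (cases d) auto
  have "box ` F \<subseteq> {- int (Q ^ d)..int (Q ^ d)}"
  proof safe
    fix g assume g: "g \<in> F"
    have "\<bar>val g\<bar> \<le> (\<Sum>i<d. real (2 * Q) * \<bar>\<alpha>\<bar> ^ i)"
      unfolding val_def
    proof (rule order.trans[OF sum_abs sum_mono])
      fix i assume "i \<in> {..<d}"
      then have "g i \<le> 2 * Q" using g by (auto simp: F_def PiE_def Pi_def)
      then show "\<bar>real (g i) * \<alpha> ^ i\<bar> \<le> real (2 * Q) * \<bar>\<alpha>\<bar> ^ i"
        by (simp add: abs_mult power_abs mult_right_mono)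
    qed
    also have "\<dots> = 2 * real Q * geo" by (simp add: geo_def sum_distrib_left)
    finally have "\<bar>val g\<bar> * T \<le> 2 * real Q * geo * T" using Tpos by (intro mult_right_mono) auto
    also have "\<dots> = real (Q ^ d)" using geo_pos Qd by (simp add: T_def)
    finally have "\<bar>val g * T\<bar> \<le> real (Q ^ d)" using Tpos by (simp add: abs_mult)
    then have 1: "- real (Q ^ d) \<le> val g * T" "val g * T \<le> real (Q ^ d)" by linarith+
    show "box g \<in> {- int (Q ^ d)..int (Q ^ d)}"
      unfolding box_def atLeastAtMost_iff
    proof
      show "- int (Q ^ d) \<le> \<lfloor>val g * T\<rfloor>" using 1(1) by (simp add: le_floor_iff)
      show "\<lfloor>val g * T\<rfloor> \<le> int (Q ^ d)" using 1(2) by (simp add: floor_le_iff) 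
    qed
  qed
  then have "card (box ` F) \<le> card {- int (Q ^ d)..int (Q ^ d)}" by (intro card_mono) auto
  also have "\<dots> = 2 * Q ^ d + 1" by (simp add: nat_add_distrib nat_mult_distrib nat_power_eq)
  also have "\<dots> < 4 * Q ^ d" using Q one_le_power[of Q d] by linarith
  also have "4 * Q ^ d \<le> 2 ^ d * Q ^ d" using power_increasing[of 2 d "2::nat"] d2 by simp
  also have "\<dots> = (2 * Q) ^ d" by (simp add: power_mult_distrib)
  also have "\<dots> \<le> card F" using power_mono[of "2 * Q" "Suc (2 * Q)" d] by (simp add: F_def card_PiE)
  finally have "\<not> inj_on box F" by (rule pigeonhole)
  then obtain g g' where g: "g \<in> F" "g' \<in> F" "g \<noteq> g'" "box g = box g'" by (auto simp: inj_on_def)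
  define c where "c = (\<Sum>i<d. monom (int (g i) - int (g' i)) i)"
  have co: "coeff c k = (if k < d then int (g k) - int (g' k) else 0)" for k
    by (simp add: c_def coeff_sum)
  have "\<exists>k<d. g k \<noteq> g' k"
    using PiE_ext[OF g(1)[unfolded F_def] g(2)[unfolded F_def]] g(3) by auto
  then have "c \<noteq> 0" using co by (metis coeff_0 of_nat_eq_iff right_minus_eq)
  moreover have "degree c \<le> d - 1" by (rule degree_le) (use co in auto)
  moreover have "\<bar>coeff c k\<bar> \<le> int (2 * Q)" for k
  proof (cases "k < d")
    case True
    then have "g k \<le> 2 * Q" "g' k \<le> 2 * Q" using g(1,2) by (auto simp: F_def PiE_def Pi_def)
    then show ?thesis using True by (simp add: co)
  qed (simp add: co)
  moreover have "\<bar>ieval c \<alpha>\<bar> \<le> 2 * geo / real Q ^ (d - 1)"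
  proof -
    have "ieval c \<alpha> = val g - val g'"
      by (simp add: c_def ieval_sum poly_monom val_def sum_subtractf left_diff_distrib)
    moreover have "\<bar>val g * T - val g' * T\<bar> \<le> 1" using g(4) unfolding box_def by linarith
    ultimately have "\<bar>ieval c \<alpha>\<bar> * T \<le> 1" using Tpos by (simp add: abs_mult flip: left_diff_distrib)
    then have "\<bar>ieval c \<alpha>\<bar> \<le> 1 / T" using Tpos by (simp add: pos_le_divide_eq)
    then show ?thesis by (simp add: T_def)
  qed
  ultimately show ?thesis using d2 by (intro exI[of _ c]) auto
qed

definition norm_max :: real where
  "norm_max = geo * (2 * geo) * (fact (d - 1) * (2 * real d * xrem_bound) ^ (d - 1))"

text \<open>In the product of the bounds in \<open>norm_bound\<close> and \<open>small_element\<close> the parameter \<open>Q\<close> cancels.\<close>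

lemma bounded_norm_small_element:
  assumes "\<epsilon> > 0"
  shows "\<exists>c. c \<noteq> 0 \<and> degree c < d \<and> \<bar>of_int (det (mult_mat c))\<bar> \<le> norm_max \<and> \<bar>ieval c \<alpha>\<bar> < \<epsilon>"
proof -
  obtain Q where "real Q > 2 * geo / \<epsilon>" using reals_Archimedean2 by blast
  moreover have "2 * geo / \<epsilon> > 0" using geo_pos assms by simp
  ultimately have Qpos: "real Q > 0" by linarith
  have Q: "Q \<ge> 1" "2 * geo / real Q < \<epsilon>"
    using Qpos \<open>real Q > 2 * geo / \<epsilon>\<close> assms by (simp_all add: pos_divide_less_eq mult.commute)
  obtain c where c: "c \<noteq> 0" "degree c < d" "\<And>k. \<bar>coeff c k\<bar> \<le> int (2 * Q)"
    "\<bar>ieval c \<alpha>\<bar> \<le> 2 * geo / real Q ^ (d - 1)" using small_element[OF Q(1)] by blast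
  have xb: "xrem_bound \<ge> 0" unfolding xrem_bound_def by (intro sum_nonneg) auto
  have "\<bar>of_int (det (mult_mat c))\<bar>
    \<le> geo * \<bar>ieval c \<alpha>\<bar> * (fact (d - 1) * (real d * real (2 * Q) * xrem_bound) ^ (d - 1))"
    using norm_bound[OF c(2,3)] .
  also have "\<dots> \<le> geo * (2 * geo / real Q ^ (d - 1)) * (fact (d - 1) * (real d * real (2 * Q) * xrem_bound) ^ (d - 1))"
    using c(4) geo_pos xb by (intro mult_right_mono mult_left_mono) auto
  also have "\<dots> = norm_max"
    using Q(1) by (simp add: norm_max_def power_mult_distrib)
  finally have "\<bar>of_int (det (mult_mat c))\<bar> \<le> norm_max" .
  moreover have "real Q ^ 1 \<le> real Q ^ (d - 1)" using Q d2 by (intro power_increasing) auto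
  then have "2 * geo / real Q ^ (d - 1) \<le> 2 * geo / real Q"
    using Q(1) geo_pos by (intro divide_left_mono) auto
  ultimately show ?thesis using c Q(2) by (intro exI[of _ c]) auto
qed

text \<open>The elements of bounded norm have infinitely many absolute values at \<open>\<alpha>\<close>, but only finitely many
  norms and residues modulo \<open>R\<close> times the norm. Two elements \<open>c\<^sub>1, c\<^sub>2\<close> that share these data and differ
  in absolute value have a unit as quotient, and the quotient is \<open>1\<close> modulo \<open>R\<close>.\<close>

theorem exists_unit_of_infinite_order:
  assumes R: "R \<noteq> 0"
  shows "\<exists>z z'. f dvd (1 + smult R z) * (1 + smult R z') - 1 \<and> \<bar>ieval (1 + smult R z) \<alpha>\<bar> \<noteq> 1"
proof -
  define C where "C = {c. c \<noteq> 0 \<and> degree c < d \<and> \<bar>of_int (det (mult_mat c))\<bar> \<le> norm_max}"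
  have ev_nz: "ieval c \<alpha> \<noteq> 0" if "c \<in> C" for c
  proof -
    obtain c' where "f dvd c' * c - [:det (mult_mat c):]"
      using cofactor_multiple[of c] \<open>c \<in> C\<close> by (auto simp: C_def)
    from dvd_ieval[OF this] have "ieval c' \<alpha> * ieval c \<alpha> = of_int (det (mult_mat c))" by simp
    then show ?thesis using norm_nonzero[of c] that by (auto simp: C_def)
  qed
  define V where "V = (\<lambda>c. \<bar>ieval c \<alpha>\<bar>) ` C"
  have "infinite V"
  proof
    assume fin: "finite V"
    define \<epsilon> where "\<epsilon> = Min (insert 1 V)"
    have "\<epsilon> > 0" using fin ev_nz by (auto simp: \<epsilon>_def V_def)
    then obtain c where "c \<in> C" "\<bar>ieval c \<alpha>\<bar> < \<epsilon>"
      using bounded_norm_small_element[of \<epsilon>] by (auto simp: C_def)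
    moreover have "\<epsilon> \<le> \<bar>ieval c \<alpha>\<bar>" using \<open>c \<in> C\<close> fin by (auto simp: \<epsilon>_def V_def)
    ultimately show False by simp
  qed
  have "\<forall>v\<in>V. \<exists>c. c \<in> C \<and> \<bar>ieval c \<alpha>\<bar> = v" by (auto simp: V_def)
  from bchoice[OF this] obtain pick where
    pick: "\<And>v. v \<in> V \<Longrightarrow> pick v \<in> C \<and> \<bar>ieval (pick v) \<alpha>\<bar> = v" by blast
  define N where "N v = det (mult_mat (pick v))" for v
  \<comment> \<open>Division by the norm \<open>n\<close> uses up a factor \<open>n\<close> of the modulus, and the factor \<open>R\<close> remains.\<close>
  define tag where "tag v = (N v, map (\<lambda>j. coeff (pick v) j mod (R * N v)) [0..<d])" for v
  define B where "B = \<lceil>norm_max\<rceil>"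
  have Nb: "\<bar>N v\<bar> \<le> B" "N v \<noteq> 0" if "v \<in> V" for v
    using pick[OF that] norm_nonzero[of "pick v"] unfolding N_def B_def C_def by (auto simp: le_ceiling_iff)
  have "tag ` V \<subseteq> {-B..B} \<times> {xs. set xs \<subseteq> {-(\<bar>R\<bar> * B)..\<bar>R\<bar> * B} \<and> length xs = d}"
  proof (rule image_subsetI)
    fix v assume v: "v \<in> V"
    have "\<bar>x mod (R * N v)\<bar> \<le> \<bar>R\<bar> * B" for x
    proof -
      have "\<bar>x mod (R * N v)\<bar> < \<bar>R * N v\<bar>" using R Nb(2)[OF v] by (simp add: abs_mod_less)
      also have "\<dots> \<le> \<bar>R\<bar> * B" using Nb(1)[OF v] by (simp add: abs_mult mult_left_mono)
      finally show ?thesis by simp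
    qed
    then have bd: "x mod (R * N v) \<in> {-(\<bar>R\<bar> * B)..\<bar>R\<bar> * B}" for x
      unfolding atLeastAtMost_iff abs_le_iff by (metis minus_le_iff)
    have "set (map (\<lambda>j. coeff (pick v) j mod (R * N v)) [0..<d]) \<subseteq> {-(\<bar>R\<bar> * B)..\<bar>R\<bar> * B}"
      unfolding set_map using bd by blast
    moreover have "N v \<in> {-B..B}" using Nb(1)[OF v] by auto
    ultimately show "tag v \<in> {-B..B} \<times> {xs. set xs \<subseteq> {-(\<bar>R\<bar> * B)..\<bar>R\<bar> * B} \<and> length xs = d}"
      unfolding tag_def by simp
  qed
  moreover have "finite ({-B..B} \<times> {xs. set xs \<subseteq> {-(\<bar>R\<bar> * B)..\<bar>R\<bar> * B} \<and> length xs = d})"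
    by (intro finite_cartesian_product finite_lists_length_eq) auto
  ultimately have "finite (tag ` V)" by (rule finite_subset)
  from pigeonhole_infinite[OF \<open>infinite V\<close> this]
  obtain v2 where v2: "v2 \<in> V" "infinite {v \<in> V. tag v = tag v2}" by auto
  then have "infinite ({v \<in> V. tag v = tag v2} - {v2})" by simp
  then have "{v \<in> V. tag v = tag v2} - {v2} \<noteq> {}" by (rule infinite_imp_nonempty)
  then obtain v1 where v1: "v1 \<in> V" "tag v1 = tag v2" "v1 \<noteq> v2" by blast
  define c1 where "c1 = pick v1"
  define c2 where "c2 = pick v2"
  define n where "n = N v2"
  have n: "n \<noteq> 0" "N v1 = n" using Nb v2 v1 by (auto simp: n_def tag_def)
  have cC: "c1 \<in> C" "c2 \<in> C" using pick v1 v2 by (auto simp: c1_def c2_def)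
  have cong: "(R * n) dvd (coeff c1 j - coeff c2 j)" for j
  proof (cases "j < d")
    case True
    then have "coeff c1 j mod (R * n) = coeff c2 j mod (R * n)"
      using v1(2) n unfolding tag_def c1_def c2_def n_def by (auto simp: map_eq_conv)
    then show ?thesis by (simp add: mod_eq_dvd_iff)
  next
    case False
    then show ?thesis using cC by (auto simp: C_def coeff_eq_0)
  qed
  define z0 where "z0 = map_poly (\<lambda>a. a div (R * n)) (c1 - c2)"
  have c12: "c1 = c2 + smult (R * n) z0"
    using cong by (intro poly_eqI) (simp add: z0_def coeff_map_poly)
  obtain c1' where c1': "f dvd c1' * c1 - [:n:]"
    using cofactor_multiple[of c1] cC n(2) by (auto simp: C_def c1_def N_def)
  obtain c2' where c2': "f dvd c2' * c2 - [:n:]"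
    using cofactor_multiple[of c2] cC n_def by (auto simp: C_def c2_def N_def)
  \<comment> \<open>\<open>c1 / c2 = 1 + R z0 (n / c2)\<close>, and \<open>c2'\<close> is \<open>n / c2\<close> modulo \<open>f\<close>; \<open>z'\<close> belongs to \<open>c2 / c1\<close>.\<close>
  define z where "z = z0 * c2'"
  define z' where "z' = - (z0 * c1')"
  have u1: "f dvd c1 * c2' - [:n:] * (1 + smult R z)"
  proof -
    have "c1 * c2' - [:n:] * (1 + smult R z) = c2' * c2 - [:n:]"
      by (simp add: c12 z_def algebra_simps smult_add_right)
    then show ?thesis using c2' by simp
  qed
  have u2: "f dvd c2 * c1' - [:n:] * (1 + smult R z')"
  proof -
    have "c2 * c1' - [:n:] * (1 + smult R z') = c1' * c1 - [:n:]"
      by (simp add: c12 z'_def algebra_simps smult_add_right)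
    then show ?thesis using c1' by simp
  qed
  have "f dvd [:n:] * [:n:] * ((1 + smult R z) * (1 + smult R z') - 1)"
  proof -
    have ident: "m * m * (u * u' - 1) = (p1 * q1 - m) * (p2 * q2) + m * (p2 * q2 - m)
      - (q1 * p2 - m * u) * (q2 * p1) - m * u * (q2 * p1 - m * u')" for m u u' p1 p2 q1 q2 :: "int poly"
      by (simp add: algebra_simps)
    show ?thesis unfolding ident[of "[:n:]" _ _ c1' c1 c2' c2]
      by (intro dvd_diff dvd_add dvd_mult2[OF c1'] dvd_mult[OF c2'] dvd_mult2[OF u1] dvd_mult[OF u2])
  qed
  moreover have "\<not> f dvd [:n:]" by (rule not_dvd_small) (use n d2 in auto)
  ultimately have "f dvd (1 + smult R z) * (1 + smult R z') - 1"
    using prime_f by (simp only: prime_elem_dvd_mult_iff) blast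
  moreover have "\<bar>ieval (1 + smult R z) \<alpha>\<bar> \<noteq> 1"
  proof
    assume 1: "\<bar>ieval (1 + smult R z) \<alpha>\<bar> = 1"
    have e1: "ieval c1 \<alpha> * ieval c2' \<alpha> = of_int n * ieval (1 + smult R z) \<alpha>"
      using dvd_ieval[OF u1] by simp
    have e2: "ieval c2' \<alpha> * ieval c2 \<alpha> = of_int n" using dvd_ieval[OF c2'] by simp
    have "\<bar>ieval c1 \<alpha>\<bar> * \<bar>ieval c2' \<alpha>\<bar> = \<bar>ieval c2 \<alpha>\<bar> * \<bar>ieval c2' \<alpha>\<bar>"
      using e1 e2 1 by (metis abs_mult mult.commute mult.right_neutral)
    moreover have "ieval c2' \<alpha> \<noteq> 0" using e2 n by auto
    ultimately have "\<bar>ieval c1 \<alpha>\<bar> = \<bar>ieval c2 \<alpha>\<bar>" by simp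
    then show False using pick v1 v2 by (metis c1_def c2_def)
  qed
  ultimately show ?thesis by blast
qed

end

section \<open>Inverse semi-rational groups\<close>

text \<open>The reduction from the units modulo \<open>N\<close> to those modulo a divisor \<open>n\<close> is onto. Adding \<open>n\<close> times the
  product of the primes that divide \<open>N\<close> but neither \<open>n\<close> nor \<open>i\<close> makes \<open>i\<close> prime to \<open>N\<close>.\<close>

lemma coprime_lift:
  fixes i n N :: nat
  assumes "coprime i n" "N > 0"
  shows "\<exists>k. [k = i] (mod n) \<and> coprime k N"
proof -
  define m where "m = \<Prod>{p \<in> prime_factors N. \<not> p dvd n \<and> \<not> p dvd i}"
  have m_iff: "p dvd m \<longleftrightarrow> p \<in> prime_factors N \<and> \<not> p dvd n \<and> \<not> p dvd i" if pr: "Factorial_Ring.prime p" for p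
  proof
    assume "p dvd m"
    then obtain q where q: "q \<in> prime_factors N" "\<not> q dvd n" "\<not> q dvd i" "p dvd q"
      unfolding m_def by (subst (asm) prime_dvd_prod_iff) (use pr in auto)
    then have "p = q" using pr by (auto simp: in_prime_factors_iff primes_dvd_imp_eq)
    with q show "p \<in> prime_factors N \<and> \<not> p dvd n \<and> \<not> p dvd i" by simp
  next
    assume "p \<in> prime_factors N \<and> \<not> p dvd n \<and> \<not> p dvd i"
    then show "p dvd m" unfolding m_def by (intro dvd_prodI[where f = "\<lambda>x. x"]) auto
  qed
  have "coprime (i + n * m) N"
  proof (rule ccontr)
    assume "\<not> coprime (i + n * m) N"
    then have "gcd (i + n * m) N \<noteq> 1" by (metis coprime_iff_gcd_eq_1)
    then obtain p where p: "Factorial_Ring.prime p" "p dvd gcd (i + n * m) N" using prime_factor_nat by blast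
    then have p: "Factorial_Ring.prime p" "p dvd i + n * m" "p dvd N" by auto
    have pN: "p \<in> prime_factors N" using p assms(2) by (auto simp: in_prime_factors_iff)
    have ni: "\<not> (p dvd i \<and> p dvd n)"
      using assms(1) p(1) by (metis coprime_common_divisor_nat not_prime_1)
    show False
    proof (cases "p dvd n * m")
      case True
      then have "p dvd i" using p(2) by (simp add: dvd_add_left_iff)
      moreover have "p dvd n \<or> p dvd m" using True p(1) by (simp add: prime_dvd_mult_iff)
      ultimately show False using ni m_iff[OF p(1)] by blast
    next
      case False
      then have "\<not> p dvd n" "\<not> p dvd m" by auto
      then have "p dvd i" using m_iff[OF p(1)] pN by blast
      then show False using p(2) False by (simp add: dvd_add_right_iff)
    qed
  qed
  moreover have "[i + n * m = i] (mod n)" by (simp add: cong_def)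
  ultimately show ?thesis by blast
qed

text \<open>The conjugacies are written without an inverse of the conjugating element \<open>g\<close>, the form in which
  they are checked in normal forms later.\<close>

definition inverse_semirational :: "('a, 'm) monoid_scheme \<Rightarrow> bool" where
  "inverse_semirational G \<longleftrightarrow>
     (\<forall>x\<in>carrier G. \<forall>k::nat. coprime k (card (carrier G)) \<longrightarrow>
        (\<exists>g\<in>carrier G. x [^]\<^bsub>G\<^esub> k \<otimes>\<^bsub>G\<^esub> g = g \<otimes>\<^bsub>G\<^esub> x \<or> x [^]\<^bsub>G\<^esub> k \<otimes>\<^bsub>G\<^esub> g = g \<otimes>\<^bsub>G\<^esub> inv\<^bsub>G\<^esub> x))"

subsection \<open>The trace of an idempotent\<close>

lemma mat_trace_mult_commute:
  fixes A B :: "'c::comm_ring_1 mat"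
  assumes "A \<in> carrier_mat n n" "B \<in> carrier_mat n n"
  shows "(\<Sum>i<n. (A * B) $$ (i, i)) = (\<Sum>i<n. (B * A) $$ (i, i))"
proof -
  have "(\<Sum>i<n. (A * B) $$ (i, i)) = (\<Sum>i<n. \<Sum>j<n. A $$ (i, j) * B $$ (j, i))"
    using assms by (intro sum.cong) (auto simp: scalar_prod_def atLeast0LessThan)
  also have "\<dots> = (\<Sum>j<n. \<Sum>i<n. B $$ (j, i) * A $$ (i, j))"
    by (subst sum.swap) (simp add: mult.commute)
  also have "\<dots> = (\<Sum>i<n. (B * A) $$ (i, i))"
    using assms by (intro sum.cong) (auto simp: scalar_prod_def atLeast0LessThan)
  finally show ?thesis .
qed

text \<open>Over the complex numbers the matrix is similar to a triangular one, whose diagonal entries are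
  idempotent, that is, \<open>0\<close> or \<open>1\<close>.\<close>

lemma idempotent_mat_trace_Ints:
  fixes A :: "complex mat"
  assumes A: "A \<in> carrier_mat n n" and idem: "A * A = A"
  shows "(\<Sum>i<n. A $$ (i, i)) \<in> \<int>"
proof -
  obtain as where as: "char_poly A = (\<Prod>a\<leftarrow>as. [:- a, 1:])" using char_poly_factorized[OF A] by auto
  obtain B P Q where BPQ: "schur_decomposition A as = (B, P, Q)" by (metis prod_cases3)
  from schur_decomposition[OF A as BPQ]
  have wit: "similar_mat_wit A B P Q" and upper: "upper_triangular B" by auto
  from similar_mat_witD2[OF A wit]
  have PQ: "P * Q = 1\<^sub>m n" "Q * P = 1\<^sub>m n" and ABPQ: "A = P * B * Q"
    and c: "B \<in> carrier_mat n n" "P \<in> carrier_mat n n" "Q \<in> carrier_mat n n" by auto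
  have B: "B = Q * (A * P)"
  proof -
    have "Q * (A * P) = Q * (P * (B * (Q * P)))" unfolding ABPQ using c by (simp add: assoc_mult_mat[of _ n n _ n _ n])
    also have "\<dots> = (Q * P) * B" using c PQ by (simp add: assoc_mult_mat[of _ n n _ n _ n, symmetric])
    finally show ?thesis using c PQ by simp
  qed
  have "B * B = Q * (A * (P * Q) * A * P)"
    unfolding B using c A by (simp add: assoc_mult_mat[of _ n n _ n _ n])
  also have "\<dots> = B" using c A PQ idem unfolding B by simp
  finally have BB: "B * B = B" .
  have diag: "B $$ (i, i) \<in> \<int>" if i: "i < n" for i
  proof -
    have "B $$ (i, i) = (B * B) $$ (i, i)" by (simp add: BB)
    also have "\<dots> = (\<Sum>k<n. B $$ (i, k) * B $$ (k, i))"
      using i c by (simp add: scalar_prod_def atLeast0LessThan)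
    also have "\<dots> = (\<Sum>k<n. if k = i then B $$ (i, i) * B $$ (i, i) else 0)"
    proof (intro sum.cong HOL.refl)
      fix k assume k: "k \<in> {..<n}"
      consider "k < i" | "k = i" | "i < k" by linarith
      then show "B $$ (i, k) * B $$ (k, i) = (if k = i then B $$ (i, i) * B $$ (i, i) else 0)"
        using upper i k c by cases (auto simp: upper_triangular_def)
    qed
    finally have "B $$ (i, i) * (B $$ (i, i) - 1) = 0" using i by (simp add: algebra_simps)
    then show ?thesis by (auto simp: eq_diff_eq)
  qed
  have "(\<Sum>i<n. A $$ (i, i)) = (\<Sum>i<n. (Q * (P * B)) $$ (i, i))"
    unfolding ABPQ using mat_trace_mult_commute[of "P * B" n Q] c by simp
  also have "Q * (P * B) = B" using c PQ by (simp add: assoc_mult_mat[of _ n n _ n _ n, symmetric])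
  finally show ?thesis using diag by (auto intro: Ints_sum)
qed

context finite_group
begin

text \<open>The left-hand side is the trace of the multiplication by \<open>f\<close> on the regular module.\<close>

lemma idempotent_trace_Ints:
  fixes f :: "'a \<Rightarrow> complex"
  assumes idem: "f \<star> f = f"
  shows "of_nat (card (carrier G)) * f \<one> \<in> \<int>"
proof -
  let ?n = "card (carrier G)"
  obtain h where h: "bij_betw h {0..<?n} (carrier G)"
    using ex_bij_betw_nat_finite[OF finite_carrier] by blast
  have hG: "h i \<in> carrier G" if "i < ?n" for i using h that by (auto simp: bij_betw_def)
  define L where "L = mat ?n ?n (\<lambda>(i, j). f (h i \<otimes> inv (h j)))"
  have L: "L \<in> carrier_mat ?n ?n" by (simp add: L_def)
  have "L * L = L"
  proof (rule eq_matI)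
    fix i j assume "i < dim_row L" "j < dim_col L"
    then have ij: "i < ?n" "j < ?n" using L by auto
    have "(L * L) $$ (i, j) = (\<Sum>k\<in>{0..<?n}. f (h i \<otimes> inv (h k)) * f (h k \<otimes> inv (h j)))"
      using ij by (simp add: L_def scalar_prod_def)
    also have "\<dots> = (\<Sum>y\<in>carrier G. f (h i \<otimes> inv y) * f (y \<otimes> inv (h j)))"
      by (rule sum.reindex_bij_betw[OF h])
    also have "\<dots> = (\<Sum>y\<in>carrier G. f (h i \<otimes> inv y) * f (inv (h i \<otimes> inv y) \<otimes> (h i \<otimes> inv (h j))))"
      using hG ij by (intro sum.cong HOL.refl) (simp add: inv_mult_group m_assoc)
    also have "\<dots> = (\<Sum>y\<in>carrier G. f y * f (inv y \<otimes> (h i \<otimes> inv (h j))))"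
      by (rule sum_inv_translate[symmetric]) (use hG ij in auto)
    also have "\<dots> = (f \<star> f) (h i \<otimes> inv (h j))"
      using hG ij by (simp add: conv_def)
    finally show "(L * L) $$ (i, j) = L $$ (i, j)" using ij by (simp add: L_def idem)
  qed (use L in auto)
  from idempotent_mat_trace_Ints[OF L this]
  have "(\<Sum>i<?n. f (h i \<otimes> inv (h i))) \<in> \<int>" by (simp add: L_def)
  moreover have "(\<Sum>i<?n. f (h i \<otimes> inv (h i))) = (\<Sum>i<?n. f \<one>)"
    by (intro sum.cong HOL.refl) (use hG in auto)
  ultimately show ?thesis by simp
qed

text \<open>The normalised indicator function of \<open>H\<close> is an idempotent that commutes with \<open>e\<close>, and the sum is,
  up to a rational factor, the trace of the product.\<close>

lemma subgroup_sum_rational: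
  fixes e :: "'a \<Rightarrow> complex"
  assumes e: "class_fun e" "e \<star> e = e" and H: "subgroup H G"
  shows "(\<Sum>z\<in>H. e z) \<in> \<rat>"
proof -
  define hH :: "'a \<Rightarrow> complex" where "hH y = (if y \<in> H then inverse (of_nat (card H)) else 0)" for y
  have HG: "H \<subseteq> carrier G" by (rule subgroup.subset[OF H])
  have finH: "finite H" using HG finite_carrier by (rule finite_subset)
  have "\<one> \<in> H" by (rule subgroup.one_closed[OF H])
  then have cardH: "card H > 0" using finH by (auto simp: card_gt_0_iff)
  have shift: "inv z \<otimes> y \<in> H \<longleftrightarrow> y \<in> H" if "z \<in> H" "y \<in> carrier G" for z y
  proof
    have zG: "z \<in> carrier G" using that HG by auto
    assume "inv z \<otimes> y \<in> H"
    then have "z \<otimes> (inv z \<otimes> y) \<in> H" by (rule subgroup.m_closed[OF H that(1)])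
    then show "y \<in> H" using that zG by simp
  next
    assume "y \<in> H"
    then show "inv z \<otimes> y \<in> H"
      by (rule subgroup.m_closed[OF H subgroup.m_inv_closed[OF H that(1)]])
  qed
  have restrict: "(\<Sum>z\<in>carrier G. hH z * g z) = inverse (of_nat (card H)) * (\<Sum>z\<in>H. g z)" for g
  proof -
    have "(\<Sum>z\<in>carrier G. hH z * g z) = (\<Sum>z\<in>H. hH z * g z)"
      by (rule sum.mono_neutral_right) (use HG finite_carrier in \<open>auto simp: hH_def\<close>)
    then show ?thesis by (simp add: hH_def sum_distrib_left)
  qed
  have hh: "hH \<star> hH = hH"
  proof
    fix y
    show "(hH \<star> hH) y = hH y"
    proof (cases "y \<in> carrier G")
      case True
      have "(\<Sum>z\<in>H. hH (inv z \<otimes> y)) = (\<Sum>z\<in>H. hH y)"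
        using shift[OF _ True] by (intro sum.cong HOL.refl) (simp add: hH_def)
      then show ?thesis using True cardH restrict[of "\<lambda>z. hH (inv z \<otimes> y)"] by (simp add: conv_def)
    qed (use HG in \<open>auto simp: conv_def hH_def\<close>)
  qed
  have "(hH \<star> e) \<star> (hH \<star> e) = hH \<star> hH \<star> (e \<star> e)"
    using conv_commute[OF e(1)] by (metis conv_assoc)
  then have idem: "(hH \<star> e) \<star> (hH \<star> e) = hH \<star> e" by (simp add: hh e(2))
  have "(hH \<star> e) \<one> = inverse (of_nat (card H)) * (\<Sum>z\<in>H. e (inv z))"
    using restrict[of "\<lambda>z. e (inv z)"] by (simp add: conv_def)
  also have "(\<Sum>z\<in>H. e (inv z)) = (\<Sum>z\<in>H. e z)"
    by (rule sum.reindex_bij_witness[of _ "\<lambda>z. inv z" "\<lambda>z. inv z"])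
       (use HG H in \<open>auto simp: subgroup.m_inv_closed\<close>)
  finally have "of_nat (card (carrier G)) * (inverse (of_nat (card H)) * (\<Sum>z\<in>H. e z)) \<in> \<int>"
    using idempotent_trace_Ints[OF idem] by simp
  then have "of_nat (card (carrier G)) * (inverse (of_nat (card H)) * (\<Sum>z\<in>H. e z)) \<in> \<rat>"
    using Ints_subset_Rats by blast
  moreover have "(\<Sum>z\<in>H. e z) = of_nat (card H) / of_nat (card (carrier G)) *
      (of_nat (card (carrier G)) * (inverse (of_nat (card H)) * (\<Sum>z\<in>H. e z)))"
    using cardH finite_carrier by (auto simp: field_simps card_gt_0_iff)
  ultimately show ?thesis by (metis Rats_mult Rats_divide Rats_of_nat)
qed

lemma pow_cong:
  assumes x: "x \<in> carrier G" and m: "x [^] m = \<one>" and ab: "[a = b] (mod m)"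
  shows "x [^] a = x [^] (b::nat)"
proof -
  obtain q1 q2 where q: "b + q1 * m = a + q2 * m" using ab unfolding cong_iff_lin_nat by blast
  have one: "x [^] (m * q) = \<one>" for q
    using x m by (simp add: nat_pow_pow[symmetric])
  have "x [^] b = x [^] (b + m * q1)" using x one[of q1] by (simp add: nat_pow_mult[symmetric])
  also have "\<dots> = x [^] (a + m * q2)" using q by (simp add: mult.commute)
  also have "\<dots> = x [^] a" using x one[of q2] by (simp add: nat_pow_mult[symmetric])
  finally show ?thesis by simp
qed

text \<open>Induction on the order of \<open>x\<close>. By \<open>subgroup_sum_rational\<close> the sum of \<open>e\<close> over the subgroup generated
  by \<open>x\<close> is rational; its elements of smaller order contribute rational values, and on the remaining
  generators of the subgroup \<open>e\<close> has the constant value \<open>e x\<close>.\<close>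

lemma idempotent_rational:
  fixes e :: "'a \<Rightarrow> complex"
  assumes e: "class_fun e" "e \<star> e = e"
    and pow: "\<And>x k. x \<in> carrier G \<Longrightarrow> coprime k (card (carrier G)) \<Longrightarrow> e (x [^] k) = e x"
    and x: "x \<in> carrier G"
  shows "e x \<in> \<rat>"
  using x
proof (induction "ord x" arbitrary: x rule: less_induct)
  case less
  let ?N = "card (carrier G)"
  define H where "H = generate G {x}"
  have H: "subgroup H G" unfolding H_def using less.prems by (intro generate_is_subgroup) auto
  have HG: "H \<subseteq> carrier G" by (rule subgroup.subset[OF H])
  have finH: "finite H" using HG finite_carrier by (rule finite_subset)
  have xH: "x \<in> H" unfolding H_def by (intro generate.incl) auto
  have Hpow: "\<exists>i::nat. h = x [^] i" if "h \<in> H" for h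
    using that generate_pow_on_finite_carrier[OF finite_carrier less.prems] by (auto simp: H_def)
  have ord1: "ord x \<ge> 1" by (rule ord_ge_1[OF finite_carrier less.prems])
  have ord_dvd: "ord h dvd ord x" if "h \<in> H" for h
  proof -
    obtain i :: nat where i: "h = x [^] i" using Hpow[OF \<open>h \<in> H\<close>] by blast
    have "h [^] ord x = \<one>" unfolding i using less.prems
      by (simp add: nat_pow_pow mult.commute[of i]) (simp add: nat_pow_pow[symmetric])
    then show ?thesis using that HG pow_eq_id by blast
  qed
  have same: "e h = e x" if h: "h \<in> H" "ord h = ord x" for h
  proof -
    obtain i :: nat where i: "h = x [^] i" using Hpow[OF h(1)] by blast
    define g where "g = gcd i (ord x)"
    obtain i' n' where in': "i = g * i'" "ord x = g * n'" unfolding g_def by (meson dvdE gcd_dvd1 gcd_dvd2)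
    have "h [^] n' = (x [^] ord x) [^] i'"
      unfolding i using less.prems in' by (simp add: nat_pow_pow mult_ac)
    then have "h [^] n' = \<one>" using less.prems by simp
    then have "ord h dvd n'" using h(1) HG pow_eq_id by blast
    then have "ord x dvd n'" using h(2) by simp
    moreover have "n' > 0" using in' ord1 by (auto intro: Nat.gr0I)
    ultimately have "g * n' \<le> n'" using in' dvd_imp_le by metis
    then have "g = 1" using \<open>n' > 0\<close> in' ord1 by (cases g) auto
    then have "coprime i (ord x)" by (metis g_def coprime_iff_gcd_eq_1)
    from coprime_lift[OF this, of ?N] obtain k where k: "[k = i] (mod ord x)" "coprime k ?N"
      using less.prems finite_carrier by (auto simp: card_gt_0_iff)
    have "x [^] k = x [^] i" using pow_cong[OF less.prems _ k(1)] less.prems by simp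
    then show ?thesis using pow[OF less.prems k(2)] i by simp
  qed
  define A where "A = {h \<in> H. ord h = ord x}"
  have "(\<Sum>z\<in>H. e z) = (\<Sum>z\<in>A. e z) + (\<Sum>z\<in>H - A. e z)"
    by (subst add.commute, rule sum.subset_diff) (use finH in \<open>auto simp: A_def\<close>)
  also have "(\<Sum>z\<in>A. e z) = (\<Sum>z\<in>A. e x)" by (intro sum.cong HOL.refl same) (auto simp: A_def)
  finally have "of_nat (card A) * e x = (\<Sum>z\<in>H. e z) - (\<Sum>z\<in>H - A. e z)" by simp
  also have "\<dots> \<in> \<rat>"
  proof (intro Rats_diff subgroup_sum_rational[OF e H] Rats_sum)
    fix h assume h: "h \<in> H - A"
    then have "ord h dvd ord x" "ord h \<noteq> ord x" using ord_dvd by (auto simp: A_def)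
    then have "ord h < ord x" using ord1 dvd_imp_le[of "ord h" "ord x"] by linarith
    then show "e h \<in> \<rat>" using less.hyps h HG by blast
  qed
  finally have "of_nat (card A) * e x \<in> \<rat>" .
  moreover have "card A \<noteq> 0" using xH finH by (auto simp: A_def)
  ultimately have "of_nat (card A) * e x / of_nat (card A) \<in> \<rat>" by (intro Rats_divide) auto
  then show ?case using \<open>card A \<noteq> 0\<close> by simp
qed

subsection \<open>Central units of inverse semi-rational groups\<close>

text \<open>Otherwise the integers \<open>\<alpha>\<^sup>k E(1)\<close>, which are values of \<open>F\<^sup>k E\<close>, would be nonzero and tend to zero.\<close>

lemma integral_eigenvalue_ge_1:
  fixes F E :: "'a \<Rightarrow> int" and \<alpha> :: real
  assumes FE: "(\<lambda>x. of_int ((F \<star> E) x)) = (\<lambda>x. \<alpha> * of_int (E x))" and E: "E \<one> \<noteq> 0" and \<alpha>: "\<alpha> \<noteq> 0"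
  shows "\<bar>\<alpha>\<bar> \<ge> 1"
proof (rule ccontr)
  assume "\<not> \<bar>\<alpha>\<bar> \<ge> 1"
  have "(\<lambda>x. of_int (((\<lambda>f. F \<star> f) ^^ k) E x)) = (\<lambda>x. \<alpha> ^ k * of_int (E x))" for k
  proof (induction k)
    case (Suc k)
    have "(\<lambda>x. real_of_int (((\<lambda>f. F \<star> f) ^^ Suc k) E x))
        = (\<lambda>x. of_int (F x)) \<star> (\<lambda>x. of_int (((\<lambda>f. F \<star> f) ^^ k) E x))"
      by (simp add: conv_of_int)
    also have "\<dots> = (\<lambda>x. \<alpha> ^ k * of_int ((F \<star> E) x))"
      by (simp add: Suc.IH conv_scale_right conv_of_int)
    also have "\<dots> = (\<lambda>x. \<alpha> ^ Suc k * of_int (E x))" using FE by (simp add: fun_eq_iff)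
    finally show ?case .
  qed simp
  then have int: "\<exists>m::int. of_int m = \<alpha> ^ k * of_int (E \<one>)" for k by (metis (no_types))
  have "(\<lambda>k. \<bar>\<alpha>\<bar> ^ k * \<bar>of_int (E \<one>)\<bar>) \<longlonglongrightarrow> 0 * \<bar>of_int (E \<one>)\<bar>"
    using \<open>\<not> \<bar>\<alpha>\<bar> \<ge> 1\<close> by (intro tendsto_mult tendsto_const LIMSEQ_power_zero) auto
  then have "\<forall>\<^sub>F k in sequentially. \<bar>\<alpha>\<bar> ^ k * \<bar>of_int (E \<one>)\<bar> < 1"
    by (intro order_tendstoD(2)) auto
  then obtain k where k: "\<bar>\<alpha>\<bar> ^ k * \<bar>of_int (E \<one>)\<bar> < 1" by (auto simp: eventually_sequentially)
  obtain m :: int where m: "of_int m = \<alpha> ^ k * of_int (E \<one>)" using int[of k] by blast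
  have "m \<noteq> 0" using m E \<alpha> by auto
  then have "1 \<le> \<bar>of_int m :: real\<bar>" by linarith
  then show False using k m by (simp add: abs_mult power_abs)
qed

lemma common_denominator:
  assumes "finite A" "\<And>x. x \<in> A \<Longrightarrow> e x \<in> (\<rat> :: complex set)"
  shows "\<exists>D::int. D > 0 \<and> (\<forall>x\<in>A. of_int D * e x \<in> \<int>)"
  using assms
proof (induction A rule: finite_induct)
  case (insert y A)
  then obtain D where D: "D > 0" "\<forall>x\<in>A. of_int D * e x \<in> \<int>" by auto
  have "e y \<in> \<rat>" using insert.prems by simp
  then obtain a b where ab: "b > 0" "e y = of_int a / of_int b" by (rule Rats_cases')
  have "of_int (D * b) * e x \<in> \<int>" if "x \<in> insert y A" for x
  proof (cases "x = y")
    case True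
    then have "of_int (D * b) * e x = of_int (D * a)" using ab by simp
    then show ?thesis by (metis Ints_of_int)
  next
    case False
    have "of_int b * (of_int D * e x) \<in> \<int>" by (rule Ints_mult) (use D(2) that False in auto)
    then show ?thesis by (simp add: mult_ac)
  qed
  then show ?case using D ab by (intro exI[of _ "D * b"]) auto
qed (auto intro: exI[of _ 1])

lemma sym_class_fun_power_invariant:
  assumes isr: "inverse_semirational G" and f: "sym_class_fun f"
    and x: "x \<in> carrier G" and k: "coprime k (card (carrier G))"
  shows "f (x [^] k) = f x"
proof -
  obtain g where g: "g \<in> carrier G" "x [^] k \<otimes> g = g \<otimes> x \<or> x [^] k \<otimes> g = g \<otimes> inv x"
    using isr x k unfolding inverse_semirational_def by blast
  have cf: "class_fun f" using f by (simp add: sym_class_fun_def)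
  have "f (x [^] k) = f (inv g \<otimes> (x [^] k \<otimes> g))"
    using class_funD[OF cf _ g(1), of "x [^] k"] x g(1) by (simp add: m_assoc)
  also have "\<dots> = f x" using g x f by (auto simp: sym_class_fun_def)
  finally show ?thesis .
qed

text \<open>The second claim is where the values must be real: \<open>e \<one>\<close> equals the sum of the squares of all values.\<close>

lemma isr_eigenvalue_rational:
  assumes isr: "inverse_semirational G" and K: "sym_class_fun K" and e: "spectral_idempotent K \<alpha> e"
  shows "x \<in> carrier G \<Longrightarrow> e x \<in> \<rat>" and "e \<one> \<noteq> 0"
proof -
  have symK: "sym_class_fun (\<lambda>x. of_int (K x) :: complex)"
    using K by (auto simp: sym_class_fun_def class_fun_def supported_def)
  have sym: "sym_class_fun e" using e sym_class_fun_peval[OF symK] by (auto simp: spectral_idempotent_def)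
  have idem: "e \<star> e = e" using e by (simp add: spectral_idempotent_def)
  show rat: "e x \<in> \<rat>" if "x \<in> carrier G" for x
    using sym idem sym_class_fun_power_invariant[OF isr sym] that
    by (intro idempotent_rational) (auto simp: sym_class_fun_def)
  show "e \<one> \<noteq> 0"
  proof
    assume "e \<one> = 0"
    then have "(e \<star> e) \<one> = 0" by (simp add: idem)
    then have "(\<Sum>y\<in>carrier G. e y * e y) = 0"
      using sym by (simp add: conv_def sym_class_fun_def)
    moreover have real: "e y = of_real (Re (e y))" if "y \<in> carrier G" for y
    proof -
      from rat[OF that] obtain a b :: int where "e y = of_int a / of_int b" by (rule Rats_cases')
      then have "e y = of_real (of_int a / of_int b)" by simp
      then show ?thesis by (metis Re_complex_of_real)
    qed
    moreover have "(\<Sum>y\<in>carrier G. e y * e y) = (\<Sum>y\<in>carrier G. complex_of_real ((Re (e y))\<^sup>2))"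
    proof (rule sum.cong[OF HOL.refl])
      fix y assume "y \<in> carrier G"
      from real[OF this] show "e y * e y = complex_of_real ((Re (e y))\<^sup>2)"
        by (metis of_real_mult power2_eq_square)
    qed
    ultimately have "(\<Sum>y\<in>carrier G. complex_of_real ((Re (e y))\<^sup>2)) = 0"
      by simp
    then have "(\<Sum>y\<in>carrier G. (Re (e y))\<^sup>2) = 0"
      by (simp only: of_real_sum[symmetric] of_real_eq_0_iff)
    then have "\<forall>y\<in>carrier G. (Re (e y))\<^sup>2 = 0"
      by (subst (asm) sum_nonneg_eq_0_iff[OF finite_carrier]) auto
    then have "e y = 0" if "y \<in> carrier G" for y using real[OF that] that by simp
    then have "e = (\<lambda>x. 0)" using sym_class_fun_supported[OF sym] by (auto simp: supported_def)
    then show False using e by (simp add: spectral_idempotent_def)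
  qed
qed

text \<open>The eigenvalues of \<open>V = u u\<^sup>*\<close> have an integral eigenvector with nonzero value at \<open>\<one>\<close>, a multiple of the
  rational idempotent. Both \<open>V\<close> and its inverse are integral, so by \<open>integral_eigenvalue_ge_1\<close> the
  eigenvalue and its inverse have absolute value at least \<open>1\<close>. With \<open>V\<^sup>2 = 1\<close> the sum of the squares of
  the coefficients of \<open>V\<close> is \<open>1\<close>, so that \<open>V(1)\<close>, the sum of the squares of the coefficients of \<open>u\<close>, is
  at most \<open>1\<close>.\<close>

theorem isr_central_unit_trivial:
  fixes u v :: "'a \<Rightarrow> int"
  assumes isr: "inverse_semirational G"
    and u: "class_fun u" and v: "supported v" and uv: "u \<star> v = delta"
  shows "\<exists>g\<in>carrier G. u = (\<lambda>x. if x = g then 1 else 0) \<or> u = (\<lambda>x. if x = g then -1 else 0)"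
proof -
  define star :: "('a \<Rightarrow> int) \<Rightarrow> 'a \<Rightarrow> int" where "star f x = (if x \<in> carrier G then f (inv x) else 0)" for f x
  have star_conv: "star (f \<star> g) = star g \<star> star f" for f g
  proof
    fix x show "star (f \<star> g) x = (star g \<star> star f) x"
    proof (cases "x \<in> carrier G")
      case True
      have "(star g \<star> star f) x = (\<Sum>y\<in>carrier G. g (inv y) * f (inv (inv y \<otimes> x)))"
        unfolding conv_def using True by (auto simp: star_def intro: sum.cong)
      also have "\<dots> = (f \<star> g) (inv x)"
        unfolding conv_inv[OF True] using True by (simp add: conv_def)
      finally show ?thesis using True by (simp add: star_def)
    qed (simp add: star_def conv_def)
  qed
  have star_u: "class_fun (star u)"
  proof (rule class_funI)
    fix x y assume "x \<in> carrier G" "y \<in> carrier G"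
    then show "star u (inv y \<otimes> x \<otimes> y) = star u x"
      using class_funD[OF u, of "inv x" y] by (simp add: star_def inv_mult_group m_assoc)
  qed (simp add: supported_def star_def)
  have star_delta: "star delta = delta" by (auto simp: fun_eq_iff star_def delta_def)
  define V where "V = u \<star> star u"
  define Y where "Y = v \<star> star v"
  have symV: "sym_class_fun V"
    unfolding sym_class_fun_def
  proof (intro conjI ballI)
    show "class_fun V" unfolding V_def by (rule class_fun_conv[OF u star_u])
    have ss: "star (star u) = u" using u by (auto simp: fun_eq_iff star_def class_fun_def supported_def)
    have "star V = V" unfolding V_def star_conv ss ..
    then show "V (inv x) = V x" if "x \<in> carrier G" for x
      using that by (metis star_def)
  qed
  have VY: "V \<star> Y = delta"
  proof -
    have "star v \<star> star u = delta" by (simp add: star_conv[symmetric] uv star_delta)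
    then have "star u \<star> star v = delta" using conv_commute[OF star_u] by metis
    moreover have "V \<star> Y = u \<star> v \<star> (star u \<star> star v)"
      unfolding V_def Y_def using conv_commute[OF star_u, of v] by (metis conv_assoc)
    ultimately show ?thesis by (simp add: uv conv_delta sym_class_fun_supported sym_class_fun_delta)
  qed
  have VV: "V \<star> V = delta"
  proof -
    let ?V = "\<lambda>x. of_int (V x) :: complex"
    have symV': "sym_class_fun ?V" using symV by (auto simp: sym_class_fun_def class_fun_def supported_def)
    have "peval [:-1, 0, 1:] ?V = (\<lambda>x. 0)"
    proof (rule spectral_theorem[OF symV])
      fix \<alpha> e assume e: "spectral_idempotent V \<alpha> e"
      obtain a where a: "\<alpha> = of_real a" using e by (auto simp: spectral_idempotent_def elim: Reals_cases)
      have rat: "e x \<in> \<rat>" if "x \<in> carrier G" for x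
        using isr_eigenvalue_rational(1)[OF isr symV e that] .
      have supp: "supported e" using e supported_peval by (auto simp: spectral_idempotent_def)
      obtain D :: int where D: "D > 0" "\<forall>x\<in>carrier G. of_int D * e x \<in> \<int>"
        using common_denominator[OF finite_carrier, of e] rat by blast
      have "\<exists>E. \<forall>x. of_int (E x) = of_int D * e x"
      proof (rule choice, rule allI)
        fix x show "\<exists>m::int. of_int m = of_int D * e x"
          using D(2) supp by (cases "x \<in> carrier G") (auto simp: supported_def elim!: Ints_cases intro: sym)
      qed
      then obtain E :: "'a \<Rightarrow> int" where E: "\<And>x. of_int (E x) = of_int D * e x" by blast
      have Ef: "(\<lambda>x. of_int (E x)) = (\<lambda>x. of_int D * e x)" using E by auto
      have E1: "E \<one> \<noteq> 0"
      proof
        assume "E \<one> = 0"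
        then have "of_int D * e \<one> = 0" using E[of \<one>] by simp
        then show False using D(1) isr_eigenvalue_rational(2)[OF isr symV e] by simp
      qed
      have Ve: "?V \<star> e = (\<lambda>x. \<alpha> * e x)" using e by (simp add: spectral_idempotent_def)
      have "(\<lambda>x. of_int ((V \<star> E) x) :: complex) = (\<lambda>x. \<alpha> * of_int (E x))"
        unfolding conv_of_int[symmetric] Ef by (simp add: conv_scale_right Ve E mult_ac)
      then have "complex_of_real (of_int ((V \<star> E) x)) = of_real (a * of_int (E x))" for x
        by (simp add: fun_eq_iff a)
      then have VE: "(\<lambda>x. of_int ((V \<star> E) x)) = (\<lambda>x. a * of_int (E x))"
        by (simp only: of_real_eq_iff)
      have YV: "Y \<star> V = delta" using VY sym_class_fun_commute[OF symV] by metis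
      have E_supp: "supported E"
        unfolding supported_def
      proof (intro allI impI)
        fix x assume "x \<notin> carrier G"
        then have "of_int (E x) = (0::complex)" using E[of x] supp by (simp add: supported_def)
        then show "E x = 0" by simp
      qed
      have YVE: "E = Y \<star> (V \<star> E)"
        using YV by (metis conv_assoc delta_conv E_supp)
      have YVE': "(\<lambda>x. of_int (E x)) = (\<lambda>x. a * of_int ((Y \<star> E) x))"
      proof -
        have "(\<lambda>x. real_of_int (E x)) = (\<lambda>x. of_int (Y x)) \<star> (\<lambda>x. of_int ((V \<star> E) x))"
          by (subst YVE) (simp add: conv_of_int)
        then show ?thesis by (simp add: VE conv_scale_right conv_of_int)
      qed
      have a0: "a \<noteq> 0" using YVE' E1 by (auto simp: fun_eq_iff)
      have "(\<lambda>x. of_int ((Y \<star> E) x)) = (\<lambda>x. inverse a * of_int (E x))"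
        using YVE' a0 by (simp add: fun_eq_iff field_simps)
      from integral_eigenvalue_ge_1[OF this E1] a0 have "\<bar>inverse a\<bar> \<ge> 1" by simp
      moreover have "\<bar>a\<bar> \<ge> 1" by (rule integral_eigenvalue_ge_1[OF VE E1 a0])
      ultimately have "\<bar>a\<bar> = 1" using a0 by (simp add: abs_inverse inverse_eq_divide pos_le_divide_eq)
      then have "a * a = 1" by (metis abs_mult_self_eq mult_1)
      then have "\<alpha> * \<alpha> = 1" by (metis a of_real_1 of_real_mult)
      then show "poly [:-1, 0, 1:] \<alpha> = 0" by simp
    qed
    then have "(\<lambda>x. (?V \<star> ?V) x - delta x) = (\<lambda>x. 0)"
      using sym_class_fun_supported[OF symV']
      by (simp add: peval_pCons one_pCons conv_add_right conv_delta fun_eq_iff)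
    then have "of_int ((V \<star> V) x) = (of_int (delta x) :: complex)" for x
      unfolding conv_of_int by (simp add: fun_eq_iff delta_def)
    then show ?thesis by (auto simp: fun_eq_iff)
  qed
  have "(\<Sum>y\<in>carrier G. V y * V y) = 1"
  proof -
    have "(V \<star> V) \<one> = (\<Sum>y\<in>carrier G. V y * V y)" using symV by (simp add: conv_def sym_class_fun_def)
    then show ?thesis by (simp add: VV delta_def)
  qed
  moreover have "V \<one> * V \<one> \<le> (\<Sum>y\<in>carrier G. V y * V y)"
    by (rule member_le_sum) (auto simp: finite_carrier)
  ultimately have "V \<one> * V \<one> \<le> 1" by simp
  then have V1: "V \<one> \<le> 1" by (smt (verit) mult_le_cancel_left1)
  have Vsum: "V \<one> = (\<Sum>y\<in>carrier G. u y * u y)" by (auto simp: V_def conv_def star_def)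
  obtain g where g: "g \<in> carrier G" "u g \<noteq> 0"
  proof -
    have "u \<noteq> (\<lambda>x. 0)"
    proof
      assume "u = (\<lambda>x. 0)"
      then have "delta = (\<lambda>x::'a. 0::int)" using uv by simp
      then show False by (metis delta_def zero_neq_one)
    qed
    then show ?thesis using u that by (auto simp: fun_eq_iff class_fun_def supported_def)
  qed
  have sq: "u g * u g \<ge> 1" using g(2) by (metis int_one_le_iff_zero_less not_square_less_zero mult_eq_0_iff linorder_cases)
  have split: "(\<Sum>y\<in>carrier G. u y * u y) = u g * u g + (\<Sum>y\<in>carrier G - {g}. u y * u y)"
    by (rule sum.remove[OF finite_carrier g(1)])
  have nn: "(\<Sum>y\<in>carrier G - {g}. u y * u y) \<ge> 0" by (intro sum_nonneg) auto
  have ug: "u g * u g = 1" and rest: "(\<Sum>y\<in>carrier G - {g}. u y * u y) = 0"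
    using V1 Vsum split nn sq by linarith+
  from rest have "\<forall>y\<in>carrier G - {g}. u y * u y = 0"
    using finite_carrier by (subst (asm) sum_nonneg_eq_0_iff) auto
  then have zero: "u y = 0" if "y \<noteq> g" for y
    using that u by (cases "y \<in> carrier G") (auto simp: class_fun_def supported_def)
  from ug have "u g = 1 \<or> u g = -1" by (simp add: zmult_eq_1_iff)
  then show ?thesis using g(1) zero by (intro bexI[of _ g]) (auto simp: fun_eq_iff)
qed

end

section \<open>Groups with the cut-property are inverse semi-rational\<close>

text \<open>The orbits of \<open>\<sigma>\<close> that are not fixed points have exactly \<open>p\<close> elements, and \<open>w\<close> is constant on each.\<close>

lemma sum_cong_fixed_points:
  fixes w :: "'b \<Rightarrow> int" and p :: nat
  assumes "finite S" "Factorial_Ring.prime p"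
    and "\<And>s. s \<in> S \<Longrightarrow> \<sigma> s \<in> S" "\<And>s. s \<in> S \<Longrightarrow> (\<sigma> ^^ p) s = s" "\<And>s. s \<in> S \<Longrightarrow> w (\<sigma> s) = w s"
  shows "[(\<Sum>s\<in>S. w s) = (\<Sum>s\<in>{s \<in> S. \<sigma> s = s}. w s)] (mod int p)"
  using assms(1,3-5)
proof (induction "card S" arbitrary: S rule: less_induct)
  case less
  show ?case
  proof (cases "\<forall>s\<in>S. \<sigma> s = s")
    case True
    then have "{s \<in> S. \<sigma> s = s} = S" by auto
    then show ?thesis by simp
  next
    case False
    then obtain s where s: "s \<in> S" "\<sigma> s \<noteq> s" by auto
    have p: "p > 1" using assms(2) by (rule prime_gt_1_nat)
    have iter_in: "(\<sigma> ^^ i) t \<in> S" if "t \<in> S" for i t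
      using that by (induction i) (auto intro: less.prems)
    have period: "(\<sigma> ^^ (i + p * j)) t = (\<sigma> ^^ i) t" if "t \<in> S" for i j t
    proof (induction j)
      case (Suc j)
      have "i + p * Suc j = (i + p * j) + p" by simp
      then have "(\<sigma> ^^ (i + p * Suc j)) t = (\<sigma> ^^ (i + p * j)) ((\<sigma> ^^ p) t)"
        by (simp only: funpow_add comp_apply)
      then show ?case using Suc less.prems(3)[OF that] by simp
    qed simp
    have no_fix: "(\<sigma> ^^ i) t \<noteq> t" if t: "t = (\<sigma> ^^ m) s" and i: "0 < i" "i < p" for i m t
    proof
      assume fx: "(\<sigma> ^^ i) t = t"
      have tS: "t \<in> S" using iter_in[OF s(1)] t by simp
      have fixj: "(\<sigma> ^^ (i * j)) t = t" for j
        by (induction j) (simp_all add: fx funpow_add)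
      have "coprime i p" using i assms(2) by (metis coprime_commute nat_dvd_not_less prime_imp_coprime_nat)
      then obtain j where "[i * j = 1] (mod p)" using cong_solve_coprime_nat by auto
      then obtain q1 q2 where q: "1 + q1 * p = i * j + q2 * p" unfolding cong_iff_lin_nat by auto
      have "(\<sigma> ^^ 1) t = (\<sigma> ^^ (1 + p * q1)) t" by (rule period[OF tS, symmetric])
      also have "1 + p * q1 = i * j + p * q2" using q by (simp add: mult.commute)
      also have "(\<sigma> ^^ (i * j + p * q2)) t = t" using period[OF tS] fixj by simp
      finally have "\<sigma> t = t" by simp
      moreover have "(\<sigma> ^^ (p * m - m)) t = s"
      proof -
        have "m \<le> p * m" using p by simp
        have "(\<sigma> ^^ (p * m - m)) t = (\<sigma> ^^ (p * m - m + m)) s" unfolding t funpow_add by simp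
        also have "p * m - m + m = 0 + p * m" using \<open>m \<le> p * m\<close> by simp
        finally show ?thesis using period[OF s(1), of 0 m] by simp
      qed
      moreover have "(\<sigma> ^^ n) t = t" for n using \<open>\<sigma> t = t\<close> by (induction n) auto
      ultimately show False using s(2) by simp
    qed
    define Q where "Q = (\<lambda>i. (\<sigma> ^^ i) s) ` {..<p}"
    have injQ: "inj_on (\<lambda>i. (\<sigma> ^^ i) s) {..<p}"
    proof (rule linorder_inj_onI)
      fix i j assume ij: "i < j" "i \<in> {..<p}" "j \<in> {..<p}"
      show "(\<sigma> ^^ i) s \<noteq> (\<sigma> ^^ j) s"
      proof
        assume "(\<sigma> ^^ i) s = (\<sigma> ^^ j) s"
        also have "(\<sigma> ^^ j) s = (\<sigma> ^^ ((j - i) + i)) s" using ij by simp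
        also have "\<dots> = (\<sigma> ^^ (j - i)) ((\<sigma> ^^ i) s)" by (simp only: funpow_add comp_apply)
        finally have "(\<sigma> ^^ (j - i)) ((\<sigma> ^^ i) s) = (\<sigma> ^^ i) s" by simp
        moreover have "0 < j - i" "j - i < p" using ij by auto
        ultimately show False using no_fix by blast
      qed
    qed auto
    have QS: "Q \<subseteq> S" using iter_in[OF s(1)] by (auto simp: Q_def)
    have closedQ: "\<sigma> t \<in> Q" if "t \<in> Q" for t
    proof -
      obtain i where i: "i < p" "t = (\<sigma> ^^ i) s" using \<open>t \<in> Q\<close> by (auto simp: Q_def)
      have "\<sigma> t = (\<sigma> ^^ (Suc i)) s" using i by simp
      also have "\<dots> = (\<sigma> ^^ (Suc i mod p)) s"
        using period[OF s(1), of "Suc i mod p" "Suc i div p"] by (simp add: mult.commute)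
      finally show ?thesis using p by (auto simp: Q_def)
    qed
    have closedS: "\<sigma> t \<in> S - Q" if "t \<in> S - Q" for t
    proof -
      have "\<sigma> t \<notin> Q"
      proof
        assume *: "\<sigma> t \<in> Q"
        have iter: "(\<sigma> ^^ n) (\<sigma> t) \<in> Q" for n
        proof (induction n)
          case (Suc n)
          show ?case using closedQ[OF Suc.IH] by simp
        qed (simp add: *)
        have "p = Suc (p - 1)" using p by simp
        then have "(\<sigma> ^^ p) t = (\<sigma> ^^ (p - 1)) (\<sigma> t)"
          by (metis funpow_Suc_right comp_apply)
        then have "t \<in> Q" using iter[of "p - 1"] less.prems(3)[of t] \<open>t \<in> S - Q\<close> by simp
        then show False using \<open>t \<in> S - Q\<close> by simp
      qed
      then show ?thesis using that less.prems(2) by auto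
    qed
    have wQ: "w t = w s" if "t \<in> Q" for t
    proof -
      have "w ((\<sigma> ^^ i) s) = w s" for i
      proof (induction i)
        case (Suc i)
        show ?case using less.prems(4)[OF iter_in[OF s(1), of i]] Suc.IH by simp
      qed simp
      then show ?thesis using that by (auto simp: Q_def)
    qed
    have sumQ: "(\<Sum>t\<in>Q. w t) = int p * w s"
      using wQ card_image[OF injQ] by (simp add: Q_def)
    have fixQ: "{t \<in> S. \<sigma> t = t} = {t \<in> S - Q. \<sigma> t = t}"
      using no_fix[of _ _ 1] p by (auto simp: Q_def)
    have "card (S - Q) < card S"
    proof (rule psubset_card_mono[OF less.prems(1)])
      have "(\<sigma> ^^ 0) s \<in> Q" unfolding Q_def using p by (intro imageI) simp
      then show "S - Q \<subset> S" using s(1) by auto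
    qed
    then have "[(\<Sum>t\<in>S - Q. w t) = (\<Sum>t\<in>{t \<in> S - Q. \<sigma> t = t}. w t)] (mod int p)"
      using less.prems closedS by (intro less.hyps) auto
    moreover have "(\<Sum>t\<in>S. w t) = (\<Sum>t\<in>S - Q. w t) + int p * w s"
      using sum.subset_diff[OF QS less.prems(1), of w] sumQ by simp
    ultimately show ?thesis unfolding fixQ by (simp add: cong_def)
  qed
qed

lemma int_fermat:
  fixes a :: int
  assumes "Factorial_Ring.prime p"
  shows "int p dvd a ^ p - a"
proof -
  define m where "m = nat (a mod int p)"
  have p0: "p > 0" using assms by (simp add: prime_gt_0_nat)
  have m: "[a = int m] (mod int p)" using p0 by (simp add: m_def cong_def)
  have "[m ^ p = m] (mod p)"
  proof (cases "p dvd m")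
    case True
    then have "p dvd m ^ p" using p0 by (simp add: dvd_power_iff_le dvd_trans dvd_power)
    with True show ?thesis by (simp add: cong_def)
  next
    case False
    then have "[m ^ (p - 1) = 1] (mod p)" by (rule fermat_theorem[OF assms])
    then have "[m * m ^ (p - 1) = m * 1] (mod p)" by (rule cong_scalar_left)
    then show ?thesis using p0 by (simp add: power_eq_if)
  qed
  then have "[int (m ^ p) = int m] (mod int p)" by (simp only: cong_int_iff)
  then have "[a ^ p = a] (mod int p)"
    using m cong_pow[OF m, of p] by (simp add: cong_def)
  then show ?thesis by (simp add: cong_iff_dvd_diff)
qed

context finite_group
begin

lemma pow_cong_card:
  assumes x: "x \<in> carrier G" and ab: "[a = b] (mod card (carrier G))"
  shows "x [^] a = x [^] (b::nat)"
  using pow_cong[OF x _ ab] pow_order_eq_1[OF x] by (simp add: Coset.order_def)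

lemma pow_inj_coprime:
  assumes "coprime p (card (carrier G))" "x \<in> carrier G" "y \<in> carrier G" "x [^] p = y [^] p"
  shows "x = y"
proof -
  obtain q where "[p * q = 1] (mod card (carrier G))" using assms(1) cong_solve_coprime_nat by auto
  then have "z = (z [^] p) [^] q" if "z \<in> carrier G" for z
    using pow_cong_card[OF that, of "p * q" 1] that by (simp add: nat_pow_pow)
  then show ?thesis using assms by metis
qed

definition prod_word :: "'a list \<Rightarrow> 'a" where "prod_word gs = foldr (\<otimes>) gs \<one>"

lemma prod_word_closed: "set gs \<subseteq> carrier G \<Longrightarrow> prod_word gs \<in> carrier G"
  by (induction gs) (auto simp: prod_word_def)

lemma prod_word_append:
  "set gs \<subseteq> carrier G \<Longrightarrow> set hs \<subseteq> carrier G \<Longrightarrow> prod_word (gs @ hs) = prod_word gs \<otimes> prod_word hs"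
proof (induction gs)
  case (Cons g gs)
  then show ?case using prod_word_closed by (simp add: prod_word_def m_assoc)
qed (simp add: prod_word_def prod_word_closed[unfolded prod_word_def])

lemma prod_word_replicate: "g \<in> carrier G \<Longrightarrow> prod_word (replicate n g) = g [^] n"
  by (induction n) (simp_all add: prod_word_def nat_pow_Suc2[symmetric] del: nat_pow_Suc)

lemma finite_words: "finite {gs. set gs \<subseteq> carrier G \<and> length gs = n \<and> P gs}"
  by (rule finite_subset[OF _ finite_lists_length_eq[OF finite_carrier, of n]]) auto

lemma conv_power_eq_sum_words:
  assumes "x \<in> carrier G"
  shows "conv_power K n x = (\<Sum>gs | set gs \<subseteq> carrier G \<and> length gs = n \<and> prod_word gs = x. prod_list (map K gs))"
  using assms
proof (induction n arbitrary: x)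
  case 0
  have "{gs. set gs \<subseteq> carrier G \<and> length gs = 0 \<and> prod_word gs = x} = (if x = \<one> then {[]} else {})"
    by (auto simp: prod_word_def)
  then show ?case by (simp add: delta_def)
next
  case (Suc n)
  let ?W = "\<lambda>n x. {gs. set gs \<subseteq> carrier G \<and> length gs = n \<and> prod_word gs = x}"
  have "conv_power K (Suc n) x = (\<Sum>y\<in>carrier G. \<Sum>gs\<in>?W n (inv y \<otimes> x). K y * prod_list (map K gs))"
    using Suc by (simp add: conv_power_Suc conv_def sum_distrib_left)
  also have "\<dots> = (\<Sum>(y, gs)\<in>(SIGMA y:carrier G. ?W n (inv y \<otimes> x)). K y * prod_list (map K gs))"
    by (rule sum.Sigma) (auto simp: finite_carrier finite_words)
  also have "\<dots> = (\<Sum>gs\<in>?W (Suc n) x. prod_list (map K gs))"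
  proof (rule sum.reindex_bij_witness[of _ "\<lambda>gs. (hd gs, tl gs)" "\<lambda>(y, gs). y # gs"])
    fix a assume "a \<in> (SIGMA y:carrier G. ?W n (inv y \<otimes> x))"
    then obtain y gs where a: "a = (y, gs)" "y \<in> carrier G" "set gs \<subseteq> carrier G" "length gs = n"
      "prod_word gs = inv y \<otimes> x" by auto
    then have "prod_word (y # gs) = x" using Suc.prems by (simp add: prod_word_def)
    with a show "(case a of (y, gs) \<Rightarrow> y # gs) \<in> ?W (Suc n) x" by simp
  next
    fix gs assume gs: "gs \<in> ?W (Suc n) x"
    then obtain y hs where yh: "gs = y # hs" by (cases gs) auto
    with gs have *: "y \<in> carrier G" "set hs \<subseteq> carrier G" "length hs = n" "y \<otimes> prod_word hs = x"
      by (auto simp: prod_word_def)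
    then have "prod_word hs = inv y \<otimes> x" using prod_word_closed by auto
    with yh * show "(hd gs, tl gs) \<in> (SIGMA y:carrier G. ?W n (inv y \<otimes> x))" by auto
    show "(case (hd gs, tl gs) of (y, gs) \<Rightarrow> y # gs) = gs" using yh by simp
  qed auto
  finally show ?case .
qed

text \<open>The power \<open>K\<^sup>p\<close> counts words of length \<open>p\<close> by their products, and rotation of a word conjugates its
  product. Summed over the conjugacy class \<open>C\<close> of \<open>z\<^sup>p\<close>, only the constant words \<open>g \<dots> g\<close> matter modulo
  \<open>p\<close>; they have \<open>g\<^sup>p\<close> in \<open>C\<close>, so that \<open>g\<close> is conjugate to \<open>z\<close>. The size of \<open>C\<close> is invertible modulo
  \<open>p\<close>.\<close>

lemma conv_power_prime_cong:
  fixes K :: "'a \<Rightarrow> int"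
  assumes K: "class_fun K" "\<And>x. K x \<in> {0, 1}" and p: "Factorial_Ring.prime p" "p > card (carrier G)"
    and z: "z \<in> carrier G"
  shows "[conv_power K p (z [^] p) = K z] (mod int p)"
proof -
  define C where "C = {inv h \<otimes> (z [^] p) \<otimes> h | h. h \<in> carrier G}"
  define S where "S = {gs. set gs \<subseteq> carrier G \<and> length gs = p \<and> prod_word gs \<in> C}"
  define w where "w gs = prod_list (map K gs)" for gs
  have p0: "p > 0" using p(1) by (rule prime_gt_0_nat)
  have cop: "coprime p (card (carrier G))"
  proof -
    have "card (carrier G) > 0" using finite_carrier z by (auto simp: card_gt_0_iff)
    then show ?thesis using p by (intro prime_imp_coprime_nat) (auto dest: dvd_imp_le)
  qed
  have CG: "C \<subseteq> carrier G" using z by (auto simp: C_def)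
  have finC: "finite C" using CG finite_carrier by (rule finite_subset)
  have conj: "inv g \<otimes> c \<otimes> g \<in> C" if "c \<in> C" "g \<in> carrier G" for c g
  proof -
    from that(1) obtain h where h: "h \<in> carrier G" "c = inv h \<otimes> (z [^] p) \<otimes> h" unfolding C_def by blast
    then have "inv g \<otimes> c \<otimes> g = inv (h \<otimes> g) \<otimes> (z [^] p) \<otimes> (h \<otimes> g)"
      using that z by (simp add: inv_mult_group m_assoc)
    then show ?thesis using h that unfolding C_def by blast
  qed
  have zC: "z [^] p \<in> C" unfolding C_def using z by (intro CollectI exI[of _ \<one>]) simp
  have power_const: "conv_power K p x = conv_power K p (z [^] p)" if "x \<in> C" for x
  proof -
    have "class_fun (conv_power K p)"
    proof (induction p)
      case 0
      have "sym_class_fun (delta :: 'a \<Rightarrow> int)" by (rule sym_class_fun_delta)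
      then show ?case by (simp add: sym_class_fun_def)
    qed (simp add: conv_power_Suc class_fun_conv K)
    then show ?thesis using that z class_funD[of "conv_power K p" "z [^] p"] by (auto simp: C_def)
  qed
  have "(\<Sum>x\<in>C. conv_power K p x) = (\<Sum>x\<in>C. \<Sum>gs | set gs \<subseteq> carrier G \<and> length gs = p \<and> prod_word gs = x. w gs)"
    unfolding w_def using CG by (intro sum.cong HOL.refl conv_power_eq_sum_words) auto
  also have "\<dots> = (\<Sum>gs\<in>S. w gs)"
  proof -
    have "(\<Sum>x\<in>C. \<Sum>gs | gs \<in> S \<and> prod_word gs = x. w gs) = (\<Sum>gs\<in>S. w gs)"
      by (rule sum.group) (auto simp: S_def finC finite_words)
    moreover have "{gs. set gs \<subseteq> carrier G \<and> length gs = p \<and> prod_word gs = x} = {gs. gs \<in> S \<and> prod_word gs = x}"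
      if "x \<in> C" for x using that by (auto simp: S_def)
    ultimately show ?thesis by simp
  qed
  finally have total: "int (card C) * conv_power K p (z [^] p) = (\<Sum>gs\<in>S. w gs)"
    using power_const by simp
  have fixed: "[(\<Sum>gs\<in>S. w gs) = (\<Sum>gs\<in>{gs \<in> S. rotate1 gs = gs}. w gs)] (mod int p)"
  proof (rule sum_cong_fixed_points[OF _ p(1)])
    show "finite S" unfolding S_def by (rule finite_words)
    fix gs assume gs: "gs \<in> S"
    then obtain g hs where gh: "gs = g # hs" using p0 by (cases gs) (auto simp: S_def)
    with gs have G: "g \<in> carrier G" "set hs \<subseteq> carrier G" by (auto simp: S_def)
    have "prod_word (rotate1 gs) = inv g \<otimes> prod_word gs \<otimes> g"
      using G gh prod_word_append[of hs "[g]"] prod_word_closed[OF G(2)]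
      by (simp add: prod_word_def m_assoc)
    then show "rotate1 gs \<in> S" using gs conj[of "prod_word gs" g] G by (simp add: S_def)
    show "w (rotate1 gs) = w gs" by (simp add: w_def gh mult.commute)
    show "(rotate1 ^^ p) gs = gs" using gs by (simp add: S_def flip: rotate_def)
  qed
  have "{gs \<in> S. rotate1 gs = gs} = replicate p ` {g \<in> carrier G. g [^] p \<in> C}"
  proof
    show "{gs \<in> S. rotate1 gs = gs} \<subseteq> replicate p ` {g \<in> carrier G. g [^] p \<in> C}"
    proof safe
      fix gs assume gs: "gs \<in> S" "rotate1 gs = gs"
      have all: "gs ! i = gs ! 0" if "i < p" for i
        using that
      proof (induction i)
        case (Suc i)
        have "gs ! Suc i = rotate1 gs ! i" using Suc.prems gs(1) by (simp add: nth_rotate1 S_def)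
        then show ?case using Suc gs(2) by simp
      qed simp
      have len: "length gs = p" using gs(1) by (simp add: S_def)
      have "gs = replicate p (gs ! 0)"
      proof (rule nth_equalityI)
        fix i assume "i < length gs"
        then have i: "i < p" using len by simp
        show "gs ! i = replicate p (gs ! 0) ! i" unfolding List.nth_replicate[OF i] by (rule all[OF i])
      qed (simp add: len)
      moreover have "gs ! 0 \<in> carrier G" using gs(1) p0 nth_mem[of 0 gs] by (auto simp: S_def)
      ultimately show "gs \<in> replicate p ` {g \<in> carrier G. g [^] p \<in> C}"
        using gs(1) prod_word_replicate[of "gs ! 0" p] by (intro image_eqI[of _ _ "gs ! 0"]) (auto simp: S_def)
    qed
  qed (auto simp: S_def prod_word_replicate in_set_replicate)
  moreover have "inj_on (replicate p) {g \<in> carrier G. g [^] p \<in> C}"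
    using p0 by (auto simp: inj_on_def replicate_eq_replicate)
  ultimately have "(\<Sum>gs\<in>{gs \<in> S. rotate1 gs = gs}. w gs) = (\<Sum>g\<in>{g \<in> carrier G. g [^] p \<in> C}. w (replicate p g))"
    by (simp add: sum.reindex)
  also have "\<dots> = (\<Sum>g\<in>{g \<in> carrier G. g [^] p \<in> C}. K z)"
  proof (rule sum.cong[OF HOL.refl])
    fix g assume "g \<in> {g \<in> carrier G. g [^] p \<in> C}"
    then obtain h where g: "g \<in> carrier G" "h \<in> carrier G" "g [^] p = inv h \<otimes> (z [^] p) \<otimes> h"
      by (auto simp: C_def)
    have pw: "(inv h \<otimes> z \<otimes> h) [^] n = inv h \<otimes> (z [^] n) \<otimes> h" for n :: nat
      by (induction n) (use g z in \<open>simp_all add: m_assoc\<close>)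
    have "g = inv h \<otimes> z \<otimes> h"
      by (rule pow_inj_coprime[OF cop]) (use g z pw[of p] in auto)
    then have "K g = K z" using class_funD[OF K(1) z g(2)] by simp
    moreover have "K g ^ p = K g" using K(2)[of g] p0 by auto
    ultimately show "w (replicate p g) = K z" by (simp add: w_def)
  qed
  also have "\<dots> = int (card {g \<in> carrier G. g [^] p \<in> C}) * K z" by simp
  also have "card {g \<in> carrier G. g [^] p \<in> C} = card C"
  proof (rule bij_betw_same_card[of "\<lambda>g. g [^] p"])
    have inj: "inj_on (\<lambda>g. g [^] p) (carrier G)" using pow_inj_coprime[OF cop] by (auto simp: inj_on_def)
    have "(\<lambda>g. g [^] p) ` carrier G = carrier G"
      by (rule endo_inj_surj[OF finite_carrier _ inj]) auto
    then show "bij_betw (\<lambda>g. g [^] p) {g \<in> carrier G. g [^] p \<in> C} C"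
      using CG inj by (auto simp: bij_betw_def inj_on_def image_iff) 
  qed
  finally have "[int (card C) * conv_power K p (z [^] p) = int (card C) * K z] (mod int p)"
    using total fixed by simp
  moreover have "coprime (int (card C)) (int p)"
  proof -
    have C: "0 < card C" "card C \<le> card (carrier G)"
      using finC zC CG finite_carrier by (auto simp: card_gt_0_iff intro: card_mono)
    have "\<not> p dvd card C"
    proof
      assume "p dvd card C"
      then have "p \<le> card C" using C(1) by (rule dvd_imp_le)
      then show False using C(2) p(2) by simp
    qed
    then have "coprime p (card C)" by (rule prime_imp_coprime_nat[OF p(1)])
    then show ?thesis by (simp add: coprime_commute)
  qed
  ultimately show ?thesis by (simp add: cong_mult_lcancel)
qed

lemma spectrum_finite: "finite {\<alpha>. \<exists>e. spectral_idempotent K \<alpha> e}"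
proof -
  obtain q where q: "q \<noteq> 0" "peval q (\<lambda>x. of_int (K x) :: complex) = (\<lambda>x. 0)"
    using peval_annihilator_exists by blast
  have "poly q \<alpha> = 0" if e: "spectral_idempotent K \<alpha> e" for \<alpha> e
  proof -
    have "supported e" using e supported_peval by (auto simp: spectral_idempotent_def)
    then have "peval q (\<lambda>x. of_int (K x)) \<star> e = (\<lambda>x. poly q \<alpha> * e x)"
      using e by (intro peval_eigenvector) (auto simp: spectral_idempotent_def)
    then show ?thesis using q(2) e by (auto simp: spectral_idempotent_def fun_eq_iff)
  qed
  then have "{\<alpha>. \<exists>e. spectral_idempotent K \<alpha> e} \<subseteq> {\<alpha>. poly q \<alpha> = 0}" by auto
  then show ?thesis using poly_roots_finite[OF q(1)] finite_subset by blast
qed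

lemma peval_sum: "peval (\<Sum>i\<in>I. p i) K = (\<lambda>x. \<Sum>i\<in>I. peval (p i) K x)"
  by (induction I rule: infinite_finite_induct) (auto simp: peval_add)

lemma peval_int_eq_0:
  assumes K: "sym_class_fun K" and Z: "\<And>\<alpha> e. spectral_idempotent K \<alpha> e \<Longrightarrow> ieval P \<alpha> = 0"
  shows "peval P K = (\<lambda>x. 0)"
  using spectral_theorem[OF K, of "map_poly of_int P"] Z
  by (simp add: peval_of_int fun_eq_iff)

text \<open>Lagrange interpolation of \<open>x\<^sup>p - x\<close> at the eigenvalues, multiplied by the common denominator \<open>D\<close>,
  has coefficients divisible by \<open>p\<close> by Fermat's little theorem.\<close>

lemma integral_spectrum_power_cong:
  fixes K :: "'a \<Rightarrow> int"
  assumes K: "sym_class_fun K"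
    and int: "\<And>\<alpha> e. spectral_idempotent K \<alpha> e \<Longrightarrow> \<alpha> \<in> \<int>"
  shows "\<exists>D::int. D \<noteq> 0 \<and> (\<forall>p x. Factorial_Ring.prime p \<longrightarrow> \<not> int p dvd D \<longrightarrow> [conv_power K p x = K x] (mod int p))"
proof -
  define L where "L = {a::int. \<exists>e. spectral_idempotent K (of_int a) e}"
  have "of_int ` L \<subseteq> {\<alpha>. \<exists>e. spectral_idempotent K \<alpha> e}" by (auto simp: L_def)
  then have "finite (of_int ` L :: complex set)" using spectrum_finite by (rule finite_subset)
  then have finL: "finite L" by (rule finite_imageD) (auto simp: inj_on_def)
  \<comment> \<open>Up to the factor \<open>d a\<close> these are the Lagrange basis polynomials, and \<open>D' a\<close> clears the denominators.\<close>
  define l where "l a = (\<Prod>b\<in>L - {a}. [:-b, 1:])" for a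
  define d where "d a = poly (l a) a" for a
  define D where "D = (\<Prod>a\<in>L. d a)"
  define D' where "D' a = (\<Prod>b\<in>L - {a}. d b)" for a
  have l_other: "poly (l a) c = 0" if "c \<in> L" "c \<noteq> a" for a c
    using that finL by (auto simp: l_def poly_prod prod_zero_iff)
  have d0: "d a \<noteq> 0" for a using finL by (auto simp: d_def l_def poly_prod prod_zero_iff)
  have dD: "d a * D' a = D" if "a \<in> L" for a
    unfolding D_def D'_def using that finL by (simp add: prod.remove)
  have "[conv_power K p x = K x] (mod int p)" if p: "Factorial_Ring.prime p" "\<not> int p dvd D" for p x
  proof -
    define f :: "int poly" where "f = [:0, 1:] ^ p - [:0, 1:]"
    define P where "P = smult D f - (\<Sum>a\<in>L. smult (poly f a * D' a) (l a))"
    have Pc: "poly P c = 0" if c: "c \<in> L" for c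
    proof -
      have "(\<Sum>a\<in>L. poly f a * D' a * poly (l a) c) = (\<Sum>a\<in>L. if a = c then poly f c * D' c * d c else 0)"
        using l_other[OF c] by (intro sum.cong HOL.refl) (auto simp: d_def)
      then show ?thesis using c finL dD[OF c] by (simp add: P_def poly_sum mult_ac)
    qed
    have "peval P K = (\<lambda>x. 0)"
    proof (rule peval_int_eq_0[OF K])
      fix \<alpha> e assume e: "spectral_idempotent K \<alpha> e"
      from int[OF e] obtain c where c: "\<alpha> = of_int c" by (rule Ints_cases)
      then have "poly P c = 0" using e Pc by (auto simp: L_def)
      moreover have "ieval P (of_int c :: complex) = of_int (poly P c)"
        by (rule of_int_hom.poly_map_poly)
      ultimately show "ieval P \<alpha> = 0" using c by simp
    qed
    then have "D * peval f K x - (\<Sum>a\<in>L. poly f a * D' a * peval (l a) K x) = 0"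
      unfolding P_def peval_diff peval_smult peval_sum by (simp add: fun_eq_iff)
    then have eq: "D * peval f K x = (\<Sum>a\<in>L. poly f a * D' a * peval (l a) K x)" by simp
    have "int p dvd poly f a" for a using int_fermat[OF p(1)] by (simp add: f_def)
    then have "int p dvd D * peval f K x" unfolding eq by (intro dvd_sum) (simp add: mult.assoc)
    moreover have "Factorial_Ring.prime (int p)" using p(1) by simp
    ultimately have "int p dvd peval f K x" using p(2) by (simp add: prime_dvd_mult_iff)
    moreover have "supported K" using K by (rule sym_class_fun_supported)
    ultimately show ?thesis by (simp add: f_def peval_diff peval_power peval_X cong_iff_dvd_diff)
  qed
  moreover have "D \<noteq> 0" using d0 finL by (simp add: D_def)
  ultimately show ?thesis by blast
qed

text \<open>All eigenvalues are roots of the characteristic polynomial of the integer matrix of \<open>K\<close>.\<close>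

lemma spectrum_algebraic_integer:
  "\<exists>\<chi>::int poly. lead_coeff \<chi> = 1 \<and> (\<forall>\<alpha> e. spectral_idempotent K \<alpha> e \<longrightarrow> ieval \<chi> \<alpha> = 0)"
proof -
  let ?n = "card (carrier G)"
  obtain h where h: "bij_betw h {0..<?n} (carrier G)"
    using ex_bij_betw_nat_finite[OF finite_carrier] by blast
  have hG: "h i \<in> carrier G" if "i < ?n" for i using h that by (auto simp: bij_betw_def)
  define M where "M = mat ?n ?n (\<lambda>(i, j). K (h i \<otimes> inv (h j)))"
  have M: "M \<in> carrier_mat ?n ?n" by (simp add: M_def)
  let ?M = "map_mat of_int M :: complex mat"
  have M': "?M \<in> carrier_mat ?n ?n" using M by simp
  have "ieval (char_poly M) \<alpha> = 0" if e: "spectral_idempotent K \<alpha> e" for \<alpha> e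
  proof -
    define v where "v = vec ?n (\<lambda>i. e (h i))"
    have v: "v \<in> carrier_vec ?n" by (simp add: v_def)
    have supp: "supported e" using e supported_peval by (auto simp: spectral_idempotent_def)
    have "v \<noteq> 0\<^sub>v ?n"
    proof
      assume v0: "v = 0\<^sub>v ?n"
      have "e x = 0" for x
      proof (cases "x \<in> carrier G")
        case True
        then have "x \<in> h ` {0..<?n}" using h by (simp add: bij_betw_def)
        then obtain i where i: "i < ?n" "x = h i" by auto
        then have "e x = v $ i" by (simp add: v_def)
        then show ?thesis using v0 i by simp
      qed (use supp in \<open>simp add: supported_def\<close>)
      then show False using e by (auto simp: spectral_idempotent_def)
    qed
    moreover have "?M *\<^sub>v v = \<alpha> \<cdot>\<^sub>v v"
    proof (rule eq_vecI)
      fix i assume "i < dim_vec (\<alpha> \<cdot>\<^sub>v v)"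
      then have i: "i < ?n" using v by simp
      have "(?M *\<^sub>v v) $ i = (\<Sum>j\<in>{0..<?n}. of_int (K (h i \<otimes> inv (h j))) * e (h j))"
        using i by (simp add: M_def v_def scalar_prod_def)
      also have "\<dots> = (\<Sum>y\<in>carrier G. of_int (K (h i \<otimes> inv y)) * e y)"
        by (rule sum.reindex_bij_betw[OF h])
      also have "\<dots> = (\<Sum>y\<in>carrier G. of_int (K (h i \<otimes> inv y)) * e (inv (h i \<otimes> inv y) \<otimes> h i))"
        using hG[OF i] by (intro sum.cong HOL.refl) (simp add: inv_mult_group m_assoc)
      also have "\<dots> = (\<Sum>y\<in>carrier G. of_int (K y) * e (inv y \<otimes> h i))"
        by (rule sum_inv_translate[symmetric]) (rule hG[OF i])
      also have "\<dots> = ((\<lambda>x. of_int (K x)) \<star> e) (h i)" using hG[OF i] by (simp add: conv_def)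
      also have "\<dots> = (\<alpha> \<cdot>\<^sub>v v) $ i" using e i by (simp add: spectral_idempotent_def v_def)
      finally show "(?M *\<^sub>v v) $ i = (\<alpha> \<cdot>\<^sub>v v) $ i" .
    qed (use M v in auto)
    ultimately have "eigenvalue ?M \<alpha>"
      unfolding eigenvalue_def eigenvector_def using v M by (intro exI[of _ v]) auto
    then have "poly (char_poly ?M) \<alpha> = 0" using eigenvalue_root_char_poly[OF M'] by simp
    then show ?thesis using of_int_hom.char_poly_hom[OF M] by metis
  qed
  moreover have "lead_coeff (char_poly M) = 1" using degree_monic_char_poly[OF M] by simp
  ultimately show ?thesis by blast
qed

lemma prime_factor_with_root:
  fixes \<chi> :: "int poly" and a :: real
  assumes monic: "lead_coeff \<chi> = 1" and root: "ieval \<chi> a = 0"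
  shows "\<exists>f. prime_elem f \<and> lead_coeff f = 1 \<and> f dvd \<chi> \<and> ieval f a = 0"
proof -
  have chi0: "\<chi> \<noteq> 0" using monic by auto
  define A where "A = prime_factorization \<chi>"
  have "normalize (prod_mset A) = normalize \<chi>"
    unfolding A_def by (rule prod_mset_prime_factorization_weak[OF chi0])
  then have "\<chi> dvd prod_mset A" by (metis associated_iff_dvd)
  then have prodA: "ieval (prod_mset A) a = 0" using root by (auto elim!: dvdE)
  have "ieval (prod_mset B) a = 0 \<Longrightarrow> \<exists>f\<in>#B. ieval f a = 0" for B :: "int poly multiset"
    by (induction B) auto
  from this[of A] obtain f where f: "f \<in># A" "ieval f a = 0" using prodA by auto
  have pf: "Factorial_Ring.prime f" using f(1) by (auto simp: A_def)
  have dvd: "f dvd \<chi>" using f(1) by (simp add: A_def in_prime_factors_iff)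
  then obtain g where "\<chi> = f * g" by auto
  then have lc: "lead_coeff f * lead_coeff g = 1" using monic by (simp add: lead_coeff_mult)
  have "unit_factor f = 1" using pf by (rule unit_factor_prime)
  then have "sgn (lead_coeff f) = 1" by (simp add: unit_factor_poly_def one_pCons)
  then have "lead_coeff f > 0" by (simp add: sgn_1_pos)
  then have "lead_coeff f = 1" using lc zmult_eq_1_iff by auto
  then show ?thesis using pf f(2) dvd by (intro exI[of _ f]) (auto simp: prime_imp_prime_elem)
qed

text \<open>If \<open>\<alpha>\<close> is not an integer, its minimal polynomial \<open>f\<close> has degree at least \<open>2\<close>. Split an annihilating
  polynomial of \<open>K\<close> as \<open>f h\<close> with coprime factors; then \<open>h h' \<equiv> R\<close> modulo \<open>f\<close> for some \<open>h'\<close> and a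
  nonzero integer \<open>R\<close>. A unit \<open>1 + R z\<close> modulo \<open>f\<close> becomes the unit \<open>1 + h h' z\<close> modulo \<open>f h\<close>, which
  is \<open>1\<close> modulo \<open>h\<close>. Its value at \<open>K\<close> is a central unit that multiplies \<open>e\<close> by a number of absolute
  value different from \<open>1\<close>, whereas trivial units preserve the norm of \<open>e\<close>.\<close>

lemma spectrum_integral:
  fixes K :: "'a \<Rightarrow> int"
  assumes K: "sym_class_fun K" and e: "spectral_idempotent K \<alpha> e"
    and trivial: "\<And>u v :: 'a \<Rightarrow> int. class_fun u \<Longrightarrow> class_fun v \<Longrightarrow> u \<star> v = delta \<Longrightarrow>
      \<exists>g\<in>carrier G. u = (\<lambda>x. if x = g then 1 else 0) \<or> u = (\<lambda>x. if x = g then -1 else 0)"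
  shows "\<alpha> \<in> \<int>"
proof -
  obtain a where a: "\<alpha> = of_real a" using e by (auto simp: spectral_idempotent_def elim: Reals_cases)
  have ieval_a: "ieval p \<alpha> = of_real (ieval p a)" for p
    unfolding a by (induction p) (simp_all add: of_int_hom.map_poly_pCons_hom)
  obtain \<chi> :: "int poly" where \<chi>: "lead_coeff \<chi> = 1" "\<And>\<alpha> e. spectral_idempotent K \<alpha> e \<Longrightarrow> ieval \<chi> \<alpha> = 0"
    using spectrum_algebraic_integer by blast
  have "ieval \<chi> a = 0" using \<chi>(2)[OF e] ieval_a by simp
  from prime_factor_with_root[OF \<chi>(1) this] obtain f where
    f: "prime_elem f" "lead_coeff f = 1" "f dvd \<chi>" "ieval f a = 0" by blast
  have nunit: "\<not> is_unit f" using f(1) by (simp add: prime_elem_def)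
  have "degree f \<noteq> 0"
  proof
    assume "degree f = 0"
    then obtain c where "f = [:c:]" by (rule degree_eq_zeroE)
    then show False using f(2) nunit by simp
  qed
  show ?thesis
  proof (cases "degree f = 1")
    case True
    then obtain b c where bc: "f = [:b, c:]" by (metis degree1_coeffs)
    then have "f = [:b, 1:]" using f(2) True by (auto split: if_splits)
    then have "a = of_int (- b)" using f(4) by (simp add: of_int_hom.map_poly_pCons_hom)
    then show ?thesis using a by simp
  next
    case False
    then interpret real_order f "degree f" a
      using f \<open>degree f \<noteq> 0\<close> by unfold_locales auto
    have chi0: "\<chi> \<noteq> 0" using \<chi>(1) by auto
    \<comment> \<open>\<open>\<chi>\<close> may have multiple factors, but \<open>f h\<close> has the same roots among the eigenvalues as \<open>\<chi>\<close>.\<close>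
    obtain h where h: "\<chi> = f ^ multiplicity f \<chi> * h" "\<not> f dvd h"
      using multiplicity_decompose'[OF chi0 nunit] by metis
    have fhK: "peval (f * h) K = (\<lambda>x. 0)"
    proof (rule peval_int_eq_0[OF K])
      fix \<beta> e' assume "spectral_idempotent K \<beta> e'"
      then have "ieval \<chi> \<beta> = 0" by (rule \<chi>(2))
      moreover have "ieval (f ^ m) \<beta> = ieval f \<beta> ^ m" for m by (induction m) auto
      ultimately have "ieval f \<beta> ^ multiplicity f \<chi> * ieval h \<beta> = 0" by (metis h(1) ieval_simps(3))
      then show "ieval (f * h) \<beta> = 0" by auto
    qed
    obtain h' b R where R: "R \<noteq> 0" "h' * h + b * f = [:R:]"
      using prime_poly_bezout_constant[OF f(1) _ h(2)] \<open>degree f \<noteq> 0\<close> by blast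
    obtain z z' where z: "f dvd (1 + smult R z) * (1 + smult R z') - 1"
      "\<bar>ieval (1 + smult R z) a\<bar> \<noteq> 1" using exists_unit_of_infinite_order[OF R(1)] by blast
    define v where "v = 1 + h * h' * z"
    define v' where "v' = 1 + h * h' * z'"
    have hh: "h * h' = [:R:] - b * f" using R(2) by (simp add: algebra_simps)
    have "f dvd z + z' + h * h' * z * z'"
    proof -
      have "(1 + smult R z) * (1 + smult R z') - 1 = [:R:] * (z + z' + smult R (z * z'))"
        by (simp add: algebra_simps smult_add_right)
      then have "f dvd [:R:] * (z + z' + smult R (z * z'))" using z(1) by simp
      moreover have "\<not> f dvd [:R:]" by (rule not_dvd_small) (use R(1) d2 in auto)
      ultimately have "f dvd z + z' + smult R (z * z')" using f(1) prime_elem_dvd_mult_iff by blast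
      moreover have "z + z' + h * h' * z * z' = (z + z' + smult R (z * z')) - f * (b * z * z')"
        unfolding hh by (simp add: algebra_simps)
      ultimately show ?thesis by (simp only: dvd_diff dvd_triv_left)
    qed
    then obtain c where c: "z + z' + h * h' * z * z' = f * c" by auto
    have "v * v' - 1 = h * h' * (z + z' + h * h' * z * z')" by (simp add: v_def v'_def algebra_simps)
    then have vv: "v * v' = f * h * (h' * c) + 1" unfolding c by (simp add: algebra_simps)
    have "peval v K \<star> peval v' K = delta"
      unfolding peval_mult[symmetric] vv peval_add peval_mult[of "f * h"] fhK by (simp add: peval_1)
    moreover have "class_fun (peval v K)" "class_fun (peval v' K)"
      using sym_class_fun_peval[OF K] by (auto simp: sym_class_fun_def)
    ultimately obtain g where g: "g \<in> carrier G"
      "peval v K = (\<lambda>x. if x = g then 1 else 0) \<or> peval v K = (\<lambda>x. if x = g then -1 else 0)"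
      using trivial by blast
    then have v_eq: "\<exists>s. s \<in> {1, -1} \<and> peval v K = (\<lambda>x. if x = g then s else 0)" by blast
    then obtain s where s: "s \<in> {1, -1}" "peval v K = (\<lambda>x. if x = g then s else 0)" by blast
    have supp: "supported e" using e supported_peval by (auto simp: spectral_idempotent_def)
    have "(\<lambda>x. of_int (peval v K x)) \<star> e = (\<lambda>x. ieval v \<alpha> * e x)"
      using e supp peval_eigenvector[of "\<lambda>x. of_int (K x)" e \<alpha> "map_poly of_int v"]
      by (simp add: peval_of_int spectral_idempotent_def)
    moreover have "((\<lambda>x. of_int (peval v K x)) \<star> e) x = of_int s * e (inv g \<otimes> x)" if "x \<in> carrier G" for x
    proof -
      have "((\<lambda>x. of_int (peval v K x)) \<star> e) x = (\<Sum>y\<in>carrier G. if y = g then of_int s * e (inv g \<otimes> x) else 0)"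
        using that unfolding s(2) by (auto simp: conv_def intro!: sum.cong)
      then show ?thesis using g(1) finite_carrier by simp
    qed
    ultimately have eq: "ieval v \<alpha> * e x = of_int s * e (inv g \<otimes> x)" if "x \<in> carrier G" for x
      using that by (simp add: fun_eq_iff)
    \<comment> \<open>A trivial unit permutes the values of \<open>e\<close> up to sign, so it preserves the norm.\<close>
    have "(\<Sum>x\<in>carrier G. (cmod (ieval v \<alpha> * e x))\<^sup>2) = (\<Sum>x\<in>carrier G. (cmod (e (inv g \<otimes> x)))\<^sup>2)"
      using eq s(1) by (intro sum.cong HOL.refl) (auto simp: norm_mult)
    also have "\<dots> = (\<Sum>x\<in>carrier G. (cmod (e x))\<^sup>2)"
      by (rule sum_left_translate[symmetric]) (use g in simp)
    finally have "(cmod (ieval v \<alpha>))\<^sup>2 * (\<Sum>x\<in>carrier G. (cmod (e x))\<^sup>2) = (\<Sum>x\<in>carrier G. (cmod (e x))\<^sup>2)"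
      by (simp add: norm_mult power_mult_distrib sum_distrib_left)
    moreover have "(\<Sum>x\<in>carrier G. (cmod (e x))\<^sup>2) > 0"
    proof -
      obtain x where "e x \<noteq> 0" using e by (auto simp: spectral_idempotent_def fun_eq_iff)
      moreover from this have "x \<in> carrier G" using supp by (auto simp: supported_def)
      ultimately show ?thesis by (intro sum_pos2[OF finite_carrier]) auto
    qed
    ultimately have "(cmod (ieval v \<alpha>))\<^sup>2 = 1" by simp
    then have "cmod (ieval v \<alpha>) = 1" by (simp add: power2_eq_1_iff) (metis norm_ge_zero not_one_le_zero neg_0_le_iff_le)
    then have "\<bar>ieval v a\<bar> = 1" by (simp only: ieval_a norm_of_real) 
    moreover have "ieval v a = ieval (1 + smult R z) a"
    proof -
      have "ieval (h * h') a = of_int R" unfolding hh using f(4) by (simp add: of_int_hom.map_poly_pCons_hom)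
      then show ?thesis by (simp add: v_def)
    qed
    ultimately show ?thesis using z(2) by simp
  qed
qed

text \<open>The indicator function \<open>K\<close> of \<open>T\<close>, the set of conjugates of \<open>x\<^sub>0\<close> and of its inverse, satisfies
  \<open>K(z\<^sup>p) = K(z)\<close> for all large primes \<open>p\<close>. An exponent \<open>k \<equiv> k\<^sub>0\<close> modulo the group order all of whose
  prime factors are large does the rest; Dirichlet's theorem on primes in progressions is avoided by
  iterating over the prime factors of \<open>k\<close>.\<close>

theorem trivial_central_units_imp_inverse_semirational:
  assumes trivial: "\<And>u v :: 'a \<Rightarrow> int. class_fun u \<Longrightarrow> class_fun v \<Longrightarrow> u \<star> v = delta \<Longrightarrow>
      \<exists>g\<in>carrier G. u = (\<lambda>x. if x = g then 1 else 0) \<or> u = (\<lambda>x. if x = g then -1 else 0)"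
  shows "inverse_semirational G"
  unfolding inverse_semirational_def
proof (intro ballI allI impI)
  let ?N = "card (carrier G)"
  fix x0 and k0 :: nat assume x0: "x0 \<in> carrier G" and k0: "coprime k0 ?N"
  define rel where "rel x g \<longleftrightarrow> x \<otimes> g = g \<otimes> x0 \<or> x \<otimes> g = g \<otimes> inv x0" for x g
  define T where "T = {x \<in> carrier G. \<exists>g\<in>carrier G. rel x g}"
  define K where "K x = (if x \<in> T then 1 else 0 :: int)" for x
  have T_conj: "inv y \<otimes> x \<otimes> y \<in> T" if "x \<in> T" "y \<in> carrier G" for x y
  proof -
    obtain g where g: "g \<in> carrier G" "rel x g" "x \<in> carrier G" using \<open>x \<in> T\<close> by (auto simp: T_def)
    have "rel (inv y \<otimes> x \<otimes> y) (inv y \<otimes> g)"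
      using g that(2) x0 by (auto simp: rel_def m_assoc)
    then show ?thesis using g that(2) by (auto simp: T_def)
  qed
  have T_inv: "inv x \<in> T" if "x \<in> T" for x
  proof -
    obtain g where g: "g \<in> carrier G" "rel x g" "x \<in> carrier G" using \<open>x \<in> T\<close> by (auto simp: T_def)
    have flip: "inv x \<otimes> g = g \<otimes> inv c" if "x \<otimes> g = g \<otimes> c" "c \<in> carrier G" for c
    proof -
      have "inv x \<otimes> (g \<otimes> c) = g" using g that inv_cancel_left(2)[of x g] by simp
      then have "g = inv x \<otimes> g \<otimes> c" using g that by (simp add: m_assoc)
      then show ?thesis using g that by (metis inv_solve_right inv_closed m_closed)
    qed
    have "rel (inv x) g" using flip[of x0] flip[of "inv x0"] g(2) x0 by (auto simp: rel_def)
    then show ?thesis using g by (auto simp: T_def)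
  qed
  have symK: "sym_class_fun K"
    unfolding sym_class_fun_def
  proof (intro conjI ballI class_funI)
    show "supported K" by (auto simp: supported_def K_def T_def)
    fix x assume x: "x \<in> carrier G"
    show "K (inv x) = K x" using T_inv[of x] T_inv[of "inv x"] x by (auto simp: K_def)
    fix y assume y: "y \<in> carrier G"
    have "inv (inv y) \<otimes> (inv y \<otimes> x \<otimes> y) \<otimes> inv y = x" using x y by (simp add: m_assoc)
    then show "K (inv y \<otimes> x \<otimes> y) = K x"
      using T_conj[of x y] T_conj[of "inv y \<otimes> x \<otimes> y" "inv y"] x y by (auto simp: K_def)
  qed
  have cK: "class_fun K" using symK by (simp add: sym_class_fun_def)
  have integral: "\<alpha> \<in> \<int>" if e: "spectral_idempotent K \<alpha> e" for \<alpha> e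
    by (rule spectrum_integral[OF symK e trivial])
  have "\<exists>D::int. D \<noteq> 0 \<and> (\<forall>p x. Factorial_Ring.prime p \<longrightarrow> \<not> int p dvd D \<longrightarrow> [conv_power K p x = K x] (mod int p))"
    by (rule integral_spectrum_power_cong[OF symK]) (rule integral)
  then obtain D :: int where D0: "D \<noteq> 0"
    and D': "\<forall>p x. Factorial_Ring.prime p \<longrightarrow> \<not> int p dvd D \<longrightarrow> [conv_power K p x = K x] (mod int p)"
    by (elim exE conjE)
  have D: "[conv_power K p x = K x] (mod int p)" if "Factorial_Ring.prime p" "\<not> int p dvd D" for p x
    using D' that by simp
  have K_prime: "K (z [^] p) = K z" if p: "Factorial_Ring.prime p" "p > ?N" "\<not> int p dvd D" and z: "z \<in> carrier G" for p z
  proof -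
    have "[conv_power K p (z [^] p) = K z] (mod int p)"
      by (rule conv_power_prime_cong[OF cK _ p(1,2) z]) (simp add: K_def)
    moreover have "[conv_power K p (z [^] p) = K (z [^] p)] (mod int p)" by (rule D[OF p(1,3)])
    ultimately have "[K (z [^] p) = K z] (mod int p)" by (metis cong_sym cong_trans)
    moreover have "p > 1" using p(1) by (rule prime_gt_1_nat)
    ultimately show ?thesis by (auto simp: K_def cong_def split: if_splits)
  qed
  have K_pow: "K (z [^] k) = K z"
    if "k > 0" "\<And>p. Factorial_Ring.prime p \<Longrightarrow> p dvd k \<Longrightarrow> p > ?N \<and> \<not> int p dvd D" "z \<in> carrier G" for k z
    using that
  proof (induction k arbitrary: z rule: less_induct)
    case (less k)
    show ?case
    proof (cases "k = 1")
      case False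
      then obtain p m where pm: "Factorial_Ring.prime p" "k = p * m" using prime_factor_nat by (metis dvdE)
      then have m: "m > 0" "m < k" using less.prems(1) prime_gt_1_nat[OF pm(1)] by auto
      have "K (z [^] k) = K ((z [^] p) [^] m)" using less.prems(3) pm by (simp add: nat_pow_pow)
      also have "\<dots> = K (z [^] p)" using less.prems m pm by (intro less.IH) auto
      also have "\<dots> = K z" using less.prems(2)[of p] less.prems(3) pm by (intro K_prime) auto
      finally show ?thesis .
    qed (use less.prems in simp)
  qed
  have "2 * ?N * (nat \<bar>D\<bar> * fact ?N) > 0" using D0 finite_carrier x0 by (auto simp: card_gt_0_iff)
  then obtain k where k: "[k = k0] (mod ?N)" "coprime k (2 * ?N * (nat \<bar>D\<bar> * fact ?N))"
    using coprime_lift[OF k0] by blast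
  have "k > 0" using k(2) by (intro Nat.gr0I) auto
  moreover have "p > ?N \<and> \<not> int p dvd D" if p: "Factorial_Ring.prime p" "p dvd k" for p
  proof -
    have np: "\<not> p dvd 2 * ?N * (nat \<bar>D\<bar> * fact ?N)"
      using k(2) p by (metis coprime_common_divisor_nat not_prime_1)
    have "p > ?N"
    proof (rule ccontr)
      assume "\<not> p > ?N"
      then have "p dvd fact ?N" using prime_gt_0_nat[OF p(1)] by (intro dvd_fact) auto
      then show False using np by (simp add: dvd_mult)
    qed
    moreover have "\<not> int p dvd D"
    proof
      assume "int p dvd D"
      then have "p dvd nat \<bar>D\<bar>" by simp
      then show False using np by (simp add: dvd_mult dvd_mult2)
    qed
    ultimately show ?thesis by simp
  qed
  ultimately have "K (x0 [^] k) = K x0" by (intro K_pow x0) auto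
  moreover have "x0 \<in> T" unfolding T_def rel_def using x0 by (auto intro!: bexI[of _ \<one>])
  ultimately have "x0 [^] k \<in> T" by (auto simp: K_def split: if_splits)
  moreover have "x0 [^] k = x0 [^] k0" by (rule pow_cong_card[OF x0 k(1)])
  ultimately show "\<exists>g\<in>carrier G. x0 [^] k0 \<otimes> g = g \<otimes> x0 \<or> x0 [^] k0 \<otimes> g = g \<otimes> inv x0"
    by (auto simp: T_def rel_def)
qed

end

section \<open>Translation to the integral group ring\<close>

context finite_group
begin

abbreviation ZG :: "('a \<Rightarrow>\<^sub>0 int) ring" where "ZG \<equiv> integral_group_ring G"

abbreviation cf :: "('a \<Rightarrow>\<^sub>0 int) \<Rightarrow> 'a \<Rightarrow> int" where "cf \<equiv> poly_mapping.lookup"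

lemma ZG_carrier_iff: "p \<in> carrier ZG \<longleftrightarrow> supported (cf p)"
  by (auto simp: integral_group_ring_def supported_def in_keys_iff subset_iff) 

lemma lookup_frag_extend:
  assumes "supported (cf p)"
  shows "cf (frag_extend b p) z = (\<Sum>i\<in>carrier G. cf p i * cf (b i) z)"
proof -
  have "cf (frag_extend b p) z = (\<Sum>i\<in>Poly_Mapping.keys p. cf p i * cf (b i) z)"
    by (simp add: frag_extend_def lookup_sum)
  also have "\<dots> = (\<Sum>i\<in>carrier G. cf p i * cf (b i) z)"
    by (rule sum.mono_neutral_left)
       (use assms finite_carrier in \<open>auto simp: supported_def in_keys_iff\<close>)
  finally show ?thesis .
qed

lemma cf_frag_of: "cf (frag_of g) = (\<lambda>x. if x = g then 1 else 0)"
  by (auto simp: fun_eq_iff lookup_single when_def)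

lemma lookup_ZG_mult:
  assumes "p \<in> carrier ZG" "q \<in> carrier ZG"
  shows "cf (p \<otimes>\<^bsub>ZG\<^esub> q) = cf p \<star> cf q"
proof
  fix x
  have s: "supported (cf p)" "supported (cf q)" using assms ZG_carrier_iff by auto
  have "cf (p \<otimes>\<^bsub>ZG\<^esub> q) x = (\<Sum>y\<in>carrier G. cf p y * (\<Sum>w\<in>carrier G. cf q w * (if x = y \<otimes> w then 1 else 0)))"
    by (simp add: integral_group_ring_def lookup_frag_extend s cf_frag_of)
  also have "\<dots> = (cf p \<star> cf q) x"
  proof (cases "x \<in> carrier G")
    case True
    have "(\<Sum>w\<in>carrier G. cf q w * (if x = y \<otimes> w then 1 else 0)) = cf q (inv y \<otimes> x)"
      if y: "y \<in> carrier G" for y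
    proof -
      have "(\<Sum>w\<in>carrier G. cf q w * (if x = y \<otimes> w then 1 else 0))
          = (\<Sum>w\<in>carrier G. if w = inv y \<otimes> x then cf q w else 0)"
        using True y by (intro sum.cong HOL.refl) auto
      then show ?thesis using True y finite_carrier by simp
    qed
    then show ?thesis using True by (simp add: conv_def)
  next
    case False
    then have "(\<Sum>w\<in>carrier G. cf q w * (if x = y \<otimes> w then 1 else 0)) = 0" if "y \<in> carrier G" for y
      using that by (intro sum.neutral) auto
    then show ?thesis using False by (simp add: conv_def)
  qed
  finally show "cf (p \<otimes>\<^bsub>ZG\<^esub> q) x = (cf p \<star> cf q) x" .
qed

lemma lookup_ZG_one: "cf \<one>\<^bsub>ZG\<^esub> = delta"
  by (simp add: integral_group_ring_def cf_frag_of delta_def fun_eq_iff)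

lemma ZG_Units_iff:
  "u \<in> Units ZG \<longleftrightarrow> u \<in> carrier ZG \<and> (\<exists>v\<in>carrier ZG. cf v \<star> cf u = delta \<and> cf u \<star> cf v = delta)"
proof -
  have "p \<otimes>\<^bsub>ZG\<^esub> q = \<one>\<^bsub>ZG\<^esub> \<longleftrightarrow> cf p \<star> cf q = delta" if "p \<in> carrier ZG" "q \<in> carrier ZG" for p q
    using lookup_ZG_mult[OF that] lookup_ZG_one by (metis poly_mapping.lookup_inject)
  then show ?thesis unfolding Units_def by blast
qed

lemma ZG_commute_iff:
  assumes "p \<in> carrier ZG" "q \<in> carrier ZG"
  shows "p \<otimes>\<^bsub>ZG\<^esub> q = q \<otimes>\<^bsub>ZG\<^esub> p \<longleftrightarrow> cf p \<star> cf q = cf q \<star> cf p"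
  using lookup_ZG_mult[OF assms] lookup_ZG_mult[OF assms(2,1)] by (metis poly_mapping.lookup_inject)

lemma frag_of_conv:
  assumes "g \<in> carrier G" "x \<in> carrier G"
  shows "(cf (frag_of g) \<star> f) x = f (inv g \<otimes> x)" and "(f \<star> cf (frag_of g)) x = f (x \<otimes> inv g)"
proof -
  have "(cf (frag_of g) \<star> f) x = (\<Sum>y\<in>carrier G. if y = g then f (inv g \<otimes> x) else 0)"
    using assms(2) by (auto simp: conv_def cf_frag_of intro: sum.cong)
  then show "(cf (frag_of g) \<star> f) x = f (inv g \<otimes> x)" using assms finite_carrier by simp
  have "(f \<star> cf (frag_of g)) x = (\<Sum>y\<in>carrier G. if y = x \<otimes> inv g then f (x \<otimes> inv g) else 0)"
  proof -
    have "inv y \<otimes> x = g \<longleftrightarrow> y = x \<otimes> inv g" if "y \<in> carrier G" for y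
      using assms that by (metis inv_solve_left inv_solve_right inv_closed m_closed inv_inv inv_equality)
    then show ?thesis
      using assms(2) by (auto simp: conv_def cf_frag_of intro!: sum.cong)
  qed
  then show "(f \<star> cf (frag_of g)) x = f (x \<otimes> inv g)" using assms finite_carrier by simp
qed

lemma frag_of_Units:
  assumes "g \<in> carrier G"
  shows "frag_of g \<in> Units ZG" and "- frag_of g \<in> Units ZG"
proof -
  have dd: "cf (frag_of h) \<star> cf (frag_of (inv h)) = delta" if "h \<in> carrier G" for h
  proof
    fix x
    show "(cf (frag_of h) \<star> cf (frag_of (inv h))) x = delta x"
    proof (cases "x \<in> carrier G")
      case True
      have "inv h \<otimes> x = inv h \<longleftrightarrow> x = \<one>" using that True by simp
      then show ?thesis unfolding frag_of_conv(1)[OF that True] by (simp add: cf_frag_of delta_def)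
    qed (auto simp: conv_def delta_def)
  qed
  have supp: "supported (cf (frag_of h))" "supported (cf (- frag_of h))" if "h \<in> carrier G" for h
    using that by (auto simp: supported_def cf_frag_of)
  have neg: "cf (- frag_of h) = (\<lambda>x. -1 * cf (frag_of h) x)" for h :: 'a by auto
  show "frag_of g \<in> Units ZG" unfolding ZG_Units_iff
    using assms dd[of g] dd[of "inv g"] supp
    by (intro conjI bexI[of _ "frag_of (inv g)"]) (auto simp: ZG_carrier_iff)
  have nn: "cf (- frag_of h) \<star> cf (- frag_of k) = cf (frag_of h) \<star> cf (frag_of k)" for h k :: 'a
    unfolding neg conv_scale_left conv_scale_right by simp
  show "- frag_of g \<in> Units ZG" unfolding ZG_Units_iff ZG_carrier_iff
  proof (intro conjI bexI[of _ "- frag_of (inv g)"])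
    show "- frag_of (inv g) \<in> carrier ZG" unfolding ZG_carrier_iff using assms by (intro supp) simp
    show "cf (- frag_of (inv g)) \<star> cf (- frag_of g) = delta" unfolding nn using dd[of "inv g"] assms by simp
    show "cf (- frag_of g) \<star> cf (- frag_of (inv g)) = delta" unfolding nn by (rule dd[OF assms])
  qed (rule supp(2)[OF assms])
qed

lemma central_unit_class_fun:
  assumes "u \<in> group_center (units_of ZG)"
  shows "class_fun (cf u)"
proof (rule class_funI)
  have u: "u \<in> Units ZG" "\<And>w. w \<in> Units ZG \<Longrightarrow> w \<otimes>\<^bsub>ZG\<^esub> u = u \<otimes>\<^bsub>ZG\<^esub> w"
    using assms by (auto simp: group_center_def units_of_def)
  from u(1) have uc: "u \<in> carrier ZG" by (auto simp: ZG_Units_iff)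
  then show "supported (cf u)" by (simp add: ZG_carrier_iff)
  fix x y assume xy: "x \<in> carrier G" "y \<in> carrier G"
  have fy: "frag_of y \<in> Units ZG" by (rule frag_of_Units(1)[OF xy(2)])
  then have "cf (frag_of y) \<star> cf u = cf u \<star> cf (frag_of y)"
    using u(2)[OF fy] ZG_commute_iff[OF _ uc] by (auto simp: ZG_Units_iff)
  then have "cf u (inv y \<otimes> (x \<otimes> y)) = cf u ((x \<otimes> y) \<otimes> inv y)"
    using frag_of_conv[OF xy(2), of "x \<otimes> y" "cf u"] xy by simp
  then show "cf u (inv y \<otimes> x \<otimes> y) = cf u x" using xy by (simp add: m_assoc)
qed

lemma class_fun_unit_central:
  assumes "class_fun (cf u)" "u \<in> Units ZG"
  shows "u \<in> group_center (units_of ZG)"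
  using assms ZG_commute_iff conv_commute[OF assms(1)]
  by (auto simp: group_center_def units_of_def ZG_Units_iff)

text \<open>Under \<open>cf\<close> the integral group ring is the convolution algebra over the integers, and the central
  units are the invertible class functions.\<close>

theorem cut_property_iff_inverse_semirational: "cut_property G \<longleftrightarrow> inverse_semirational G"
proof
  assume cut: "cut_property G"
  show "inverse_semirational G"
  proof (rule trivial_central_units_imp_inverse_semirational)
    fix u v :: "'a \<Rightarrow> int" assume uv: "class_fun u" "class_fun v" "u \<star> v = delta"
    have lookup_Abs: "cf (Abs_poly_mapping f) = f" if "class_fun f" for f :: "'a \<Rightarrow> int"
    proof -
      have "finite {x. f x \<noteq> 0}"
        by (rule finite_subset[OF _ finite_carrier]) (use that in \<open>auto simp: class_fun_def supported_def\<close>)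
      then show ?thesis by (simp add: Abs_poly_mapping_inverse)
    qed
    define U where "U = Abs_poly_mapping u"
    have U: "cf U = u" using lookup_Abs uv by (simp add: U_def)
    have "U \<in> Units ZG"
      unfolding ZG_Units_iff ZG_carrier_iff U
      using uv lookup_Abs[OF uv(2)] conv_commute[OF uv(1), of v]
      by (intro conjI bexI[of _ "Abs_poly_mapping v"]) (auto simp: class_fun_def ZG_carrier_iff)
    then have "U \<in> group_center (units_of ZG)" using uv by (intro class_fun_unit_central) (simp add: U)
    then obtain g where g: "g \<in> group_center G" "U = frag_of g \<or> U = - frag_of g"
      using cut unfolding cut_property_def by blast
    then show "\<exists>g\<in>carrier G. u = (\<lambda>x. if x = g then 1 else 0) \<or> u = (\<lambda>x. if x = g then -1 else 0)"
      unfolding U[symmetric]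
      by (intro bexI[of _ g]) (auto simp: cf_frag_of group_center_def fun_eq_iff)
  qed
next
  assume isr: "inverse_semirational G"
  show "cut_property G"
    unfolding cut_property_def
  proof (intro equalityI subsetI)
    fix u assume u: "u \<in> group_center (units_of ZG)"
    have cf: "class_fun (cf u)" by (rule central_unit_class_fun[OF u])
    obtain v where v: "v \<in> carrier ZG" "cf u \<star> cf v = delta"
      using u by (auto simp: group_center_def units_of_def ZG_Units_iff)
    obtain g where g: "g \<in> carrier G"
      "cf u = (\<lambda>x. if x = g then 1 else 0) \<or> cf u = (\<lambda>x. if x = g then -1 else 0)"
      using isr_central_unit_trivial[OF isr cf _ v(2)] v(1) by (auto simp: ZG_carrier_iff)
    have "g \<in> group_center G"
      unfolding group_center_def
    proof (intro CollectI conjI ballI g(1))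
      fix h assume h: "h \<in> carrier G"
      have "cf u (inv h \<otimes> g \<otimes> h) = cf u g" by (rule class_funD[OF cf g(1) h])
      then have "inv h \<otimes> g \<otimes> h = g" using g(2) by (auto split: if_splits)
      then have "h \<otimes> (inv h \<otimes> (g \<otimes> h)) = h \<otimes> g" using g(1) h by (simp add: m_assoc)
      then show "h \<otimes> g = g \<otimes> h" using g(1) h by simp
    qed
    moreover have "u = frag_of g \<or> u = - frag_of g"
    proof -
      have "cf u = cf (frag_of g) \<or> cf u = cf (- frag_of g)"
        using g(2) by (auto simp: fun_eq_iff cf_frag_of)
      then show ?thesis by (simp only: poly_mapping.lookup_inject)
    qed
    ultimately show "u \<in> {frag_of g | g. g \<in> group_center G} \<union> {- frag_of g | g. g \<in> group_center G}" by blast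
  next
    fix u assume "u \<in> {frag_of g | g. g \<in> group_center G} \<union> {- frag_of g | g. g \<in> group_center G}"
    then obtain g where g: "g \<in> group_center G" "u = frag_of g \<or> u = - frag_of g" by blast
    then have gG: "g \<in> carrier G" by (simp add: group_center_def)
    have fix_g: "inv y \<otimes> x \<otimes> y = g \<longleftrightarrow> x = g" if "x \<in> carrier G" "y \<in> carrier G" for x y
    proof
      assume "inv y \<otimes> x \<otimes> y = g"
      then have "y \<otimes> g = x \<otimes> y" using that by (auto simp: m_assoc)
      moreover have "y \<otimes> g = g \<otimes> y" using g(1) that by (simp add: group_center_def)
      ultimately show "x = g" using gG that by (simp add: r_cancel)
    next
      assume "x = g"
      moreover have "y \<otimes> g = g \<otimes> y" using g(1) that by (simp add: group_center_def)
      ultimately show "inv y \<otimes> x \<otimes> y = g" using gG that by (simp add: m_assoc flip: \<open>y \<otimes> g = g \<otimes> y\<close>)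
    qed
    have "class_fun (cf u)"
      by (rule class_funI) (use g(2) gG fix_g in \<open>auto simp: cf_frag_of supported_def\<close>)
    moreover have "u \<in> Units ZG" using g(2) frag_of_Units[OF gG] by auto
    ultimately show "u \<in> group_center (units_of ZG)" by (rule class_fun_unit_central)
  qed
qed

end

section \<open>Normal forms in metacyclic groups\<close>

text \<open>A pair of elements that satisfies the defining relations, with the conjugation relation in the form
  \<open>A B = B A\<^sup>r\<close>. The pair may generate a proper subgroup, and the group may be a proper quotient of the
  presented one.\<close>

locale metacyclic_pair = group H for H (structure) +
  fixes A B and n t l r :: nat
  assumes A_closed [simp]: "A \<in> carrier H" and B_closed [simp]: "B \<in> carrier H"
    and n0: "n > 0" and t0: "t > 0"
    and A_order: "A [^] n = \<one>" and B_power: "B [^] t = A [^] l" and A_B: "A \<otimes> B = B \<otimes> A [^] r"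
begin

definition nf :: "nat \<Rightarrow> nat \<Rightarrow> 'a" where "nf j i = B [^] j \<otimes> A [^] i"

lemma nf_closed [simp]: "nf j i \<in> carrier H"
  by (simp add: nf_def)

lemma A_pow_B: "A [^] i \<otimes> B = B \<otimes> A [^] (i * r)"
proof (induction i)
  case (Suc i)
  have "A [^] Suc i \<otimes> B = A [^] i \<otimes> (B \<otimes> A [^] r)" by (simp add: m_assoc A_B)
  also have "\<dots> = B \<otimes> A [^] (i * r) \<otimes> A [^] r" by (simp add: m_assoc[symmetric] Suc)
  also have "\<dots> = B \<otimes> A [^] (Suc i * r)" by (simp add: m_assoc nat_pow_mult add.commute)
  finally show ?case .
qed simp

lemma A_pow_B_pow: "A [^] i \<otimes> B [^] j = B [^] j \<otimes> A [^] (i * r ^ j)"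
proof (induction j)
  case (Suc j)
  have "A [^] i \<otimes> B [^] Suc j = B [^] j \<otimes> (A [^] (i * r ^ j) \<otimes> B)"
    by (simp add: m_assoc[symmetric] Suc)
  also have "\<dots> = B [^] Suc j \<otimes> A [^] (i * r ^ Suc j)"
    by (simp add: A_pow_B m_assoc mult_ac)
  finally show ?case .
qed simp

lemma nf_mult: "nf j i \<otimes> nf j' i' = nf (j + j') (i * r ^ j' + i')"
proof -
  have "nf j i \<otimes> nf j' i' = B [^] j \<otimes> (A [^] i \<otimes> B [^] j') \<otimes> A [^] i'"
    by (simp add: nf_def m_assoc)
  also have "\<dots> = (B [^] j \<otimes> B [^] j') \<otimes> (A [^] (i * r ^ j') \<otimes> A [^] i')"
    by (simp add: A_pow_B_pow m_assoc)
  finally show ?thesis by (simp add: nf_def nat_pow_mult)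
qed

lemma A_pow_mod: "A [^] (i mod n) = A [^] i"
proof -
  have "A [^] i = A [^] (n * (i div n) + i mod n)" by simp
  also have "\<dots> = (A [^] n) [^] (i div n) \<otimes> A [^] (i mod n)"
    by (simp only: nat_pow_mult[symmetric] nat_pow_pow A_closed nat_pow_closed)
  finally show ?thesis by (simp add: A_order)
qed

lemma nf_cong: "[i = i'] (mod n) \<Longrightarrow> nf j i = nf j i'"
  unfolding nf_def cong_def by (metis A_pow_mod)

lemma nf_carry: "nf (j + t * q) i = nf j (l * q + i)"
proof -
  have "B [^] (j + t * q) = B [^] j \<otimes> A [^] (l * q)"
    by (simp add: nat_pow_mult[symmetric]) (simp add: nat_pow_pow[symmetric] B_power)
  then show ?thesis by (simp add: nf_def m_assoc nat_pow_mult)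
qed

lemma nf_reduce: "nf j i = nf (j mod t) ((i + l * (j div t)) mod n)"
proof -
  have "nf j i = nf (j mod t) (l * (j div t) + i)"
    using nf_carry[of "j mod t" "j div t" i] by simp
  also have "\<dots> = nf (j mod t) ((i + l * (j div t)) mod n)"
    by (rule nf_cong) (simp add: cong_def add.commute)
  finally show ?thesis .
qed

lemma nf_0_0 [simp]: "nf 0 0 = \<one>" and nf_A: "nf 0 1 = A" and nf_B: "nf 1 0 = B"
  by (simp_all add: nf_def)

definition NF :: "'a set" where "NF = (\<lambda>(j, i). nf j i) ` ({..<t} \<times> {..<n})"

lemma nf_in_NF: "nf j i \<in> NF"
  unfolding NF_def by (rule image_eqI[of _ _ "(j mod t, (i + l * (j div t)) mod n)"])
    (use n0 t0 nf_reduce in auto)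

lemma NF_mult: "x \<in> NF \<Longrightarrow> y \<in> NF \<Longrightarrow> x \<otimes> y \<in> NF"
  using nf_in_NF by (auto simp: NF_def nf_mult)

lemma NF_pow: "x \<in> NF \<Longrightarrow> x [^] (k::nat) \<in> NF"
  by (induction k) (auto intro: NF_mult simp: nf_in_NF[of 0 0, simplified])

lemma inv_A_in_NF: "inv A \<in> NF"
proof -
  have "A [^] (n - 1) \<otimes> A = \<one>" using A_order n0 nat_pow_Suc[of A "n - 1"] by simp
  then have "inv A = A [^] (n - 1)" by (intro inv_equality) auto
  then show ?thesis using NF_pow nf_in_NF[of 0 1] by (simp only: nf_A)
qed

lemma inv_B_in_NF: "inv B \<in> NF"
proof -
  have "B [^] (t * n) = (A [^] n) [^] l" by (simp add: nat_pow_pow[symmetric] B_power) (simp add: nat_pow_pow mult.commute)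
  then have "B [^] Suc (t * n - 1) = \<one>" using n0 t0 by (simp add: A_order)
  then have "B [^] (t * n - 1) \<otimes> B = \<one>" by simp
  then have "inv B = B [^] (t * n - 1)" by (intro inv_equality) auto
  then show ?thesis using NF_pow nf_in_NF[of 1 0] by (simp only: nf_B)
qed

end

definition word_value :: "('a, 'm) monoid_scheme \<Rightarrow> ('g \<Rightarrow> 'a) \<Rightarrow> ('g \<times> bool) list \<Rightarrow> 'a" where
  "word_value H ev w =
     foldr (\<lambda>(x, e) acc. (if e then ev x else inv\<^bsub>H\<^esub> (ev x)) \<otimes>\<^bsub>H\<^esub> acc) w \<one>\<^bsub>H\<^esub>"

context group
begin

lemma word_value_closed: "(\<And>x. ev x \<in> carrier G) \<Longrightarrow> word_value G ev w \<in> carrier G"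
  by (induction w) (auto simp: word_value_def split: prod.splits)

lemma word_value_append:
  assumes "\<And>x. ev x \<in> carrier G"
  shows "word_value G ev (u @ v) = word_value G ev u \<otimes> word_value G ev v"
proof (induction u)
  case Nil
  show ?case using word_value_closed[of ev, OF assms] by (simp add: word_value_def[of _ _ "[]"])
next
  case (Cons y u)
  obtain x e where y: "y = (x, e)" by force
  have step: "word_value G ev ((x, e) # w) = (if e then ev x else inv (ev x)) \<otimes> word_value G ev w" for w
    by (simp add: word_value_def)
  show ?case unfolding y append_Cons step Cons
    using assms word_value_closed[of ev, OF assms] by (simp add: m_assoc)
qed

lemma word_value_replicate: "ev x \<in> carrier G \<Longrightarrow> word_value G ev (replicate k (x, True)) = ev x [^] k"
proof (induction k)
  case (Suc k)
  then show ?case using nat_pow_Suc2[of "ev x" k] by (simp add: word_value_def)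
qed (simp add: word_value_def)

lemma pres_eq_word_value:
  assumes ev: "\<And>x. ev x \<in> carrier G"
    and R: "\<And>u v. (u, v) \<in> R \<Longrightarrow> word_value G ev u = word_value G ev v"
    and "pres_eq R u v"
  shows "word_value G ev u = word_value G ev v"
  using assms(3)
proof (induction rule: pres_eq.induct)
  case (cancel p x e q)
  have "word_value G ev [(x, e), (x, \<not> e)] = \<one>" using ev by (simp add: word_value_def)
  then show ?case using word_value_closed[of ev, OF ev]
    by (simp only: word_value_append[of ev, OF ev] l_one)
next
  case (relation u v p q)
  then show ?case using R by (simp only: word_value_append[of ev, OF ev])
qed auto

end

definition metacyclic_rels :: "nat \<Rightarrow> nat \<Rightarrow> nat \<Rightarrow> nat \<Rightarrow> ((gen \<times> bool) list \<times> (gen \<times> bool) list) set" where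
  "metacyclic_rels n t l r =
    {(replicate n (Gen_a, True), []),
     (replicate t (Gen_b, True), replicate l (Gen_a, True)),
     ([(Gen_b, False), (Gen_a, True), (Gen_b, True)], replicate r (Gen_a, True))}"

lemma metacyclic_pres_rels: "metacyclic_pres n t l r = presented_group (metacyclic_rels n t l r)"
  by (simp add: metacyclic_pres_def metacyclic_rels_def)

definition pres_gen :: "nat \<Rightarrow> nat \<Rightarrow> nat \<Rightarrow> nat \<Rightarrow> gen \<Rightarrow> (gen \<times> bool) list set" where
  "pres_gen n t l r x = pres_class (metacyclic_rels n t l r) [(x, True)]"

lemma word_value_presented:
  "word_value (presented_group R) (\<lambda>x. pres_class R [(x, True)]) w = pres_class R w"
proof (induction w)
  case Nil
  show ?case by (simp add: word_value_def presented_group_def)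
next
  case (Cons y w)
  obtain x e where y: "y = (x, e)" by force
  interpret P: group "presented_group R" by (rule group_presented_group)
  have inv: "inv\<^bsub>presented_group R\<^esub> (pres_class R [(x, True)]) = pres_class R [(x, False)]"
  proof (rule P.inv_equality)
    show "pres_class R [(x, False)] \<otimes>\<^bsub>presented_group R\<^esub> pres_class R [(x, True)] = \<one>\<^bsub>presented_group R\<^esub>"
      unfolding presented_group_mult using pres_eq.cancel[of R "[]" x False "[]"]
      by (simp add: pres_class_eq_iff presented_group_def)
  qed (simp_all add: presented_group_def)
  have "word_value (presented_group R) (\<lambda>x. pres_class R [(x, True)]) (y # w)
    = pres_class R [y] \<otimes>\<^bsub>presented_group R\<^esub> word_value (presented_group R) (\<lambda>x. pres_class R [(x, True)]) w"
    by (simp add: word_value_def y inv)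
  then show ?case unfolding Cons by (simp add: presented_group_mult)
qed

lemma metacyclic_pres_pair:
  assumes "n > 0" "t > 0"
  shows "metacyclic_pair (metacyclic_pres n t l r) (pres_gen n t l r Gen_a) (pres_gen n t l r Gen_b) n t l r"
proof -
  let ?R = "metacyclic_rels n t l r"
  let ?P = "presented_group ?R"
  interpret P: group ?P by (rule group_presented_group)
  let ?ev = "\<lambda>x. pres_class ?R [(x, True)]"
  have ev: "?ev x \<in> carrier ?P" for x by (simp add: presented_group_def)
  have rel: "word_value ?P ?ev u = word_value ?P ?ev v" if "(u, v) \<in> ?R" for u v
    unfolding word_value_presented pres_class_eq_iff using pres_eq.relation[OF that, of "[]" "[]"] by simp
  have 1: "?ev Gen_a [^]\<^bsub>?P\<^esub> n = \<one>\<^bsub>?P\<^esub>"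
    using rel[of "replicate n (Gen_a, True)" "[]"] P.word_value_replicate[of ?ev, OF ev]
    by (simp add: metacyclic_rels_def word_value_def[of _ _ "[]"])
  have 2: "?ev Gen_b [^]\<^bsub>?P\<^esub> t = ?ev Gen_a [^]\<^bsub>?P\<^esub> l"
    using rel[of "replicate t (Gen_b, True)" "replicate l (Gen_a, True)"] P.word_value_replicate[of ?ev, OF ev]
    by (simp add: metacyclic_rels_def)
  have "inv\<^bsub>?P\<^esub> (?ev Gen_b) \<otimes>\<^bsub>?P\<^esub> (?ev Gen_a \<otimes>\<^bsub>?P\<^esub> ?ev Gen_b) = ?ev Gen_a [^]\<^bsub>?P\<^esub> r"
  proof -
    have "([(Gen_b, False), (Gen_a, True), (Gen_b, True)], replicate r (Gen_a, True)) \<in> ?R"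
      by (simp add: metacyclic_rels_def)
    from rel[OF this] have "word_value ?P ?ev [(Gen_b, False), (Gen_a, True), (Gen_b, True)] = ?ev Gen_a [^]\<^bsub>?P\<^esub> r"
      using P.word_value_replicate[of ?ev, OF ev] by simp
    moreover have "word_value ?P ?ev [(Gen_b, False), (Gen_a, True), (Gen_b, True)]
        = inv\<^bsub>?P\<^esub> (?ev Gen_b) \<otimes>\<^bsub>?P\<^esub> (?ev Gen_a \<otimes>\<^bsub>?P\<^esub> (?ev Gen_b \<otimes>\<^bsub>?P\<^esub> \<one>\<^bsub>?P\<^esub>))"
      by (simp add: word_value_def)
    ultimately show ?thesis using P.r_one[OF ev, of Gen_b] by simp
  qed
  then have 3: "?ev Gen_a \<otimes>\<^bsub>?P\<^esub> ?ev Gen_b = ?ev Gen_b \<otimes>\<^bsub>?P\<^esub> ?ev Gen_a [^]\<^bsub>?P\<^esub> r"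
    using ev by (metis P.inv_solve_left P.m_closed P.nat_pow_closed)
  show ?thesis
    unfolding metacyclic_pres_rels pres_gen_def
    by unfold_locales (use assms 1 2 3 ev in auto)
qed

lemma metacyclic_pres_carrier:
  assumes "n > 0" "t > 0"
  shows "carrier (metacyclic_pres n t l r) =
    metacyclic_pair.NF (metacyclic_pres n t l r) (pres_gen n t l r Gen_a) (pres_gen n t l r Gen_b) n t"
proof -
  let ?R = "metacyclic_rels n t l r"
  let ?P = "metacyclic_pres n t l r"
  interpret P: metacyclic_pair ?P "pres_gen n t l r Gen_a" "pres_gen n t l r Gen_b" n t l r
    by (rule metacyclic_pres_pair[OF assms])
  have a: "pres_gen n t l r Gen_a \<in> P.NF" using P.nf_in_NF[of 0 1] unfolding P.nf_A .
  have b: "pres_gen n t l r Gen_b \<in> P.NF" using P.nf_in_NF[of 1 0] unfolding P.nf_B .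
  have gens: "pres_gen n t l r x \<in> P.NF \<and> inv\<^bsub>?P\<^esub> (pres_gen n t l r x) \<in> P.NF" for x
  proof (cases x)
    case Gen_a
    then show ?thesis using a P.inv_A_in_NF by blast
  next
    case Gen_b
    then show ?thesis using b P.inv_B_in_NF by blast
  qed
  have word: "word_value ?P (pres_gen n t l r) w \<in> P.NF" for w
  proof (induction w)
    case Nil
    show ?case using P.nf_in_NF[of 0 0] by (simp add: word_value_def)
  next
    case (Cons y w)
    then show ?case using gens by (auto simp: word_value_def split: prod.splits intro!: P.NF_mult)
  qed
  show ?thesis
  proof (intro equalityI subsetI)
    fix x assume "x \<in> carrier ?P"
    then obtain w where "x = pres_class ?R w" by (auto simp: metacyclic_pres_rels presented_group_def)
    then have "x = word_value ?P (pres_gen n t l r) w"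
      using word_value_presented[of ?R w] by (simp add: metacyclic_pres_rels pres_gen_def[abs_def])
    then show "x \<in> P.NF" using word by simp
  qed (auto simp: P.NF_def)
qed

text \<open>The universal property of the presentation.\<close>

lemma metacyclic_pair_hom:
  fixes H (structure)
  assumes "metacyclic_pair H A B n t l r"
  shows "\<exists>\<phi>\<in>hom (metacyclic_pres n t l r) H. \<phi> (pres_gen n t l r Gen_a) = A \<and> \<phi> (pres_gen n t l r Gen_b) = B"
proof -
  interpret metacyclic_pair H A B n t l r by fact
  let ?R = "metacyclic_rels n t l r"
  define ev where "ev x = (case x of Gen_a \<Rightarrow> A | Gen_b \<Rightarrow> B)" for x
  have ev: "ev x \<in> carrier H" for x by (cases x) (auto simp: ev_def)
  have "word_value H ev u = word_value H ev v" if "(u, v) \<in> ?R" for u v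
  proof -
    have "inv B \<otimes> (A \<otimes> B) = A [^] r" by (metis A_B A_closed B_closed inv_solve_left m_closed nat_pow_closed)
    then have w: "word_value H ev [(Gen_b, False), (Gen_a, True), (Gen_b, True)] = A [^] r"
      by (simp add: word_value_def ev_def)
    show ?thesis
      using that word_value_replicate[of ev, OF ev] A_order B_power w
      by (auto simp: metacyclic_rels_def ev_def word_value_def[of _ _ "[]"])
  qed
  from pres_eq_word_value[of ev, OF ev this]
  have val: "pres_eq ?R u v \<Longrightarrow> word_value H ev u = word_value H ev v" for u v by blast
  define \<phi> where "\<phi> C = word_value H ev (SOME u. u \<in> C)" for C
  have phi: "\<phi> (pres_class ?R u) = word_value H ev u" for u
  proof -
    have "u \<in> pres_class ?R u" by (simp add: pres_class_def pres_eq.refl)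
    then have "(SOME v. v \<in> pres_class ?R u) \<in> pres_class ?R u" by (rule someI)
    then have "pres_eq ?R u (SOME v. v \<in> pres_class ?R u)" by (simp add: pres_class_def)
    then show ?thesis unfolding \<phi>_def by (rule val[symmetric])
  qed
  have "\<phi> \<in> hom (metacyclic_pres n t l r) H"
  proof (rule homI)
    fix x y assume "x \<in> carrier (metacyclic_pres n t l r)" "y \<in> carrier (metacyclic_pres n t l r)"
    then obtain u v where "x = pres_class ?R u" "y = pres_class ?R v"
      by (auto simp: metacyclic_pres_rels presented_group_def)
    then show "\<phi> (x \<otimes>\<^bsub>metacyclic_pres n t l r\<^esub> y) = \<phi> x \<otimes> \<phi> y"
      by (simp add: metacyclic_pres_rels presented_group_mult phi word_value_append[of ev, OF ev])
  next
    fix x assume "x \<in> carrier (metacyclic_pres n t l r)"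
    then obtain u where "x = pres_class ?R u" by (auto simp: metacyclic_pres_rels presented_group_def)
    then show "\<phi> x \<in> carrier H" using word_value_closed[of ev, OF ev] by (simp add: phi)
  qed
  then show ?thesis
    by (intro bexI[of _ \<phi>]) (auto simp: pres_gen_def phi word_value_def ev_def)
qed

lemma hom_nf:
  assumes "metacyclic_pair P a b n t l r" "metacyclic_pair H A B n t l r"
    and "\<phi> \<in> hom P H" "\<phi> a = A" "\<phi> b = B"
  shows "\<phi> (metacyclic_pair.nf P a b j i) = metacyclic_pair.nf H A B j i"
proof -
  interpret P: metacyclic_pair P a b n t l r by fact
  interpret H: metacyclic_pair H A B n t l r by fact
  interpret group_hom P H \<phi> by unfold_locales (fact assms(3))
  show ?thesis using assms(4,5) by (simp add: P.nf_def H.nf_def hom_nat_pow)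
qed

text \<open>The action of \<open>a\<close> and \<open>b\<close> by left multiplication on the \<open>n t\<close> formal normal forms.\<close>

definition act_a :: "nat \<Rightarrow> nat \<Rightarrow> nat \<Rightarrow> nat \<times> nat \<Rightarrow> nat \<times> nat" where
  "act_a n t r = restrict (\<lambda>(j, i). (j, (i + r ^ j) mod n)) ({..<t} \<times> {..<n})"

definition act_b :: "nat \<Rightarrow> nat \<Rightarrow> nat \<Rightarrow> nat \<times> nat \<Rightarrow> nat \<times> nat" where
  "act_b n t l = restrict (\<lambda>(j, i). if Suc j < t then (Suc j, i) else (0, (i + l) mod n)) ({..<t} \<times> {..<n})"

lemma add_mod_inj: "(i + c) mod n = (i' + c) mod n \<Longrightarrow> i < n \<Longrightarrow> i' < (n::nat) \<Longrightarrow> i = i'"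
  by (metis cong_add_rcancel_nat cong_def mod_less)

text \<open>The presented group should act by left multiplication on its \<open>n t\<close> normal forms \<open>b\<^sup>j a\<^sup>i\<close>. The conditions
  on the parameters ensure that the two permutations \<open>act_a\<close> and \<open>act_b\<close> satisfy the relations, and the
  images of \<open>(0, 0)\<close> separate the normal forms.\<close>

lemma metacyclic_model:
  fixes n t l r :: nat
  assumes n: "n > 0" and t: "t > 0" and rt: "[r ^ t = 1] (mod n)" and lr: "[l * r = l] (mod n)"
  shows "\<exists>A B. metacyclic_pair (BijGroup ({..<t} \<times> {..<n})) A B n t l r
    \<and> inj_on (\<lambda>(j, i). metacyclic_pair.nf (BijGroup ({..<t} \<times> {..<n})) A B j i) ({..<t} \<times> {..<n})"
proof -
  define S where "S = {..<t} \<times> {..<n}"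
  let ?H = "BijGroup S"
  let ?A = "act_a n t r" and ?B = "act_b n t l"
  interpret H: group ?H by (rule group_BijGroup)
  have SI: "(j, i) \<in> S" if "j < t" "i < n" for j i using that by (simp add: S_def)
  have finS: "finite S" by (simp add: S_def)
  have bij: "f \<in> Bij S" if "f \<in> extensional S" "f ` S \<subseteq> S" "inj_on f S" for f
    using that endo_inj_surj[OF finS that(2,3)] by (auto simp: Bij_def bij_betw_def)
  have A: "?A \<in> Bij S"
  proof (rule bij)
    show "?A \<in> extensional S" by (simp add: act_a_def S_def)
    show "?A ` S \<subseteq> S" using n by (auto simp: act_a_def S_def)
    show "inj_on ?A S" by (auto simp: inj_on_def act_a_def S_def dest: add_mod_inj)
  qed
  have B: "?B \<in> Bij S"
  proof (rule bij)
    show "?B \<in> extensional S" by (simp add: act_b_def S_def)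
    show "?B ` S \<subseteq> S" using n t by (auto simp: act_b_def S_def split: if_splits)
    show "inj_on ?B S"
      by (auto simp: inj_on_def act_b_def S_def split: if_splits dest: add_mod_inj)
  qed
  have AB [simp]: "?A \<in> carrier ?H" "?B \<in> carrier ?H" using A B by (simp_all add: BijGroup_def)
  have mult: "(f \<otimes>\<^bsub>?H\<^esub> g) s = f (g s)" if "f \<in> carrier ?H" "g \<in> carrier ?H" "s \<in> S" for f g s
    using that by (simp add: BijGroup_def compose_def)
  have one: "\<one>\<^bsub>?H\<^esub> s = s" if "s \<in> S" for s using that by (simp add: BijGroup_def)
  have inS: "f s \<in> S" if "f \<in> carrier ?H" "s \<in> S" for f s
    using that by (auto simp: BijGroup_def Bij_def bij_betw_def)
  have eqI: "f = g" if "f \<in> carrier ?H" "g \<in> carrier ?H" "\<And>s. s \<in> S \<Longrightarrow> f s = g s" for f g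
    using that by (intro extensionalityI[of _ S]) (auto simp: BijGroup_def Bij_def)
  have Apow: "(?A [^]\<^bsub>?H\<^esub> k) (j, i) = (j, (i + k * r ^ j) mod n)" if "j < t" "i < n" for k j i
    using that
  proof (induction k arbitrary: i)
    case 0
    then show ?case by (simp add: one SI)
  next
    case (Suc k)
    have "(?A [^]\<^bsub>?H\<^esub> Suc k) (j, i) = (?A [^]\<^bsub>?H\<^esub> k) (?A (j, i))"
      using Suc.prems by (simp add: mult SI)
    also have "?A (j, i) = (j, (i + r ^ j) mod n)" using Suc.prems by (simp add: act_a_def)
    also have "(?A [^]\<^bsub>?H\<^esub> k) \<dots> = (j, ((i + r ^ j) mod n + k * r ^ j) mod n)"
      using Suc.prems n by (intro Suc.IH) auto
    finally show ?case by (simp add: mod_add_left_eq add.assoc)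
  qed
  have Bpow: "(?B [^]\<^bsub>?H\<^esub> k) (j, i) = (j + k, i)" if "j + k < t" "i < n" for k j i
    using that
  proof (induction k arbitrary: j)
    case 0
    then show ?case by (simp add: one SI)
  next
    case (Suc k)
    have "(?B [^]\<^bsub>?H\<^esub> Suc k) (j, i) = (?B [^]\<^bsub>?H\<^esub> k) (?B (j, i))"
      using Suc.prems by (simp add: mult SI)
    also have "?B (j, i) = (Suc j, i)" using Suc.prems by (simp add: act_b_def)
    also have "(?B [^]\<^bsub>?H\<^esub> k) \<dots> = (Suc j + k, i)" using Suc.prems by (intro Suc.IH) auto
    finally show ?case by simp
  qed
  have lrj: "[l * r ^ j = l] (mod n)" for j
  proof (induction j)
    case (Suc j)
    have "[l * r ^ j * r = l * r] (mod n)" using Suc by (rule cong_scalar_right)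
    then show ?case using lr by (simp add: mult_ac cong_trans)
  qed simp
  have pair: "metacyclic_pair ?H ?A ?B n t l r"
  proof unfold_locales
    show "?A [^]\<^bsub>?H\<^esub> n = \<one>\<^bsub>?H\<^esub>"
    proof (rule eqI)
      fix s assume "s \<in> S"
      then obtain j i where s: "s = (j, i)" "j < t" "i < n" by (auto simp: S_def)
      then show "(?A [^]\<^bsub>?H\<^esub> n) s = \<one>\<^bsub>?H\<^esub> s" by (simp add: Apow one SI)
    qed auto
    show "?B [^]\<^bsub>?H\<^esub> t = ?A [^]\<^bsub>?H\<^esub> l"
    proof (rule eqI)
      fix s assume "s \<in> S"
      then obtain j i where s: "s = (j, i)" "j < t" "i < n" by (auto simp: S_def)
      have b1: "(?B [^]\<^bsub>?H\<^esub> (t - 1 - j)) (j, i) = (t - 1, i)" using Bpow[of j "t - 1 - j" i] s by simp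
      have b2: "?B (t - 1, i) = (0, (i + l) mod n)" using s by (simp add: act_b_def)
      have b3: "(?B [^]\<^bsub>?H\<^esub> j) (0, (i + l) mod n) = (j, (i + l) mod n)" using Bpow[of 0 j] s n by simp
      have "t = j + (1 + (t - 1 - j))" using s by simp
      then have "?B [^]\<^bsub>?H\<^esub> t = ?B [^]\<^bsub>?H\<^esub> j \<otimes>\<^bsub>?H\<^esub> (?B \<otimes>\<^bsub>?H\<^esub> ?B [^]\<^bsub>?H\<^esub> (t - 1 - j))"
        using H.nat_pow_mult[of ?B j "1 + (t - 1 - j)"] H.nat_pow_Suc2[of ?B "t - 1 - j"] by simp
      then have "(?B [^]\<^bsub>?H\<^esub> t) s = (j, (i + l) mod n)"
        using s b1 b2 b3 by (simp add: mult inS SI)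
      also have "\<dots> = (?A [^]\<^bsub>?H\<^esub> l) s"
        using s lrj[of j] by (simp add: Apow cong_def) (metis mod_add_right_eq)
      finally show "(?B [^]\<^bsub>?H\<^esub> t) s = (?A [^]\<^bsub>?H\<^esub> l) s" .
    qed auto
    show "?A \<otimes>\<^bsub>?H\<^esub> ?B = ?B \<otimes>\<^bsub>?H\<^esub> ?A [^]\<^bsub>?H\<^esub> r"
    proof (rule eqI)
      fix s assume "s \<in> S"
      then obtain j i where s: "s = (j, i)" "j < t" "i < n" by (auto simp: S_def)
      have AB': "(?A \<otimes>\<^bsub>?H\<^esub> ?B) s = ?A (?B (j, i))" using s by (simp add: mult SI)
      have BA: "(?B \<otimes>\<^bsub>?H\<^esub> ?A [^]\<^bsub>?H\<^esub> r) s = ?B (j, (i + r * r ^ j) mod n)"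
        using s by (simp add: mult SI Apow n)
      show "(?A \<otimes>\<^bsub>?H\<^esub> ?B) s = (?B \<otimes>\<^bsub>?H\<^esub> ?A [^]\<^bsub>?H\<^esub> r) s"
      proof (cases "Suc j < t")
        case True
        then show ?thesis unfolding AB' BA using s n by (simp add: act_a_def act_b_def)
      next
        case False
        then have jt: "Suc j = t" using s by simp
        then have rr: "r * r ^ j = r ^ t" by auto
        have "?A (?B (j, i)) = (0, ((i + l) mod n + 1) mod n)"
          using s n False t by (simp add: act_a_def act_b_def)
        also have "((i + l) mod n + 1) mod n = (i + l + 1) mod n" by (rule mod_add_left_eq)
        also have "\<dots> = (i + l + r ^ t) mod n"
          using cong_add[OF cong_refl cong_sym[OF rt], of "i + l"] by (simp only: cong_def)
        also have "\<dots> = ((i + r ^ t) mod n + l) mod n"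
          unfolding mod_add_left_eq by (simp only: add_ac)
        also have "(0, \<dots>) = ?B (j, (i + r ^ t) mod n)"
          using s n False t by (simp add: act_b_def)
        finally show ?thesis unfolding AB' BA rr .
      qed
    qed auto
  qed (use n t in auto)
  interpret P: metacyclic_pair ?H ?A ?B n t l r by (rule pair)
  have at_0: "P.nf j i (0, 0) = (j, i)" if "j < t" "i < n" for j i
  proof -
    have "P.nf j i (0, 0) = (?B [^]\<^bsub>?H\<^esub> j) ((?A [^]\<^bsub>?H\<^esub> i) (0, 0))"
      unfolding P.nf_def using n t by (intro mult) (auto simp: SI)
    then show ?thesis using that n t by (simp add: Apow Bpow)
  qed
  have "inj_on (\<lambda>(j, i). P.nf j i) S"
  proof (rule inj_onI)
    fix x y assume xy: "x \<in> S" "y \<in> S" "(case x of (j, i) \<Rightarrow> P.nf j i) = (case y of (j, i) \<Rightarrow> P.nf j i)"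
    have "(case z of (j, i) \<Rightarrow> P.nf j i) (0, 0) = z" if "z \<in> S" for z
      using that at_0 by (auto simp: S_def)
    then show "x = y" using xy by metis
  qed
  with pair show ?thesis unfolding S_def by (intro exI conjI)
qed

text \<open>The normal forms are unique and exhaust the group.\<close>

locale metacyclic_normal = metacyclic_pair +
  assumes carrier_NF: "carrier H = NF"
    and nf_inj: "inj_on (\<lambda>(j, i). nf j i) ({..<t} \<times> {..<n})"
    and r_pow_t: "[r ^ t = 1] (mod n)" and l_r: "[l * r = l] (mod n)"
begin

lemma card_carrier: "card (carrier H) = t * n"
  unfolding carrier_NF NF_def by (subst card_image[OF nf_inj]) simp

lemma finite_carrier: "finite (carrier H)"
  unfolding carrier_NF NF_def by simp

lemma carrierE: 
  assumes "x \<in> carrier H"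
  obtains j i where "x = nf j i" "j < t" "i < n"
  using assms unfolding carrier_NF NF_def by auto

lemma nf_eq_iff: "nf j i = nf j i' \<longleftrightarrow> [i = i'] (mod n)"
proof
  assume eq: "nf j i = nf j i'"
  let ?j = "j mod t" and ?q = "l * (j div t)"
  have "nf ?j ((i + ?q) mod n) = nf ?j ((i' + ?q) mod n)" using eq nf_reduce by metis
  then have "(?j, (i + ?q) mod n) = (?j, (i' + ?q) mod n)"
    by (intro inj_onD[OF nf_inj]) (use n0 t0 in auto)
  then have "(i + ?q) mod n = (i' + ?q) mod n" by simp
  then show "[i = i'] (mod n)" by (metis cong_add_rcancel_nat cong_def)
qed (rule nf_cong)

lemma nf_eq_imp_mod: "nf j i = nf j' i' \<Longrightarrow> [j = j'] (mod t)"
proof -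
  assume "nf j i = nf j' i'"
  then have "nf (j mod t) ((i + l * (j div t)) mod n) = nf (j' mod t) ((i' + l * (j' div t)) mod n)"
    using nf_reduce by metis
  then have "(j mod t, (i + l * (j div t)) mod n) = (j' mod t, (i' + l * (j' div t)) mod n)"
    by (intro inj_onD[OF nf_inj]) (use n0 t0 in auto)
  then show ?thesis by (simp add: cong_def)
qed

end

text \<open>A homomorphism into the permutation model keeps the normal forms apart.\<close>

theorem metacyclic_pres_normal:
  fixes n t l r :: nat
  assumes "n > 0" "t > 0" "[r ^ t = 1] (mod n)" "[l * r = l] (mod n)"
  shows "metacyclic_normal (metacyclic_pres n t l r) (pres_gen n t l r Gen_a) (pres_gen n t l r Gen_b) n t l r"
proof -
  let ?P = "metacyclic_pres n t l r" and ?S = "{..<t} \<times> {..<n}"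
  let ?a = "pres_gen n t l r Gen_a" and ?b = "pres_gen n t l r Gen_b"
  interpret P: metacyclic_pair ?P ?a ?b n t l r by (rule metacyclic_pres_pair[OF assms(1,2)])
  obtain A B where H: "metacyclic_pair (BijGroup ?S) A B n t l r"
    and inj: "inj_on (\<lambda>(j, i). metacyclic_pair.nf (BijGroup ?S) A B j i) ?S"
    using metacyclic_model[OF assms] by blast
  obtain \<phi> where phi: "\<phi> \<in> hom ?P (BijGroup ?S)" "\<phi> ?a = A" "\<phi> ?b = B"
    using metacyclic_pair_hom[OF H] by blast
  have "inj_on (\<lambda>(j, i). P.nf j i) ?S"
  proof (rule inj_onI)
    fix x y assume xy: "x \<in> ?S" "y \<in> ?S" "(case x of (j, i) \<Rightarrow> P.nf j i) = (case y of (j, i) \<Rightarrow> P.nf j i)"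
    obtain j i j' i' where x: "x = (j, i)" "y = (j', i')" by (metis prod.exhaust)
    have "\<phi> (P.nf j i) = \<phi> (P.nf j' i')" using xy(3) x by simp
    then have "metacyclic_pair.nf (BijGroup ?S) A B j i = metacyclic_pair.nf (BijGroup ?S) A B j' i'"
      unfolding hom_nf[OF P.metacyclic_pair_axioms H phi] .
    then show "x = y" using xy x by (intro inj_onD[OF inj]) auto
  qed
  then show ?thesis
    using metacyclic_pres_carrier[OF assms(1,2)] assms by unfold_locales auto
qed

text \<open>A surjective homomorphism between finite groups of the same order is an isomorphism.\<close>

theorem metacyclic_recognition:
  fixes n t l r :: nat
  assumes pair: "metacyclic_pair H A B n t l r" and cond: "[r ^ t = 1] (mod n)" "[l * r = l] (mod n)"
    and gen: "carrier H = metacyclic_pair.NF H A B n t" and card: "card (carrier H) = t * n"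
  shows "metacyclic_pres n t l r \<cong> H"
proof -
  let ?P = "metacyclic_pres n t l r"
  let ?a = "pres_gen n t l r Gen_a" and ?b = "pres_gen n t l r Gen_b"
  interpret H: metacyclic_pair H A B n t l r by (rule pair)
  interpret P: metacyclic_normal ?P ?a ?b n t l r
    by (rule metacyclic_pres_normal[OF H.n0 H.t0 cond])
  obtain \<phi> where phi: "\<phi> \<in> hom ?P H" "\<phi> ?a = A" "\<phi> ?b = B"
    using metacyclic_pair_hom[OF pair] by blast
  have "\<phi> ` carrier ?P = carrier H"
  proof -
    have "\<phi> ` carrier ?P = (\<lambda>(j, i). \<phi> (P.nf j i)) ` ({..<t} \<times> {..<n})"
      unfolding P.carrier_NF P.NF_def by (auto simp: image_image split_beta)
    also have "\<dots> = carrier H"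
      unfolding gen H.NF_def hom_nf[OF P.metacyclic_pair_axioms pair phi] ..
    finally show ?thesis .
  qed
  moreover from this have "inj_on \<phi> (carrier ?P)"
    using P.card_carrier card P.finite_carrier by (intro eq_card_imp_inj_on) auto
  ultimately have "\<phi> \<in> iso ?P H" using phi(1) by (simp add: iso_def bij_betw_def)
  then show ?thesis by (rule is_isoI)
qed

section \<open>Inverse semi-rationality of a metacyclic group as a congruence condition\<close>

text \<open>The condition that the \<open>k\<close>-th power of \<open>b\<^sup>j a\<^sup>i\<close> is conjugate to \<open>b\<^sup>j a\<^sup>i\<close> (first line) or to its
  inverse (second line), by an element \<open>b\<^sup>m a\<^sup>u\<close>. The unknown \<open>u\<close> has been eliminated by
  \<open>cong_mult_minus_one_solvable\<close>, which is why the modulus is \<open>gcd n (r\<^sup>j - 1)\<close>.\<close>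

definition semirational_at :: "nat \<Rightarrow> nat \<Rightarrow> nat \<Rightarrow> nat \<Rightarrow> nat \<Rightarrow> nat \<Rightarrow> nat \<Rightarrow> bool" where
  "semirational_at n t l r j i k \<longleftrightarrow>
     (let g = gcd n (r ^ j - 1) in
       (j * k) mod t = j \<and> list_ex (\<lambda>m. (l * ((j * k - j) div t) + i * k * r ^ m) mod g = i mod g) [0..<t]
     \<or> (j * k + j) mod t = 0 \<and> list_ex (\<lambda>m. (l * ((j * k + j) div t) + i * k * r ^ m + i) mod g = 0) [0..<t])"

text \<open>A linear congruence \<open>u (d - 1) \<equiv> c - c'\<close> modulo \<open>n\<close>, written without subtraction.\<close>

lemma cong_mult_minus_one_solvable:
  fixes n d c c' :: nat
  assumes "n > 0" "d > 0"
  shows "(\<exists>u<n. [c + u = u * d + c'] (mod n)) \<longleftrightarrow> [c = c'] (mod gcd n (d - 1))"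
proof
  let ?g = "gcd n (d - 1)"
  assume "\<exists>u<n. [c + u = u * d + c'] (mod n)"
  then obtain u where "[c + u = u * d + c'] (mod n)" by blast
  then have "[c + u = u * d + c'] (mod ?g)" by (rule cong_dvd_modulus_nat) simp
  also have "u * d + c' = u * (d - 1) + (c' + u)" using assms(2) by (cases d) auto
  also have "[u * (d - 1) + (c' + u) = 0 + (c' + u)] (mod ?g)"
    by (intro cong_add) (auto simp: cong_0_iff)
  finally have "[c + u = c' + u] (mod ?g)" by simp
  then show "[c = c'] (mod ?g)" by (simp add: cong_add_rcancel_nat)
next
  let ?g = "gcd n (d - 1)"
  assume "[c = c'] (mod ?g)"
  then have "int ?g dvd int c - int c'" by (metis cong_iff_dvd_diff cong_int_iff)
  then obtain e where e: "int c - int c' = int ?g * e" by auto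
  obtain w where w: "[int (d - 1) * w = gcd (int (d - 1)) (int n)] (mod int n)" using cong_solve_int by blast
  define u where "u = nat ((w * e) mod int n)"
  have u: "int u = (w * e) mod int n" using assms(1) by (simp add: u_def)
  have "[int (d - 1) * w * e = int ?g * e] (mod int n)"
    using cong_scalar_right[OF w, of e] by (simp add: gcd.commute)
  then have "[int (d - 1) * int u = int c - int c'] (mod int n)"
    unfolding u e by (simp add: cong_def mod_simps mult.assoc)
  then have "[int (d - 1) * int u + (int u + int c') = int c - int c' + (int u + int c')] (mod int n)"
    by (rule cong_add) simp
  then have "[int c + int u = int u * int d + int c'] (mod int n)"
    using assms(2) by (simp add: of_nat_diff algebra_simps cong_sym_eq)
  then have "[int (c + u) = int (u * d + c')] (mod int n)" by simp
  then have "[c + u = u * d + c'] (mod n)" by (simp only: cong_int_iff)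
  moreover have "u < n" using assms(1) by (simp add: u_def nat_less_iff)
  ultimately show "\<exists>u<n. [c + u = u * d + c'] (mod n)" by blast
qed

context metacyclic_normal
begin

lemma nf_pow: "nf j i [^] (k::nat) = nf (j * k) (i * (\<Sum>v<k. (r ^ j) ^ v))"
proof (induction k)
  case (Suc k)
  have "nf j i [^] Suc k = nf (j * k + j) (i * (\<Sum>v<k. (r ^ j) ^ v) * r ^ j + i)"
    by (simp add: Suc nf_mult)
  also have "i * (\<Sum>v<k. (r ^ j) ^ v) * r ^ j + i = i * (\<Sum>v<Suc k. (r ^ j) ^ v)"
    by (subst sum.lessThan_Suc_shift) (simp add: sum_distrib_left sum_distrib_right mult_ac)
  finally show ?case by (simp add: add.commute)
qed simp

lemma r_pow_cong: "r > 0 \<Longrightarrow> [r ^ j = 1] (mod gcd n (r ^ j - 1))"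
  by (metis cong_diff_iff_cong_0_nat cong_0_iff gcd_dvd2 One_nat_def Suc_leI zero_less_power)

text \<open>Modulo \<open>r\<^sup>j - 1\<close> the geometric sum in the exponent of \<open>a\<close> collapses to its number of terms.\<close>

lemma geometric_sum_cong:
  assumes "r > 0"
  shows "[(\<Sum>v<k. (r ^ j) ^ v) = k] (mod gcd n (r ^ j - 1))"
proof -
  have "[(\<Sum>v<k. (r ^ j) ^ v) = (\<Sum>v<k. 1)] (mod gcd n (r ^ j - 1))"
    using cong_pow[OF r_pow_cong[OF assms]] by (intro cong_sum) fastforce
  then show ?thesis by simp
qed

lemma ex_carrier: "(\<exists>h\<in>carrier H. Q h) \<longleftrightarrow> (\<exists>m<t. \<exists>u<n. Q (nf m u))"
  unfolding carrier_NF NF_def by auto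

lemma conj_power_iff:
  assumes r: "r > 0" and q: "j * k = j + t * q"
  shows "(\<exists>h\<in>carrier H. nf j i [^] k \<otimes> h = h \<otimes> nf j i) \<longleftrightarrow>
    (\<exists>m<t. [l * q + i * k * r ^ m = i] (mod gcd n (r ^ j - 1)))"
proof -
  let ?S = "\<Sum>v<k. (r ^ j) ^ v"
  have "(nf j i [^] k \<otimes> nf m u = nf m u \<otimes> nf j i)
    \<longleftrightarrow> [(l * q + i * ?S * r ^ m) + u = u * r ^ j + i] (mod n)" for m u
  proof -
    have "nf j i [^] k \<otimes> nf m u = nf (m + j + t * q) (i * ?S * r ^ m + u)"
      unfolding nf_pow nf_mult q by (simp add: add_ac)
    also have "\<dots> = nf (m + j) (l * q + (i * ?S * r ^ m + u))" by (rule nf_carry)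
    finally have L: "nf j i [^] k \<otimes> nf m u = nf (m + j) ((l * q + i * ?S * r ^ m) + u)"
      by (simp only: add.assoc)
    show ?thesis unfolding L nf_mult nf_eq_iff ..
  qed
  then have "(\<exists>h\<in>carrier H. nf j i [^] k \<otimes> h = h \<otimes> nf j i) \<longleftrightarrow>
    (\<exists>m<t. [l * q + i * ?S * r ^ m = i] (mod gcd n (r ^ j - 1)))"
    unfolding ex_carrier using cong_mult_minus_one_solvable[OF n0, of "r ^ j"] r by simp
  moreover have "[l * q + i * ?S * r ^ m = i] (mod gcd n (r ^ j - 1)) \<longleftrightarrow>
      [l * q + i * k * r ^ m = i] (mod gcd n (r ^ j - 1))" for m
  proof -
    have "[l * q + i * ?S * r ^ m = l * q + i * k * r ^ m] (mod gcd n (r ^ j - 1))"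
      using geometric_sum_cong[OF r] by (intro cong_add cong_mult) auto
    then show ?thesis by (simp add: cong_def)
  qed
  ultimately show ?thesis by simp
qed

lemma conj_inverse_power_iff:
  assumes r: "r > 0" and q: "j * k + j = t * q"
  shows "(\<exists>h\<in>carrier H. nf j i [^] k \<otimes> h = h \<otimes> inv (nf j i)) \<longleftrightarrow>
    (\<exists>m<t. [l * q + i * k * r ^ m + i = 0] (mod gcd n (r ^ j - 1)))"
proof -
  let ?S = "\<Sum>v<k. (r ^ j) ^ v" and ?g = "gcd n (r ^ j - 1)"
  have "(nf j i [^] k \<otimes> nf m u = nf m u \<otimes> inv (nf j i))
    \<longleftrightarrow> [0 + u = u * r ^ j + (l * q + i * ?S * r ^ m * r ^ j + i)] (mod n)" for m u
  proof -
    have "(nf j i [^] k \<otimes> nf m u = nf m u \<otimes> inv (nf j i)) \<longleftrightarrow> nf j i [^] k \<otimes> nf m u \<otimes> nf j i = nf m u"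
      by (metis inv_solve_right nat_pow_closed nf_closed m_closed)
    moreover have "nf j i [^] k \<otimes> nf m u \<otimes> nf j i = nf (m + t * q) ((i * ?S * r ^ m + u) * r ^ j + i)"
      unfolding nf_pow nf_mult q[symmetric] by (simp add: add_ac)
    moreover have "\<dots> = nf m (u * r ^ j + (l * q + i * ?S * r ^ m * r ^ j + i))"
      unfolding nf_carry by (simp add: algebra_simps)
    ultimately have L: "(nf j i [^] k \<otimes> nf m u = nf m u \<otimes> inv (nf j i)) \<longleftrightarrow>
        nf m (u * r ^ j + (l * q + i * ?S * r ^ m * r ^ j + i)) = nf m u" by simp
    show ?thesis unfolding L nf_eq_iff add_0 by (rule cong_sym_eq)
  qed
  then have "(\<exists>h\<in>carrier H. nf j i [^] k \<otimes> h = h \<otimes> inv (nf j i)) \<longleftrightarrow>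
    (\<exists>m<t. [0 = l * q + i * ?S * r ^ m * r ^ j + i] (mod ?g))"
    unfolding ex_carrier using cong_mult_minus_one_solvable[OF n0, of "r ^ j" 0] r by simp
  moreover have "[0 = l * q + i * ?S * r ^ m * r ^ j + i] (mod ?g) \<longleftrightarrow> [l * q + i * k * r ^ m + i = 0] (mod ?g)" for m
  proof -
    have "[l * q + i * ?S * r ^ m * r ^ j + i = l * q + i * k * r ^ m * 1 + i] (mod ?g)"
      using geometric_sum_cong[OF r] r_pow_cong[OF r] by (intro cong_add cong_mult) auto
    then show ?thesis by (simp only: cong_def mult_1_right) auto
  qed
  ultimately show ?thesis by simp
qed

lemma conj_power_imp_mod: "h \<in> carrier H \<Longrightarrow> nf j i [^] k \<otimes> h = h \<otimes> nf j i \<Longrightarrow> [j * k = j] (mod t)"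
proof (erule carrierE)
  fix m u assume h: "h = nf m u" "nf j i [^] k \<otimes> h = h \<otimes> nf j i"
  from h(2)[unfolded h(1) nf_pow nf_mult] have "[j * k + m = m + j] (mod t)" by (rule nf_eq_imp_mod)
  then show ?thesis by (metis add.commute cong_add_rcancel_nat)
qed

lemma conj_inverse_power_imp_mod:
  "h \<in> carrier H \<Longrightarrow> nf j i [^] k \<otimes> h = h \<otimes> inv (nf j i) \<Longrightarrow> [j * k + j = 0] (mod t)"
proof (erule carrierE)
  fix m u assume h: "h = nf m u" "nf j i [^] k \<otimes> h = h \<otimes> inv (nf j i)"
  then have "nf j i [^] k \<otimes> nf m u \<otimes> nf j i = nf m u"
    by (metis inv_solve_right nat_pow_closed nf_closed m_closed)
  from this[unfolded nf_pow nf_mult] have "[j * k + m + j = m] (mod t)" by (rule nf_eq_imp_mod)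
  then have "[(j * k + j) + m = 0 + m] (mod t)" by (simp add: add_ac)
  then show ?thesis by (simp only: cong_add_rcancel_nat)
qed

lemma semirational_at_iff:
  assumes r: "r > 0" and j: "j < t" and k: "k > 0 \<or> j = 0"
  shows "(\<exists>h\<in>carrier H. nf j i [^] k \<otimes> h = h \<otimes> nf j i \<or> nf j i [^] k \<otimes> h = h \<otimes> inv (nf j i))
    \<longleftrightarrow> semirational_at n t l r j i k"
proof -
  let ?q1 = "(j * k - j) div t" and ?q2 = "(j * k + j) div t"
  have jk: "j \<le> j * k" using k by auto
  have 1: "(\<exists>h\<in>carrier H. nf j i [^] k \<otimes> h = h \<otimes> nf j i) \<longleftrightarrow>
    (j * k) mod t = j \<and> (\<exists>m<t. [l * ?q1 + i * k * r ^ m = i] (mod gcd n (r ^ j - 1)))" (is "?L \<longleftrightarrow> ?M \<and> ?R")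
  proof (cases ?M)
    case True
    then have "t dvd j * k - j" using j jk by (metis mod_less mod_eq_dvd_iff_nat)
    then have "j * k = j + t * ?q1" using jk by simp
    from conj_power_iff[OF r this, of i] True show ?thesis by simp
  next
    case False
    then show ?thesis using conj_power_imp_mod[of _ j i k] j by (auto simp: cong_def)
  qed
  have 2: "(\<exists>h\<in>carrier H. nf j i [^] k \<otimes> h = h \<otimes> inv (nf j i)) \<longleftrightarrow>
    (j * k + j) mod t = 0 \<and> (\<exists>m<t. [l * ?q2 + i * k * r ^ m + i = 0] (mod gcd n (r ^ j - 1)))" (is "?L \<longleftrightarrow> ?M \<and> ?R")
  proof (cases ?M)
    case True
    then have "j * k + j = t * ?q2" by (metis dvd_mult_div_cancel mod_eq_0_iff_dvd)
    from conj_inverse_power_iff[OF r this, of i] True show ?thesis by simp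
  next
    case False
    then show ?thesis using conj_inverse_power_imp_mod[of _ j i k] by (auto simp: cong_def)
  qed
  have "(\<exists>h\<in>carrier H. nf j i [^] k \<otimes> h = h \<otimes> nf j i \<or> nf j i [^] k \<otimes> h = h \<otimes> inv (nf j i))
    \<longleftrightarrow> (\<exists>h\<in>carrier H. nf j i [^] k \<otimes> h = h \<otimes> nf j i) \<or> (\<exists>h\<in>carrier H. nf j i [^] k \<otimes> h = h \<otimes> inv (nf j i))"
    by blast
  then show ?thesis unfolding 1 2 semirational_at_def Let_def cong_def list_ex_iff
    by (simp add: Bex_def)
qed

theorem inverse_semirational_iff:
  assumes r: "r > 0"
  shows "inverse_semirational H \<longleftrightarrow>
    (\<forall>j<t. \<forall>i<n. \<forall>k. coprime k (n * t) \<longrightarrow> semirational_at n t l r j i k)"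
proof -
  have k0: "k > 0 \<or> j = 0" if "coprime k (n * t)" "j < t" for j k
    using that by (cases "k = 0") auto
  have "inverse_semirational H \<longleftrightarrow> (\<forall>j<t. \<forall>i<n. \<forall>k. coprime k (n * t) \<longrightarrow>
     (\<exists>h\<in>carrier H. nf j i [^] k \<otimes> h = h \<otimes> nf j i \<or> nf j i [^] k \<otimes> h = h \<otimes> inv (nf j i)))"
    unfolding inverse_semirational_def card_carrier by (auto simp: mult.commute[of t] elim!: carrierE)
  also have "\<dots> \<longleftrightarrow> (\<forall>j<t. \<forall>i<n. \<forall>k. coprime k (n * t) \<longrightarrow> semirational_at n t l r j i k)"
    using semirational_at_iff[OF r] k0 by blast
  finally show ?thesis .
qed

end

text \<open>The condition \<open>semirational_at\<close> is periodic in \<open>k\<close> and in \<open>i\<close>. For \<open>j = 0\<close>, or if \<open>l\<close> is \<open>0\<close> modulo \<open>g\<close>, it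
  is moreover inherited from \<open>i = 1\<close> by multiplication with \<open>i\<close>. Disjunctions replace implications
  because rewriting evaluates the second disjunct only if the first one is false.\<close>

definition semirational_check :: "nat \<Rightarrow> nat \<Rightarrow> nat \<Rightarrow> nat \<Rightarrow> bool" where
  "semirational_check n t l r \<longleftrightarrow>
     list_all (\<lambda>j. let g = gcd n (r ^ j - 1); P = (if j = 0 then n else g * t) in
       list_all (\<lambda>k. \<not> coprime k P \<or>
         list_all (\<lambda>i. semirational_at n t l r j i k) (if j = 0 \<or> l mod g = 0 then [1] else [0..<g])) [0..<P]) [0..<t]"

lemma semirational_at_reduce_i:
  assumes "semirational_at n t l r j (i mod gcd n (r ^ j - 1)) k"
  shows "semirational_at n t l r j i k"
proof -
  let ?g = "gcd n (r ^ j - 1)"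
  have i: "[i mod ?g = i] (mod ?g)" by simp
  have 1: "[a + (i mod ?g) * k * b = a + i * k * b] (mod ?g)" for a b
    by (intro cong_add cong_mult i) auto
  have 2: "[a + (i mod ?g) * k * b + i mod ?g = a + i * k * b + i] (mod ?g)" for a b
    by (intro cong_add cong_mult i) auto
  show ?thesis
    using assms unfolding semirational_at_def Let_def 1[unfolded cong_def] 2[unfolded cong_def] by simp
qed

lemma semirational_at_one:
  assumes l: "j = 0 \<or> l mod gcd n (r ^ j - 1) = 0" and one: "semirational_at n t l r j 1 k"
  shows "semirational_at n t l r j i k"
proof -
  let ?g = "gcd n (r ^ j - 1)"
  have lq: "[l * q = 0] (mod ?g)" if "q = (j * k - j) div t \<or> q = (j * k + j) div t" for q
  proof (cases "j = 0")
    case False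
    then have "?g dvd l" using l by auto
    then show ?thesis by (simp add: cong_0_iff)
  qed (use that in auto)
  have 1: "(l * q + i * k * b) mod ?g = i mod ?g" 
    if "(l * q + 1 * k * b) mod ?g = 1 mod ?g" and q: "q = (j * k - j) div t" for q b
  proof -
    note lq = lq[OF disjI1[OF q]]
    have "[0 + k * b = l * q + 1 * k * b] (mod ?g)" using cong_sym[OF lq] by (intro cong_add) auto
    also have "[l * q + 1 * k * b = 1] (mod ?g)" using that by (simp add: cong_def)
    finally have "[i * (k * b) = i * 1] (mod ?g)" by (intro cong_scalar_left) simp
    then have "[l * q + i * (k * b) = 0 + i * 1] (mod ?g)" by (intro cong_add lq)
    then show ?thesis by (simp add: cong_def mult.assoc)
  qed
  have 2: "(l * q + i * k * b + i) mod ?g = 0" 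
    if "(l * q + 1 * k * b + 1) mod ?g = 0" and q: "q = (j * k + j) div t" for q b
  proof -
    note lq = lq[OF disjI2[OF q]]
    have "[0 + (k * b + 1) = l * q + (k * b + 1)] (mod ?g)" using cong_sym[OF lq] by (intro cong_add) auto
    also have "[l * q + (k * b + 1) = 0] (mod ?g)" using that by (simp add: cong_def)
    finally have "[i * (k * b + 1) = i * 0] (mod ?g)" by (intro cong_scalar_left) simp
    then have "[l * q + i * (k * b + 1) = 0 + i * 0] (mod ?g)" by (intro cong_add lq)
    then show ?thesis by (simp add: cong_def mult.assoc add.assoc algebra_simps)
  qed
  show ?thesis
    using one unfolding semirational_at_def Let_def list_ex_iff
  proof (elim disjE conjE bexE)
    fix m assume "(j * k) mod t = j" "m \<in> set [0..<t]"
      "(l * ((j * k - j) div t) + 1 * k * r ^ m) mod ?g = 1 mod ?g"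
    then show "j * k mod t = j \<and> (\<exists>m\<in>set [0..<t]. (l * ((j * k - j) div t) + i * k * r ^ m) mod ?g = i mod ?g)
      \<or> (j * k + j) mod t = 0 \<and> (\<exists>m\<in>set [0..<t]. (l * ((j * k + j) div t) + i * k * r ^ m + i) mod ?g = 0)"
      by (intro disjI1 conjI bexI[of _ m] 1 HOL.refl)
  next
    fix m assume "(j * k + j) mod t = 0" "m \<in> set [0..<t]"
      "(l * ((j * k + j) div t) + 1 * k * r ^ m + 1) mod ?g = 0"
    then show "j * k mod t = j \<and> (\<exists>m\<in>set [0..<t]. (l * ((j * k - j) div t) + i * k * r ^ m) mod ?g = i mod ?g)
      \<or> (j * k + j) mod t = 0 \<and> (\<exists>m\<in>set [0..<t]. (l * ((j * k + j) div t) + i * k * r ^ m + i) mod ?g = 0)"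
      by (intro disjI2 conjI bexI[of _ m] 2 HOL.refl)
  qed
qed

lemma semirational_at_period:
  fixes n t l r i j k :: nat
  defines "P \<equiv> (if j = 0 then n else gcd n (r ^ j - 1) * t)"
  assumes at: "semirational_at n t l r j i (k mod P)" and t: "t > 0" and pos: "j = 0 \<or> k mod P > 0"
  shows "semirational_at n t l r j i k"
proof -
  let ?g = "gcd n (r ^ j - 1)"
  define k' where "k' = k mod P"
  define c where "c = k div P"
  have k: "k = k' + P * c" by (simp add: k'_def c_def)
  have kg: "[k' = k] (mod ?g)"
    unfolding k P_def by (auto simp: cong_def mult.assoc)
  have jj: "j \<le> j * k'" using pos by (cases "j = 0") (auto simp: k'_def)
  have jk: "j * k = j * k' + t * (?g * (j * c))" by (simp add: k P_def algebra_simps)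
  have m1: "(j * k) mod t = (j * k') mod t" and m2: "(j * k + j) mod t = (j * k' + j) mod t"
  proof -
    show "(j * k) mod t = (j * k') mod t" unfolding jk by simp
    have "j * k + j = (j * k' + j) + t * (?g * (j * c))" unfolding jk by simp
    then show "(j * k + j) mod t = (j * k' + j) mod t" by (metis mod_mult_self2)
  qed
  have q1: "(j * k - j) div t = (j * k' - j) div t + ?g * (j * c)"
  proof -
    have "j * k - j = (j * k' - j) + t * (?g * (j * c))" unfolding jk using jj by simp
    then show ?thesis using t by simp
  qed
  have q2: "(j * k + j) div t = (j * k' + j) div t + ?g * (j * c)"
  proof -
    have eq: "j * k + j = (j * k' + j) + t * (?g * (j * c))" unfolding jk by simp
    show ?thesis unfolding eq using t by simp
  qed
  have lq: "[l * q = l * (q + ?g * (j * c))] (mod ?g)" for q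
    by (simp add: cong_def distrib_left mult.left_commute[of l])
  have e1: "[l * q + i * k' * b = l * (q + ?g * (j * c)) + i * k * b] (mod ?g)" for q b
    by (intro cong_add cong_mult lq kg) auto
  have e2: "[l * q + i * k' * b + i = l * (q + ?g * (j * c)) + i * k * b + i] (mod ?g)" for q b
    by (intro cong_add cong_mult lq kg) auto
  show ?thesis
    using at unfolding k'_def[symmetric] semirational_at_def Let_def m1 m2 q1 q2
      e1[unfolded cong_def] e2[unfolded cong_def] .
qed

theorem (in metacyclic_normal) inverse_semirational_if_check:
  assumes r: "r > 0" and check: "semirational_check n t l r"
  shows "inverse_semirational H"
  unfolding inverse_semirational_iff[OF r]
proof (intro allI impI)
  fix j i k assume j: "j < t" and "i < n" and k: "coprime k (n * t)"
  define g where "g = gcd n (r ^ j - 1)"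
  define P where "P = (if j = 0 then n else g * t)"
  have g0: "g > 0" using n0 by (simp add: g_def)
  have P0: "P > 0" using g0 n0 t0 by (simp add: P_def)
  have "P dvd n * t" unfolding P_def g_def by (auto intro: mult_dvd_mono)
  then have "coprime k P" using k by (meson coprime_divisors dvd_refl)
  then have k': "coprime (k mod P) P" using P0 by simp
  have pos: "j = 0 \<or> k mod P > 0"
  proof (cases "j = 0 \<or> k mod P > 0")
    case False
    then have "P = 1" using k' by simp
    then show ?thesis using False j by (auto simp: P_def)
  qed simp
  have jt: "j \<in> set [0..<t]" using j by simp
  have "list_all (\<lambda>k. \<not> coprime k P \<or>
      list_all (\<lambda>i. semirational_at n t l r j i k) (if j = 0 \<or> l mod g = 0 then [1] else [0..<g])) [0..<P]"
    using bspec[OF check[unfolded semirational_check_def Let_def list_all_iff[of _ "[0..<t]"]] jt]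
    unfolding P_def g_def .
  moreover have "k mod P \<in> set [0..<P]" using P0 by simp
  ultimately have chk: "list_all (\<lambda>i. semirational_at n t l r j i (k mod P)) (if j = 0 \<or> l mod g = 0 then [1] else [0..<g])"
    using k' unfolding list_all_iff[of _ "[0..<P]"] by blast
  have "semirational_at n t l r j i (k mod P)"
  proof (cases "j = 0 \<or> l mod g = 0")
    case True
    then have "semirational_at n t l r j 1 (k mod P)" using chk by auto
    with True show ?thesis unfolding g_def by (rule semirational_at_one)
  next
    case False
    then have "semirational_at n t l r j (i mod g) (k mod P)" using chk g0 by (simp add: list_all_iff)
    then show ?thesis unfolding g_def by (rule semirational_at_reduce_i)
  qed
  then show "semirational_at n t l r j i k"
    using semirational_at_period[of n t l r j i k] t0 pos unfolding P_def g_def by simp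
qed

section \<open>Isomorphisms between metacyclic presentations\<close>

text \<open>A pair \<open>(j, i)\<close> stands for the normal form \<open>b\<^sup>j a\<^sup>i\<close>.\<close>

fun nf_times :: "nat \<Rightarrow> nat \<Rightarrow> nat \<Rightarrow> nat \<Rightarrow> nat \<times> nat \<Rightarrow> nat \<times> nat \<Rightarrow> nat \<times> nat" where
  "nf_times n t l r (j, i) (j', i') = ((j + j') mod t, (i * r ^ j' + i' + l * ((j + j') div t)) mod n)"

definition nf_power :: "nat \<Rightarrow> nat \<Rightarrow> nat \<Rightarrow> nat \<Rightarrow> nat \<times> nat \<Rightarrow> nat \<Rightarrow> nat \<times> nat" where
  "nf_power n t l r x k = (nf_times n t l r x ^^ k) (0, 0)"

lemma (in metacyclic_pair) nf_times:
  "(case nf_times n t l r x y of (j, i) \<Rightarrow> nf j i) = (case x of (j, i) \<Rightarrow> nf j i) \<otimes> (case y of (j, i) \<Rightarrow> nf j i)"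
  by (cases x; cases y) (simp add: nf_mult nf_reduce[symmetric])

lemma (in metacyclic_pair) nf_power:
  "(case nf_power n t l r x k of (j, i) \<Rightarrow> nf j i) = (case x of (j, i) \<Rightarrow> nf j i) [^] k"
proof (induction k)
  case (Suc k)
  have "(case x of (j, i) \<Rightarrow> nf j i) \<in> carrier H" by (cases x) simp
  then show ?case
    unfolding nat_pow_Suc2[OF \<open>(case x of (j, i) \<Rightarrow> nf j i) \<in> carrier H\<close>] Suc[symmetric] nf_times[symmetric]
    by (simp add: nf_power_def)
qed (simp add: nf_power_def)

definition consistent :: "nat \<Rightarrow> nat \<Rightarrow> nat \<Rightarrow> nat \<Rightarrow> bool" where
  "consistent n t l r \<longleftrightarrow> n > 1 \<and> t > 1 \<and> r > 0 \<and> r ^ t mod n = 1 \<and> l * r mod n = l mod n"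

text \<open>The pairs \<open>x\<close> and \<open>y\<close> are the images of the generators; the exponents \<open>p, q\<close> and \<open>p', q'\<close>
  write the generators of the target as words in them.\<close>

definition iso_check :: "nat \<times> nat \<times> nat \<times> nat \<Rightarrow> nat \<times> nat \<times> nat \<times> nat
    \<Rightarrow> nat \<times> nat \<Rightarrow> nat \<times> nat \<Rightarrow> nat \<times> nat \<Rightarrow> nat \<times> nat \<Rightarrow> bool" where
  "iso_check = (\<lambda>(n, t, l, r) (n', t', l', r') x y (p, q) (p', q').
     let pw = nf_power n' t' l' r'; tm = nf_times n' t' l' r' in
     n * t = n' * t' \<and> consistent n t l r \<and> consistent n' t' l' r' \<and>
     pw x n = (0, 0) \<and> pw y t = pw x l \<and> tm x y = tm y (pw x r) \<and>
     tm (pw y p) (pw x q) = (0, 1) \<and> tm (pw y p') (pw x q') = (1, 0))"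

definition pres :: "nat \<times> nat \<times> nat \<times> nat \<Rightarrow> (gen \<times> bool) list set monoid" where
  "pres = (\<lambda>(n, t, l, r). metacyclic_pres n t l r)"

lemma consistent_normal:
  assumes "consistent n t l r"
  shows "metacyclic_normal (metacyclic_pres n t l r) (pres_gen n t l r Gen_a) (pres_gen n t l r Gen_b) n t l r"
  using assms by (intro metacyclic_pres_normal) (auto simp: consistent_def cong_def)

text \<open>The images of the generators satisfy the relations of the source, so they define a homomorphism; it
  is onto because the generators of the target are words in the images, and the orders agree.\<close>

lemma iso_check_sound:
  assumes "iso_check s d x y pq pq'"
  shows "pres s \<cong> pres d"
proof -
  obtain n t l r n' t' l' r' p q p' q' where eq: "s = (n, t, l, r)" "d = (n', t', l', r')" "pq = (p, q)" "pq' = (p', q')"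
    by (metis prod_cases4 surj_pair)
  let ?P = "metacyclic_pres n' t' l' r'"
  note chk = assms[unfolded eq iso_check_def Let_def prod.case]
  have c: "consistent n t l r" "consistent n' t' l' r'" using chk by auto
  interpret P: metacyclic_normal ?P "pres_gen n' t' l' r' Gen_a" "pres_gen n' t' l' r' Gen_b" n' t' l' r'
    by (rule consistent_normal[OF c(2)])
  define val where "val z = (case z of (j, i) \<Rightarrow> P.nf j i)" for z
  have val_mult: "val (nf_times n' t' l' r' z w) = val z \<otimes>\<^bsub>?P\<^esub> val w" for z w
    unfolding val_def by (rule P.nf_times)
  have val_pow: "val (nf_power n' t' l' r' z k) = val z [^]\<^bsub>?P\<^esub> k" for z k
    unfolding val_def by (rule P.nf_power)
  have val_closed: "val z \<in> carrier ?P" for z by (cases z) (simp add: val_def)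
  have pair: "metacyclic_pair ?P (val x) (val y) n t l r"
  proof unfold_locales
    show "val x [^]\<^bsub>?P\<^esub> n = \<one>\<^bsub>?P\<^esub>" using chk val_pow[of x n] by (simp add: val_def)
    show "val y [^]\<^bsub>?P\<^esub> t = val x [^]\<^bsub>?P\<^esub> l" using chk val_pow by metis
    show "val x \<otimes>\<^bsub>?P\<^esub> val y = val y \<otimes>\<^bsub>?P\<^esub> val x [^]\<^bsub>?P\<^esub> r" using chk val_pow val_mult by metis
  qed (use c val_closed in \<open>auto simp: consistent_def\<close>)
  interpret Q: metacyclic_pair ?P "val x" "val y" n t l r by (rule pair)
  have a: "pres_gen n' t' l' r' Gen_a \<in> Q.NF"
  proof -
    have "Q.nf p q = val (0, 1)" using chk val_mult val_pow unfolding Q.nf_def by metis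
    then show ?thesis using Q.nf_in_NF[of p q] by (simp add: val_def P.nf_A[unfolded One_nat_def])
  qed
  have b: "pres_gen n' t' l' r' Gen_b \<in> Q.NF"
  proof -
    have "Q.nf p' q' = val (1, 0)" using chk val_mult val_pow unfolding Q.nf_def by metis
    then show ?thesis using Q.nf_in_NF[of p' q'] by (simp add: val_def P.nf_B[unfolded One_nat_def])
  qed
  have "carrier ?P = Q.NF"
  proof (intro equalityI subsetI)
    fix z assume "z \<in> carrier ?P"
    then show "z \<in> Q.NF" using a b by (elim P.carrierE) (auto simp: P.nf_def intro!: Q.NF_mult Q.NF_pow)
  qed (auto simp: Q.NF_def)
  moreover have "card (carrier ?P) = t * n" using P.card_carrier chk by (simp add: mult.commute)
  ultimately show ?thesis
    unfolding eq pres_def prod.case using c(1)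
    by (intro metacyclic_recognition[OF pair]) (auto simp: consistent_def cong_def)
qed

lemma metacyclic_pres_cong:
  fixes n t l r l' r' :: nat
  assumes nt: "n > 0" "t > 0" and cons: "[r ^ t = 1] (mod n)" "[l * r = l] (mod n)"
    and lr: "[l = l'] (mod n)" "[r = r'] (mod n)"
  shows "metacyclic_pres n t l r \<cong> metacyclic_pres n t l' r'"
proof -
  have cons': "[r' ^ t = 1] (mod n)" "[l' * r' = l'] (mod n)"
    using cons lr by (metis cong_pow cong_sym cong_trans, metis cong_mult cong_sym cong_trans)
  interpret P: metacyclic_normal "metacyclic_pres n t l' r'" "pres_gen n t l' r' Gen_a" "pres_gen n t l' r' Gen_b" n t l' r'
    by (rule metacyclic_pres_normal[OF nt cons'])
  have "metacyclic_pair (metacyclic_pres n t l' r') (pres_gen n t l' r' Gen_a) (pres_gen n t l' r' Gen_b) n t l r"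
    by unfold_locales (use nt P.A_order P.B_power P.A_B lr P.A_pow_mod in \<open>auto simp: cong_def\<close>, metis+)
  then show ?thesis
    using P.carrier_NF P.card_carrier cons
    by (intro metacyclic_recognition) (auto simp: metacyclic_pair.NF_def metacyclic_pair.nf_def P.NF_def P.nf_def)
qed

section \<open>Bounds on the parameters\<close>

lemma inverse_semirational_iso:
  assumes "group G" "group H" "G \<cong> H" "inverse_semirational G"
  shows "inverse_semirational H"
  unfolding inverse_semirational_def
proof (intro ballI allI impI)
  interpret G: group G by fact
  interpret H: group H by fact
  obtain \<phi> where phi: "\<phi> \<in> iso G H" using assms(3) by (auto simp: is_iso_def)
  then interpret group_hom G H \<phi> by unfold_locales (simp add: iso_def)
  have bij: "\<phi> ` carrier G = carrier H" "card (carrier G) = card (carrier H)"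
    using phi by (auto simp: iso_def bij_betw_def dest: card_image)
  fix y and k :: nat assume "y \<in> carrier H" "coprime k (card (carrier H))"
  then obtain x where x: "x \<in> carrier G" "y = \<phi> x" "coprime k (card (carrier G))" using bij by auto
  then obtain g where g: "g \<in> carrier G" "x [^]\<^bsub>G\<^esub> k \<otimes>\<^bsub>G\<^esub> g = g \<otimes>\<^bsub>G\<^esub> x \<or> x [^]\<^bsub>G\<^esub> k \<otimes>\<^bsub>G\<^esub> g = g \<otimes>\<^bsub>G\<^esub> inv\<^bsub>G\<^esub> x"
    using assms(4) unfolding inverse_semirational_def by blast
  have "\<phi> (x [^]\<^bsub>G\<^esub> k \<otimes>\<^bsub>G\<^esub> g) = y [^]\<^bsub>H\<^esub> k \<otimes>\<^bsub>H\<^esub> \<phi> g" using x g(1) by (simp add: hom_nat_pow)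
  then have 1: "y [^]\<^bsub>H\<^esub> k \<otimes>\<^bsub>H\<^esub> \<phi> g = \<phi> (x [^]\<^bsub>G\<^esub> k \<otimes>\<^bsub>G\<^esub> g)" by (rule HOL.sym)
  have 2: "\<phi> (g \<otimes>\<^bsub>G\<^esub> x) = \<phi> g \<otimes>\<^bsub>H\<^esub> y" using x g(1) by simp
  have 3: "\<phi> (g \<otimes>\<^bsub>G\<^esub> inv\<^bsub>G\<^esub> x) = \<phi> g \<otimes>\<^bsub>H\<^esub> inv\<^bsub>H\<^esub> y" using x g(1) by simp
  show "\<exists>h\<in>carrier H. y [^]\<^bsub>H\<^esub> k \<otimes>\<^bsub>H\<^esub> h = h \<otimes>\<^bsub>H\<^esub> y \<or> y [^]\<^bsub>H\<^esub> k \<otimes>\<^bsub>H\<^esub> h = h \<otimes>\<^bsub>H\<^esub> inv\<^bsub>H\<^esub> y"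
    by (rule bexI[OF _ hom_closed[OF g(1)]], use g(2) in \<open>elim disjE\<close>) (simp_all only: 1 2 3 simp_thms)
qed

definition units_pm_powers :: "nat \<Rightarrow> nat \<Rightarrow> nat \<Rightarrow> bool" where
  "units_pm_powers n t r \<longleftrightarrow>
     (\<forall>k. coprime k n \<longrightarrow> (\<exists>m<t. [k * r ^ m = 1] (mod n) \<or> [k * r ^ m + 1 = 0] (mod n)))"

context metacyclic_normal
begin

text \<open>The condition on the powers of \<open>a\<close>, that is, \<open>j = 0\<close> and \<open>i = 1\<close>.\<close>

lemma isr_units_pm_powers:
  assumes isr: "inverse_semirational H" and r: "r > 0" and n: "n > 1"
  shows "units_pm_powers n t r"
  unfolding units_pm_powers_def
proof (intro allI impI)
  fix k assume "coprime k n"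
  moreover have "n * t > 0" using n0 t0 by simp
  ultimately obtain k' where k': "[k' = k] (mod n)" "coprime k' (n * t)" using coprime_lift by blast
  then have "semirational_at n t l r 0 1 k'"
    using isr n t0 unfolding inverse_semirational_iff[OF r] by blast
  then obtain m where m: "m < t" "[k' * r ^ m = 1] (mod n) \<or> [k' * r ^ m + 1 = 0] (mod n)"
    by (auto simp: semirational_at_def list_ex_iff cong_def)
  have km: "[k' * r ^ m = k * r ^ m] (mod n)" using k'(1) by (rule cong_scalar_right)
  have "[k' * r ^ m + 1 = k * r ^ m + 1] (mod n)" by (rule cong_add[OF km cong_refl])
  with km m show "\<exists>m<t. [k * r ^ m = 1] (mod n) \<or> [k * r ^ m + 1 = 0] (mod n)"
    by (metis cong_sym cong_trans)
qed

text \<open>The condition on the powers of \<open>b\<close>, seen in the quotient of order \<open>t\<close>.\<close>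

lemma isr_units_mod_t:
  assumes isr: "inverse_semirational H" and r: "r > 0" and t: "t > 1" and k: "coprime k t"
  shows "[k = 1] (mod t) \<or> [k + 1 = 0] (mod t)"
proof -
  have "n * t > 0" using n0 t0 by simp
  then obtain k' where k': "[k' = k] (mod t)" "coprime k' (n * t)" using coprime_lift[OF k] by blast
  then have "semirational_at n t l r 1 0 k'"
    using isr n0 t unfolding inverse_semirational_iff[OF r] by blast
  then have "[k' = 1] (mod t) \<or> [k' + 1 = 0] (mod t)"
    using t by (auto simp: semirational_at_def cong_def Let_def)
  moreover have "[k' + 1 = k + 1] (mod t)" by (rule cong_add[OF k'(1) cong_refl])
  ultimately show ?thesis using k'(1) by (metis cong_sym cong_trans)
qed

end

text \<open>For \<open>t > 6\<close> or \<open>t = 5\<close>, one of \<open>2\<close>, \<open>t / 2 + 1\<close> and \<open>t / 2 + 2\<close> is a unit different from \<open>1\<close> and \<open>-1\<close>.\<close>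

lemma units_pm_one_cases:
  fixes t :: nat
  assumes t: "t > 1" and units: "\<And>k. coprime k t \<Longrightarrow> [k = 1] (mod t) \<or> [k + 1 = 0] (mod t)"
  shows "t \<in> {2, 3, 4, 6}"
proof -
  have dvd: "t dvd k - 1 \<or> t dvd k + 1" if "coprime k t" "k \<ge> 1" for k
    using units[OF that(1)] that(2) by (auto simp: cong_altdef_nat cong_0_iff)
  consider "odd t" | s where "t = 2 * s" "even s" | s where "t = 2 * s" "odd s" by (auto elim: evenE)
  then show ?thesis
  proof cases
    case 1
    then have "coprime 2 t" by simp
    then have "t dvd 1 \<or> t dvd 3" using dvd[of 2] by simp
    then have "t \<le> 3" using t by (auto dest: dvd_imp_le)
    moreover have "t \<noteq> 2" using 1 by auto
    ultimately show ?thesis using t by auto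
  next
    case (2 s)
    then have s: "s \<ge> 2" using t by (auto elim!: evenE)
    have "coprime (s + 1) s" by simp
    then have "coprime (s + 1) t" using 2 by (simp add: coprime_mult_right_iff)
    then have "t dvd s \<or> t dvd s + 2" using dvd[of "s + 1"] by simp
    then have "2 * s \<le> s \<or> 2 * s \<le> s + 2" using 2 s by (auto dest!: dvd_imp_le)
    then have "s = 2" using s by auto
    then show ?thesis using 2 by simp
  next
    case (3 s)
    have "coprime (s + 2) s"
      using 3(2) by (metis add.commute coprime_iff_gcd_eq_1 gcd_add1 coprime_left_2_iff_odd)
    then have "coprime (s + 2) t" using 3 by (simp add: coprime_mult_right_iff)
    then have "t dvd s + 1 \<or> t dvd s + 3" using dvd[of "s + 2"] by (simp add: numeral_eq_Suc)
    then have "2 * s \<le> s + 1 \<or> 2 * s \<le> s + 3" using 3 by (auto dest!: dvd_imp_le)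
    then have "s \<le> 3" by auto
    then have "s = 1 \<or> s = 3" using 3 by (auto simp: numeral_eq_Suc le_Suc_eq)
    then show ?thesis using 3 by auto
  qed
qed

text \<open>The element \<open>k r\<^sup>m\<close> is \<open>1\<close> or \<open>-1\<close> for some \<open>m\<close>, so its \<open>e\<close>-th power and that of \<open>r\<^sup>m\<close> are \<open>1\<close>.\<close>

lemma units_pm_powers_exponent:
  assumes u: "units_pm_powers n t r" and rt: "[r ^ t = 1] (mod n)" and e: "even e" "t dvd e"
    and k: "coprime k n"
  shows "[k ^ e = 1] (mod n)"
proof -
  obtain m where m: "[k * r ^ m = 1] (mod n) \<or> [k * r ^ m + 1 = 0] (mod n)"
    using u k unfolding units_pm_powers_def by blast
  let ?x = "k * r ^ m"
  have "[?x * ?x = 1] (mod n)"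
    using m
  proof
    assume "[?x = 1] (mod n)"
    then show ?thesis using cong_mult by fastforce
  next
    assume x: "[?x + 1 = 0] (mod n)"
    have "[?x * (?x + 1) = ?x * 0] (mod n)" by (rule cong_scalar_left[OF x])
    then have "[?x * ?x + ?x = 0] (mod n)" by (simp add: algebra_simps)
    moreover have "[0 = 1 + ?x] (mod n)" using x by (simp add: add.commute cong_sym_eq)
    ultimately have "[?x * ?x + ?x = 1 + ?x] (mod n)" by (rule cong_trans)
    then show ?thesis by (simp only: cong_add_rcancel_nat)
  qed
  then have "[(?x * ?x) ^ (e div 2) = 1 ^ (e div 2)] (mod n)" by (rule cong_pow)
  then have "[?x ^ e = 1] (mod n)" using e(1) by (simp add: power_mult_distrib[symmetric] power2_eq_square[symmetric] power_mult[symmetric])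
  moreover have "[(r ^ m) ^ e = 1] (mod n)"
  proof -
    obtain c where "e = t * c" using e(2) by auto
    then have "(r ^ m) ^ e = (r ^ t) ^ (m * c)" by (simp add: power_mult[symmetric] mult_ac)
    then show ?thesis using cong_pow[OF rt, of "m * c"] by simp
  qed
  then have "[k ^ e * (r ^ m) ^ e = k ^ e * 1] (mod n)" by (rule cong_scalar_left)
  ultimately show ?thesis by (metis cong_sym cong_trans mult.right_neutral power_mult_distrib)
qed

lemma units_exponent_dvd:
  fixes n e q c :: nat
  assumes "\<And>k. coprime k n \<Longrightarrow> [k ^ e = 1] (mod n)" and n: "n > 0" and q: "q dvd n" and c: "coprime c q"
  shows "[c ^ e = 1] (mod q)"
proof -
  obtain k where k: "[k = c] (mod q)" "coprime k n" using coprime_lift[OF c n] by blast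
  have "[k ^ e = 1] (mod q)" using assms(1)[OF k(2)] q by (rule cong_dvd_modulus_nat)
  then show ?thesis using cong_pow[OF k(1), of e] by (metis cong_sym cong_trans)
qed

lemma units_exponent_not_dvd:
  fixes n e q c :: nat
  assumes "\<And>k. coprime k n \<Longrightarrow> [k ^ e = 1] (mod n)" "n > 0" "coprime c q" "c ^ e mod q \<noteq> 1 mod q"
  shows "\<not> q dvd n"
  using units_exponent_dvd[OF assms(1,2) _ assms(3)] assms(4) by (auto simp: cong_def)

text \<open>The element \<open>c\<close> shows that \<open>p\<close> does not divide \<open>n\<close>; then \<open>p\<close> itself is a unit modulo \<open>n\<close>.\<close>

lemma units_exponent_bound:
  fixes n e q c :: nat
  assumes u: "\<And>k. coprime k n \<Longrightarrow> [k ^ e = 1] (mod n)" and n: "n > 0"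
    and p: "Factorial_Ring.prime p" "coprime c p" "c ^ e mod p \<noteq> 1 mod p"
  shows "n dvd p ^ e - 1"
proof -
  have "\<not> p dvd n" by (rule units_exponent_not_dvd[OF u n p(2,3)])
  then have "coprime p n" using p(1) by (rule prime_imp_coprime_nat[rotated])
  then have "[p ^ e = 1] (mod n)" by (rule u)
  then show ?thesis using p(1) by (subst (asm) cong_altdef_nat) (auto simp: prime_gt_0_nat Suc_le_eq)
qed

lemma dvd_drop_prime:
  fixes n p m :: nat
  assumes n: "n dvd p * m" and p: "Factorial_Ring.prime p" "p ^ e dvd p * m" and ndvd: "\<not> p ^ e dvd n"
  shows "n dvd m"
proof -
  obtain w where w: "p * m = n * w" using n by (auto elim: dvdE)
  have "p dvd w"
  proof (rule ccontr)
    assume "\<not> p dvd w"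
    then have "coprime (p ^ e) w" using prime_imp_coprime_nat[OF p(1)] by simp
    then have "p ^ e dvd n" using p(2) by (simp add: w coprime_dvd_mult_left_iff)
    then show False using ndvd by simp
  qed
  then obtain w' where w': "w = p * w'" by auto
  have "p * m = p * (n * w')" unfolding w w' by (rule mult.left_commute)
  then have "m = n * w'" using prime_gt_0_nat[OF p(1)] by (simp only: nat_mult_eq_cancel1)
  then show ?thesis by simp
qed

text \<open>A unit is determined by the exponent \<open>m\<close> and the sign.\<close>

lemma totient_le_if_units_pm_powers:
  assumes u: "units_pm_powers q t r" and q: "q > 1"
  shows "totient q \<le> 2 * t"
proof -
  define R where "R k m b \<longleftrightarrow> (if b then [k * r ^ m = 1] (mod q) else [k * r ^ m + 1 = 0] (mod q))" for k m b
  define f where "f = (\<lambda>(m, b). SOME k. k \<in> totatives q \<and> R k m b)"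
  have unique: "k = k'" if k: "k \<in> totatives q" "k' \<in> totatives q" "R k m b" "R k' m b" for k k' m b
  proof -
    have "[k * r ^ m = k' * r ^ m] (mod q)"
    proof (cases b)
      case False
      then have "[k * r ^ m + 1 = k' * r ^ m + 1] (mod q)" using k by (auto simp: R_def intro: cong_trans cong_sym)
      then show ?thesis by (simp only: cong_add_rcancel_nat)
    qed (use k in \<open>auto simp: R_def intro: cong_trans cong_sym\<close>)
    moreover have "coprime (r ^ m) q"
    proof (cases b)
      case True
      then have "[k * r ^ m = 1] (mod q)" using k by (simp add: R_def)
      then have "coprime (k * r ^ m) q" using cong_imp_coprime cong_sym coprime_1_left by blast
      then show ?thesis by simp
    next
      case False
      then have "q dvd k * r ^ m + 1" using k by (simp add: R_def cong_0_iff)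
      then have "coprime (k * r ^ m) q"
        by (metis coprime_Suc_right_nat coprime_divisors dvd_refl Suc_eq_plus1)
      then show ?thesis by simp
    qed
    ultimately have "[k = k'] (mod q)" by (simp add: cong_mult_rcancel_nat coprime_commute)
    moreover have "k < q" "k' < q" using k(1,2) q totatives_less by auto
    ultimately show ?thesis by (simp add: cong_def)
  qed
  have "totatives q \<subseteq> f ` ({..<t} \<times> UNIV)"
  proof
    fix k assume k: "k \<in> totatives q"
    then have "coprime k q" by (simp add: in_totatives_iff)
    then obtain m b where m: "m < t" "R k m b" using u unfolding units_pm_powers_def R_def by (metis (full_types))
    then have "(SOME k. k \<in> totatives q \<and> R k m b) \<in> totatives q \<and> R (SOME k. k \<in> totatives q \<and> R k m b) m b"
      using k by (intro someI[of "\<lambda>k. k \<in> totatives q \<and> R k m b" k]) auto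
    then have "f (m, b) = k" using unique k m unfolding f_def by auto
    then show "k \<in> f ` ({..<t} \<times> UNIV)" using m by force
  qed
  then have "card (totatives q) \<le> card (f ` ({..<t} \<times> (UNIV :: bool set)))" by (intro card_mono) auto
  also have "\<dots> \<le> card ({..<t} \<times> (UNIV :: bool set))" by (intro card_image_le) auto
  finally show ?thesis by (simp add: totient_def)
qed

section \<open>Enumeration of the remaining parameters\<close>

text \<open>The groups of the classification, one list for each line, as quadruples \<open>(n, t, l, r)\<close>. Where the
  parameter is a primitive root, its least positive value is taken.\<close>

definition fam1 :: "(nat \<times> nat \<times> nat \<times> nat) list" where
  "fam1 =
    [(3, 2, 0, 2), (4, 2, 0, 3), (6, 2, 0, 5), (3, 4, 0, 2), (4, 4, 0, 3), (6, 4, 0, 5),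
     (3, 6, 0, 2), (4, 6, 0, 3), (6, 6, 0, 5)]"

definition fam2 :: "(nat \<times> nat \<times> nat \<times> nat) list" where
  "fam2 =
    [(4, 2, 2, 3), (4, 4, 2, 3), (4, 6, 2, 3)]"

definition fam3 :: "(nat \<times> nat \<times> nat \<times> nat) list" where
  "fam3 =
    [(6, 2, 3, 5)]"

definition fam4 :: "(nat \<times> nat \<times> nat \<times> nat) list" where
  "fam4 =
    [(5, 4, 0, 2), (7, 6, 0, 3), (9, 6, 0, 2), (10, 4, 0, 3), (14, 6, 0, 3), (18, 6, 0, 5)]"

definition fam5 :: "(nat \<times> nat \<times> nat \<times> nat) list" where
  "fam5 =
    [(7, 6, 0, 2), (9, 6, 0, 4), (14, 6, 0, 9), (18, 6, 0, 7), (7, 3, 0, 2), (9, 3, 0, 4),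
     (14, 3, 0, 9), (18, 3, 0, 7)]"

definition fam6 :: "(nat \<times> nat \<times> nat \<times> nat) list" where
  "fam6 =
    [(8, 2, 0, 3), (8, 2, 0, 5), (8, 4, 0, 3), (8, 4, 0, 5)]"

definition fam7 :: "(nat \<times> nat \<times> nat \<times> nat) list" where
  "fam7 =
    [(12, 2, 0, 5), (12, 4, 0, 5)]"

definition fam8 :: "(nat \<times> nat \<times> nat \<times> nat) list" where
  "fam8 =
    [(12, 2, 2, 7), (12, 2, 12, 7), (12, 6, 6, 7), (12, 6, 12, 7)]"

definition fam9 :: "(nat \<times> nat \<times> nat \<times> nat) list" where
  "fam9 =
    [(15, 4, 0, 2)]"

definition fam10 :: "(nat \<times> nat \<times> nat \<times> nat) list" where
  "fam10 =
    [(16, 4, 0, 3), (16, 4, 0, 5)]"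

definition fam11 :: "(nat \<times> nat \<times> nat \<times> nat) list" where
  "fam11 =
    [(20, 4, 0, 3), (20, 4, 0, 13)]"

definition fam12 :: "(nat \<times> nat \<times> nat \<times> nat) list" where
  "fam12 =
    [(20, 4, 10, 3)]"

definition fam13 :: "(nat \<times> nat \<times> nat \<times> nat) list" where
  "fam13 =
    [(21, 6, 0, 2), (21, 6, 0, 10)]"

definition fam14 :: "(nat \<times> nat \<times> nat \<times> nat) list" where
  "fam14 =
    [(28, 6, 14, 11), (28, 6, 28, 11)]"

definition fam15 :: "(nat \<times> nat \<times> nat \<times> nat) list" where
  "fam15 =
    [(30, 4, 0, 17)]"

definition fam16 :: "(nat \<times> nat \<times> nat \<times> nat) list" where
  "fam16 =
    [(36, 6, 6, 7), (36, 6, 36, 7)]"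

definition fam17 :: "(nat \<times> nat \<times> nat \<times> nat) list" where
  "fam17 =
    [(42, 6, 0, 11), (42, 6, 0, 19)]"

definition targets :: "(nat \<times> nat \<times> nat \<times> nat) list" where
  "targets = fam1 @ fam2 @ fam3 @ fam4 @ fam5 @ fam6 @ fam7 @ fam8 @ fam9 @ fam10 @ fam11 @ fam12 @ fam13 @ fam14 @ fam15 @ fam16 @ fam17"

text \<open>Each row consists of a quadruple that passes the congruences, a listed quadruple, and the data of
  \<open>iso_check\<close>: the images of the two generators and the words for the inverse homomorphism. The
  exponents \<open>l\<close> in the first component are divisors of \<open>n\<close>, so that the split extension appears with
  \<open>l = n\<close>. Many groups with \<open>b\<^sup>t \<noteq> 1\<close> split after \<open>b\<close> is multiplied by a power of \<open>a\<close>, and some with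
  \<open>t = 2, 3\<close> are metacyclic with respect to another normal subgroup.\<close>

definition iso_table :: "((nat \<times> nat \<times> nat \<times> nat) \<times> (nat \<times> nat \<times> nat \<times> nat) \<times> (nat \<times> nat) \<times> (nat \<times> nat) \<times> (nat \<times> nat) \<times> (nat \<times> nat)) list" where
  "iso_table =
    [((3, 2, 3, 2), (3, 2, 0, 2), (0, 1), (1, 0), (0, 1), (1, 0)), ((3, 4, 3, 2), (3, 4, 0, 2), (0, 1), (1, 0), (0, 1), (1, 0)),
     ((3, 6, 3, 2), (3, 6, 0, 2), (0, 1), (1, 0), (0, 1), (1, 0)), ((4, 2, 2, 3), (4, 2, 2, 3), (0, 1), (1, 0), (0, 1), (1, 0)),
     ((4, 2, 4, 3), (4, 2, 0, 3), (0, 1), (1, 0), (0, 1), (1, 0)), ((4, 4, 2, 3), (4, 4, 2, 3), (0, 1), (1, 0), (0, 1), (1, 0)),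
     ((4, 4, 4, 3), (4, 4, 0, 3), (0, 1), (1, 0), (0, 1), (1, 0)), ((4, 6, 2, 3), (4, 6, 2, 3), (0, 1), (1, 0), (0, 1), (1, 0)),
     ((4, 6, 4, 3), (4, 6, 0, 3), (0, 1), (1, 0), (0, 1), (1, 0)), ((5, 4, 5, 2), (5, 4, 0, 2), (0, 1), (1, 0), (0, 1), (1, 0)),
     ((5, 4, 5, 3), (5, 4, 0, 2), (0, 1), (3, 0), (0, 1), (3, 0)), ((6, 2, 3, 5), (3, 4, 0, 2), (2, 1), (1, 0), (0, 4), (1, 0)),
     ((6, 2, 6, 5), (6, 2, 0, 5), (0, 1), (1, 0), (0, 1), (1, 0)), ((6, 4, 6, 5), (6, 4, 0, 5), (0, 1), (1, 0), (0, 1), (1, 0)),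
     ((6, 6, 6, 5), (6, 6, 0, 5), (0, 1), (1, 0), (0, 1), (1, 0)), ((7, 3, 7, 2), (7, 3, 0, 2), (0, 1), (1, 0), (0, 1), (1, 0)),
     ((7, 3, 7, 4), (7, 3, 0, 2), (0, 1), (2, 0), (0, 1), (2, 0)), ((7, 6, 7, 2), (7, 6, 0, 2), (0, 1), (1, 0), (0, 1), (1, 0)),
     ((7, 6, 7, 3), (7, 6, 0, 3), (0, 1), (1, 0), (0, 1), (1, 0)), ((7, 6, 7, 4), (7, 6, 0, 2), (0, 1), (5, 0), (0, 1), (5, 0)),
     ((7, 6, 7, 5), (7, 6, 0, 3), (0, 1), (5, 0), (0, 1), (5, 0)), ((8, 2, 4, 3), (8, 2, 0, 3), (0, 1), (1, 1), (0, 1), (1, 7)),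
     ((8, 2, 8, 3), (8, 2, 0, 3), (0, 1), (1, 0), (0, 1), (1, 0)), ((8, 2, 2, 5), (4, 4, 2, 3), (1, 0), (1, 1), (1, 3), (0, 1)),
     ((8, 2, 4, 5), (4, 4, 2, 3), (1, 0), (0, 1), (1, 0), (0, 1)), ((8, 2, 8, 5), (4, 4, 2, 3), (1, 0), (2, 1), (1, 6), (0, 1)),
     ((8, 4, 8, 3), (8, 4, 0, 3), (0, 1), (1, 0), (0, 1), (1, 0)), ((8, 4, 4, 5), (8, 4, 0, 5), (0, 1), (1, 1), (0, 1), (1, 7)),
     ((8, 4, 8, 5), (8, 4, 0, 5), (0, 1), (1, 0), (0, 1), (1, 0)), ((9, 3, 3, 4), (9, 3, 0, 4), (0, 1), (1, 1), (0, 1), (1, 8)),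
     ((9, 3, 9, 4), (9, 3, 0, 4), (0, 1), (1, 0), (0, 1), (1, 0)), ((9, 3, 3, 7), (9, 3, 0, 4), (0, 1), (2, 1), (0, 1), (2, 1)),
     ((9, 3, 9, 7), (9, 3, 0, 4), (0, 1), (2, 0), (0, 1), (2, 0)), ((9, 6, 9, 2), (9, 6, 0, 2), (0, 1), (1, 0), (0, 1), (1, 0)),
     ((9, 6, 3, 4), (9, 6, 0, 4), (0, 1), (1, 2), (0, 1), (1, 7)), ((9, 6, 9, 4), (9, 6, 0, 4), (0, 1), (1, 0), (0, 1), (1, 0)),
     ((9, 6, 9, 5), (9, 6, 0, 2), (0, 1), (5, 0), (0, 1), (5, 0)), ((9, 6, 3, 7), (9, 6, 0, 4), (0, 1), (5, 2), (0, 1), (5, 5)),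
     ((9, 6, 9, 7), (9, 6, 0, 4), (0, 1), (5, 0), (0, 1), (5, 0)), ((10, 4, 10, 3), (10, 4, 0, 3), (0, 1), (1, 0), (0, 1), (1, 0)),
     ((10, 4, 10, 7), (10, 4, 0, 3), (0, 1), (3, 0), (0, 1), (3, 0)), ((12, 2, 6, 5), (12, 2, 0, 5), (0, 1), (1, 1), (0, 1), (1, 11)),
     ((12, 2, 12, 5), (12, 2, 0, 5), (0, 1), (1, 0), (0, 1), (1, 0)), ((12, 2, 2, 7), (4, 6, 2, 3), (1, 0), (1, 1), (1, 5), (0, 1)),
     ((12, 2, 4, 7), (4, 6, 0, 3), (2, 1), (1, 0), (0, 9), (1, 0)), ((12, 2, 6, 7), (4, 6, 2, 3), (1, 0), (0, 1), (1, 0), (0, 1)),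
     ((12, 2, 12, 7), (4, 6, 0, 3), (2, 1), (3, 0), (0, 9), (1, 8)), ((12, 4, 12, 5), (12, 4, 0, 5), (0, 1), (1, 0), (0, 1), (1, 0)),
     ((12, 6, 6, 7), (12, 6, 6, 7), (0, 1), (1, 0), (0, 1), (1, 0)), ((12, 6, 12, 7), (12, 6, 12, 7), (0, 1), (1, 0), (0, 1), (1, 0)),
     ((14, 3, 7, 9), (7, 6, 0, 2), (3, 1), (1, 0), (0, 8), (1, 0)), ((14, 3, 14, 9), (7, 6, 0, 2), (3, 1), (4, 0), (0, 8), (1, 7)),
     ((14, 3, 7, 11), (7, 6, 0, 2), (3, 1), (5, 0), (0, 8), (2, 7)), ((14, 3, 14, 11), (7, 6, 0, 2), (3, 1), (2, 0), (0, 8), (2, 7)),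
     ((14, 6, 14, 3), (14, 6, 0, 3), (0, 1), (1, 0), (0, 1), (1, 0)), ((14, 6, 14, 5), (14, 6, 0, 3), (0, 1), (5, 0), (0, 1), (5, 0)),
     ((14, 6, 14, 9), (14, 6, 0, 9), (0, 1), (1, 0), (0, 1), (1, 0)), ((14, 6, 14, 11), (14, 6, 0, 9), (0, 1), (5, 0), (0, 1), (5, 0)),
     ((15, 4, 15, 2), (15, 4, 0, 2), (0, 1), (1, 0), (0, 1), (1, 0)), ((15, 4, 15, 8), (15, 4, 0, 2), (0, 1), (3, 0), (0, 1), (3, 0)),
     ((16, 4, 8, 3), (16, 4, 0, 3), (0, 1), (1, 1), (0, 1), (1, 15)), ((16, 4, 16, 3), (16, 4, 0, 3), (0, 1), (1, 0), (0, 1), (1, 0)),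
     ((16, 4, 4, 5), (16, 4, 0, 5), (0, 1), (1, 3), (0, 1), (1, 13)), ((16, 4, 8, 5), (16, 4, 0, 5), (0, 1), (1, 2), (0, 1), (1, 14)),
     ((16, 4, 16, 5), (16, 4, 0, 5), (0, 1), (1, 0), (0, 1), (1, 0)), ((16, 4, 8, 11), (16, 4, 0, 3), (0, 1), (3, 1), (0, 1), (3, 11)),
     ((16, 4, 16, 11), (16, 4, 0, 3), (0, 1), (3, 0), (0, 1), (3, 0)), ((16, 4, 4, 13), (16, 4, 0, 5), (0, 1), (3, 3), (0, 1), (3, 11)),
     ((16, 4, 8, 13), (16, 4, 0, 5), (0, 1), (3, 2), (0, 1), (3, 2)), ((16, 4, 16, 13), (16, 4, 0, 5), (0, 1), (3, 0), (0, 1), (3, 0)),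
     ((18, 3, 3, 7), (9, 6, 0, 4), (1, 1), (3, 1), (1, 9), (2, 1)), ((18, 3, 6, 7), (9, 6, 0, 4), (1, 1), (4, 2), (1, 2), (2, 17)),
     ((18, 3, 9, 7), (9, 6, 0, 4), (1, 1), (5, 0), (1, 1), (2, 9)), ((18, 3, 18, 7), (9, 6, 0, 4), (1, 1), (2, 0), (1, 10), (2, 9)),
     ((18, 3, 3, 13), (9, 6, 0, 4), (1, 1), (5, 1), (2, 14), (1, 8)), ((18, 3, 6, 13), (9, 6, 0, 4), (1, 1), (0, 2), (2, 6), (1, 1)),
     ((18, 3, 9, 13), (9, 6, 0, 4), (1, 1), (1, 0), (2, 10), (1, 0)), ((18, 3, 18, 13), (9, 6, 0, 4), (1, 1), (4, 0), (2, 10), (1, 9)),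
     ((18, 6, 18, 5), (18, 6, 0, 5), (0, 1), (1, 0), (0, 1), (1, 0)), ((18, 6, 6, 7), (18, 6, 0, 7), (0, 1), (1, 1), (0, 1), (1, 17)),
     ((18, 6, 18, 7), (18, 6, 0, 7), (0, 1), (1, 0), (0, 1), (1, 0)), ((18, 6, 18, 11), (18, 6, 0, 5), (0, 1), (5, 0), (0, 1), (5, 0)),
     ((18, 6, 6, 13), (18, 6, 0, 7), (0, 1), (5, 1), (0, 1), (5, 1)), ((18, 6, 18, 13), (18, 6, 0, 7), (0, 1), (5, 0), (0, 1), (5, 0)),
     ((20, 4, 10, 3), (20, 4, 10, 3), (0, 1), (1, 0), (0, 1), (1, 0)), ((20, 4, 20, 3), (20, 4, 0, 3), (0, 1), (1, 0), (0, 1), (1, 0)),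
     ((20, 4, 10, 7), (20, 4, 10, 3), (0, 1), (3, 0), (0, 1), (3, 0)), ((20, 4, 20, 7), (20, 4, 0, 3), (0, 1), (3, 0), (0, 1), (3, 0)),
     ((20, 4, 20, 13), (20, 4, 0, 13), (0, 1), (1, 0), (0, 1), (1, 0)), ((20, 4, 20, 17), (20, 4, 0, 13), (0, 1), (3, 0), (0, 1), (3, 0)),
     ((21, 6, 21, 2), (21, 6, 0, 2), (0, 1), (1, 0), (0, 1), (1, 0)), ((21, 6, 21, 10), (21, 6, 0, 10), (0, 1), (1, 0), (0, 1), (1, 0)),
     ((21, 6, 21, 11), (21, 6, 0, 2), (0, 1), (5, 0), (0, 1), (5, 0)), ((21, 6, 21, 19), (21, 6, 0, 10), (0, 1), (5, 0), (0, 1), (5, 0)),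
     ((28, 6, 14, 11), (28, 6, 14, 11), (0, 1), (1, 0), (0, 1), (1, 0)), ((28, 6, 28, 11), (28, 6, 28, 11), (0, 1), (1, 0), (0, 1), (1, 0)),
     ((28, 6, 14, 23), (28, 6, 14, 11), (0, 1), (5, 0), (0, 1), (5, 0)), ((28, 6, 28, 23), (28, 6, 28, 11), (0, 1), (5, 0), (0, 1), (5, 0)),
     ((30, 4, 30, 17), (30, 4, 0, 17), (0, 1), (1, 0), (0, 1), (1, 0)), ((30, 4, 30, 23), (30, 4, 0, 17), (0, 1), (3, 0), (0, 1), (3, 0)),
     ((36, 6, 6, 7), (36, 6, 6, 7), (0, 1), (1, 0), (0, 1), (1, 0)), ((36, 6, 12, 7), (36, 6, 36, 7), (0, 1), (1, 2), (0, 1), (1, 34)),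
     ((36, 6, 18, 7), (36, 6, 6, 7), (0, 1), (1, 2), (0, 1), (1, 34)), ((36, 6, 36, 7), (36, 6, 36, 7), (0, 1), (1, 0), (0, 1), (1, 0)),
     ((36, 6, 6, 31), (36, 6, 6, 7), (0, 1), (5, 2), (0, 1), (5, 14)), ((36, 6, 12, 31), (36, 6, 36, 7), (0, 1), (5, 2), (0, 1), (5, 2)),
     ((36, 6, 18, 31), (36, 6, 6, 7), (0, 1), (5, 1), (0, 1), (5, 31)), ((36, 6, 36, 31), (36, 6, 36, 7), (0, 1), (5, 0), (0, 1), (5, 0)),
     ((42, 6, 42, 11), (42, 6, 0, 11), (0, 1), (1, 0), (0, 1), (1, 0)), ((42, 6, 42, 19), (42, 6, 0, 19), (0, 1), (1, 0), (0, 1), (1, 0)),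
     ((42, 6, 42, 23), (42, 6, 0, 11), (0, 1), (5, 0), (0, 1), (5, 0)), ((42, 6, 42, 31), (42, 6, 0, 19), (0, 1), (5, 0), (0, 1), (5, 0))]"

text \<open>The other choice of the primitive root: in each case there are two primitive roots, inverse to each
  other, and \<open>b\<close> is replaced by its inverse.\<close>

definition primroot_table :: "((nat \<times> nat \<times> nat \<times> nat) \<times> (nat \<times> nat \<times> nat \<times> nat) \<times> (nat \<times> nat) \<times> (nat \<times> nat) \<times> (nat \<times> nat) \<times> (nat \<times> nat)) list" where
  "primroot_table =
    [((5, 4, 0, 3), (5, 4, 0, 2), (0, 1), (3, 0), (0, 1), (3, 0)), ((7, 6, 0, 5), (7, 6, 0, 3), (0, 1), (5, 0), (0, 1), (5, 0)),
     ((9, 6, 0, 5), (9, 6, 0, 2), (0, 1), (5, 0), (0, 1), (5, 0)), ((10, 4, 0, 7), (10, 4, 0, 3), (0, 1), (3, 0), (0, 1), (3, 0)),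
     ((14, 6, 0, 5), (14, 6, 0, 3), (0, 1), (5, 0), (0, 1), (5, 0)), ((18, 6, 0, 11), (18, 6, 0, 5), (0, 1), (5, 0), (0, 1), (5, 0)),
     ((7, 6, 0, 4), (7, 6, 0, 2), (0, 1), (5, 0), (0, 1), (5, 0)), ((9, 6, 0, 7), (9, 6, 0, 4), (0, 1), (5, 0), (0, 1), (5, 0)),
     ((14, 6, 0, 11), (14, 6, 0, 9), (0, 1), (5, 0), (0, 1), (5, 0)), ((18, 6, 0, 13), (18, 6, 0, 7), (0, 1), (5, 0), (0, 1), (5, 0)),
     ((7, 3, 0, 4), (7, 3, 0, 2), (0, 1), (2, 0), (0, 1), (2, 0)), ((9, 3, 0, 7), (9, 3, 0, 4), (0, 1), (2, 0), (0, 1), (2, 0)),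
     ((14, 3, 0, 11), (14, 3, 0, 9), (0, 1), (2, 0), (0, 1), (2, 0)), ((18, 3, 0, 13), (18, 3, 0, 7), (0, 1), (2, 0), (0, 1), (2, 0))]"

lemma targets_semirational:
  "list_all (\<lambda>(n, t, l, r). consistent n t l r \<and> semirational_check n t l r) targets"
  by code_simp

lemma iso_table_checked:
  "list_all (\<lambda>(s, d, x, y, p, p'). iso_check s d x y p p' \<and> List.member targets d) iso_table"
  by code_simp

lemma primroot_table_checked: "list_all (\<lambda>(s, d, x, y, p, p'). iso_check s d x y p p') primroot_table"
  by code_simp

definition units_check :: "nat \<Rightarrow> nat \<Rightarrow> nat \<Rightarrow> bool" where
  "units_check n t r \<longleftrightarrow> list_all (\<lambda>k. \<not> coprime k n \<or>
     list_ex (\<lambda>m. (k * r ^ m) mod n = 1 \<or> (k * r ^ m + 1) mod n = 0) [0..<t]) [1..<n]"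

text \<open>These eight triples \<open>(j, i, k)\<close> suffice to refute all quadruples outside of the table.\<close>

definition witness_check :: "nat \<Rightarrow> nat \<Rightarrow> nat \<Rightarrow> nat \<Rightarrow> bool" where
  "witness_check n t l r \<longleftrightarrow>
     list_ex (\<lambda>(j, i, k). j < t \<and> coprime k (n * t) \<and> \<not> semirational_at n t l r j i k)
       [(1, 0, 3), (1, 0, 5), (1, 0, 7), (1, 0, 11), (1, 1, 5), (1, 1, 7), (2, 1, 3), (2, 1, 7)]"

definition candidates_check :: "nat \<Rightarrow> nat list \<Rightarrow> bool" where
  "candidates_check t ns \<longleftrightarrow> list_all (\<lambda>n. list_all (\<lambda>r.
     \<not> (r \<noteq> 1 \<and> (r ^ t) mod n = 1 \<and> units_check n t r) \<or>
     list_all (\<lambda>l. \<not> (n mod l = 0 \<and> (l * r) mod n = l mod n) \<or>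
       List.member (map fst iso_table) (n, t, l, r) \<or> witness_check n t l r) [1..<Suc n]) [1..<n]) ns"

definition small_divisors :: "nat \<Rightarrow> nat \<Rightarrow> nat list" where
  "small_divisors t N = filter (\<lambda>d. N mod d = 0 \<and> totient d \<le> 2 * t) [2..<Suc N]"

lemma small_divisors_2: "small_divisors 2 24 = [2, 3, 4, 6, 8, 12]"
  by code_simp

lemma small_divisors_4: "small_divisors 4 240 = [2, 3, 4, 5, 6, 8, 10, 12, 15, 16, 20, 24, 30]"
  by code_simp

lemma small_divisors_3: "small_divisors 3 504 = [2, 3, 4, 6, 7, 8, 9, 12, 14, 18]"
  by code_simp

lemma small_divisors_6: "small_divisors 6 504 = [2, 3, 4, 6, 7, 8, 9, 12, 14, 18, 21, 24, 28, 36, 42]"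
  by code_simp

lemma candidates_checked:
  "candidates_check 2 [2, 3, 4, 6, 8, 12]"
  "candidates_check 3 [2, 3, 4, 6, 7, 8, 9, 12, 14, 18]"
  "candidates_check 4 [2, 3, 4, 5, 6, 8, 10, 12, 15, 16, 20, 24, 30]"
  "candidates_check 6 [2, 3, 4, 6, 7, 8, 9, 12, 14, 18, 21, 24, 28, 36, 42]"
  by code_simp+

lemma pres_inverse_semirational:
  assumes "d \<in> set targets"
  shows "inverse_semirational (pres d)"
proof -
  obtain n t l r where d: "d = (n, t, l, r)" by (metis prod_cases4)
  have chk: "consistent n t l r" "semirational_check n t l r"
    using targets_semirational assms unfolding d list_all_iff by auto
  interpret metacyclic_normal "metacyclic_pres n t l r" "pres_gen n t l r Gen_a" "pres_gen n t l r Gen_b" n t l r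
    by (rule consistent_normal[OF chk(1)])
  show ?thesis unfolding d pres_def prod.case
    using chk by (intro inverse_semirational_if_check) (auto simp: consistent_def)
qed

lemma (in metacyclic_normal) comm_group_if_r_cong_1:
  assumes "[r = 1] (mod n)"
  shows "comm_group H"
proof (rule group_comm_groupI)
  have rj: "[i * r ^ j = i] (mod n)" for i j
    using cong_scalar_left[OF cong_pow[OF assms, of j], of i] by simp
  fix x y assume "x \<in> carrier H" "y \<in> carrier H"
  then obtain j i j' i' where xy: "x = nf j i" "y = nf j' i'" by (metis carrierE)
  have "[i * r ^ j' + i' = i' * r ^ j + i] (mod n)"
    using cong_add[OF rj[of i j'] cong_refl[of i']] cong_add[OF rj[of i' j] cong_refl[of i]]
    by (simp add: cong_def add.commute)
  then have "nf (j + j') (i * r ^ j' + i') = nf (j + j') (i' * r ^ j + i)" by (rule nf_cong)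
  then show "x \<otimes> y = y \<otimes> x" unfolding xy nf_mult by (simp add: add.commute)
qed

lemma units_check_if:
  assumes "units_pm_powers n t r" "n > 1"
  shows "units_check n t r"
  unfolding units_check_def list_all_iff list_ex_iff
proof
  fix k
  show "\<not> coprime k n \<or> (\<exists>m\<in>set [0..<t]. k * r ^ m mod n = 1 \<or> (k * r ^ m + 1) mod n = 0)"
  proof (cases "coprime k n")
    case True
    then obtain m where m: "m < t" "[k * r ^ m = 1] (mod n) \<or> [k * r ^ m + 1 = 0] (mod n)"
      using assms(1) unfolding units_pm_powers_def by blast
    from m(2) have "k * r ^ m mod n = 1 \<or> (k * r ^ m + 1) mod n = 0"
      unfolding cong_def mod_less[OF assms(2)] mod_0 by blast
    with m(1) show ?thesis by - (rule disjI2, rule bexI[of _ m], simp_all)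
  qed simp
qed

text \<open>Take \<open>p = 5\<close> in \<open>units_exponent_bound\<close>, since \<open>5\<^sup>2 - 1 = 24\<close>.\<close>

lemma exponent_2:
  fixes n :: nat
  shows "\<lbrakk>\<And>k. coprime k n \<Longrightarrow> [k ^ 2 = 1] (mod n); n > 0\<rbrakk> \<Longrightarrow> n dvd 24"
  using units_exponent_bound[of n 2 5 2] by simp

text \<open>Here \<open>7\<^sup>4 - 1 = 2400\<close>, and the surplus factors \<open>2\<close> and \<open>5\<close> are removed because the units modulo \<open>32\<close>
  and \<open>25\<close> have larger exponent.\<close>

lemma exponent_4:
  fixes n :: nat
  assumes u: "\<And>k. coprime k n \<Longrightarrow> [k ^ 4 = 1] (mod n)" and n: "n > 0"
  shows "n dvd 240"
proof -
  have p: "Factorial_Ring.prime (7::nat)" "Factorial_Ring.prime (2::nat)" "Factorial_Ring.prime (5::nat)" by simp_all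
  have c: "coprime (3::nat) 32" "coprime (2::nat) 25" by code_simp+
  have "n dvd 7 ^ 4 - 1" by (rule units_exponent_bound[OF u n p(1), of 2]) auto
  then have "n dvd 2 * 1200" by simp
  moreover have "\<not> 2 ^ 5 dvd n" by (rule units_exponent_not_dvd[OF u n, of 3]) (auto simp: c)
  ultimately have "n dvd 1200" using dvd_drop_prime[of n 2 1200 5] p(2) by simp
  then have "n dvd 5 * 240" by simp
  moreover have "\<not> 5 ^ 2 dvd n" by (rule units_exponent_not_dvd[OF u n, of 2]) (auto simp: c)
  ultimately show ?thesis using dvd_drop_prime[of n 5 240 2] p(3) by simp
qed

text \<open>Here \<open>5\<^sup>6 - 1 = 31 \<cdot> 504\<close>, and \<open>31\<close> has units of larger order.\<close>

lemma exponent_6: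
  fixes n :: nat
  assumes u: "\<And>k. coprime k n \<Longrightarrow> [k ^ 6 = 1] (mod n)" and n: "n > 0"
  shows "n dvd 504"
proof -
  have p: "Factorial_Ring.prime (5::nat)" "Factorial_Ring.prime (31::nat)" by simp_all
  have "n dvd 5 ^ 6 - 1" by (rule units_exponent_bound[OF u n p(1), of 2]) auto
  then have "n dvd 31 * 504" by simp
  moreover have "\<not> 31 ^ 1 dvd n"
  proof (rule units_exponent_not_dvd[OF u n, of 3])
    have "coprime (3::nat) 31" by code_simp
    then show "coprime (3::nat) (31 ^ 1)" by simp
  qed auto
  ultimately show ?thesis using dvd_drop_prime[of n 31 504 1] p(2) by simp
qed

lemma small_divisorsI: "n > 1 \<Longrightarrow> n dvd N \<Longrightarrow> N > 0 \<Longrightarrow> totient n \<le> 2 * t \<Longrightarrow> n \<in> set (small_divisors t N)"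
  using dvd_imp_le[of n N] by (cases "n = N") (auto simp: small_divisors_def)

text \<open>The bounds restrict \<open>(n, t, l, r)\<close> to the quadruples inspected by \<open>candidates_check\<close>, and those that
  are not rows of the table have a witness against inverse semi-rationality.\<close>

lemma classification_reduced:
  fixes n t l r :: nat
  assumes n: "n > 0" and t: "t > 0" and r: "r > 0" and l: "l > 0" and rn: "r < n"
    and rt: "[r ^ t = 1] (mod n)" and lr: "[l * r = l] (mod n)" and ln: "l dvd n"
    and isr: "inverse_semirational (metacyclic_pres n t l r)" and nonab: "\<not> comm_group (metacyclic_pres n t l r)"
  shows "\<exists>d\<in>set targets. metacyclic_pres n t l r \<cong> pres d"
proof -
  interpret P: metacyclic_normal "metacyclic_pres n t l r" "pres_gen n t l r Gen_a" "pres_gen n t l r Gen_b" n t l r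
    by (rule metacyclic_pres_normal[OF n t rt lr])
  have r1: "\<not> [r = 1] (mod n)" using P.comm_group_if_r_cong_1 nonab by blast
  have n1: "n > 1" using r1 n by (cases "n = 1") auto
  have t1: "t > 1" using r1 rt t by (cases "t = 1") auto
  have t4: "t \<in> {2, 3, 4, 6}"
    by (rule units_pm_one_cases[OF t1 P.isr_units_mod_t[OF isr r t1]])
  have u: "units_pm_powers n t r" by (rule P.isr_units_pm_powers[OF isr r n1])
  have tot: "totient n \<le> 2 * t" by (rule totient_le_if_units_pm_powers[OF u n1])
  have expo: "[k ^ e = 1] (mod n)" if "even e" "t dvd e" "coprime k n" for e k
    by (rule units_pm_powers_exponent[OF u rt that])
  obtain ns where ns: "n \<in> set ns" "candidates_check t ns"
  proof -
    from t4 consider "t = 2" | "t = 3" | "t = 4" | "t = 6" by auto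
    then show ?thesis
    proof cases
      case 1
      have "n dvd 24" by (rule exponent_2[OF expo n]) (auto simp: 1)
      show ?thesis
        by (rule that[OF small_divisorsI[OF n1 \<open>n dvd 24\<close> _ tot]]) (simp_all add: 1 small_divisors_2 candidates_checked)
    next
      case 2
      have "n dvd 504" by (rule exponent_6[OF expo n]) (auto simp: 2)
      show ?thesis
        by (rule that[OF small_divisorsI[OF n1 \<open>n dvd 504\<close> _ tot]]) (simp_all add: 2 small_divisors_3 candidates_checked)
    next
      case 3
      have "n dvd 240" by (rule exponent_4[OF expo n]) (auto simp: 3)
      show ?thesis
        by (rule that[OF small_divisorsI[OF n1 \<open>n dvd 240\<close> _ tot]]) (simp_all add: 3 small_divisors_4 candidates_checked)
    next
      case 4
      have "n dvd 504" by (rule exponent_6[OF expo n]) (auto simp: 4)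
      show ?thesis
        by (rule that[OF small_divisorsI[OF n1 \<open>n dvd 504\<close> _ tot]]) (simp_all add: 4 small_divisors_6 candidates_checked)
    qed
  qed
  have rset: "r \<in> set [1..<n]" using r rn by simp
  have lset: "l \<in> set [1..<Suc n]" using l ln n by (auto dest: dvd_imp_le)
  have pre: "(r ^ t) mod n = 1" "r \<noteq> 1" "units_check n t r" "n mod l = 0" "(l * r) mod n = l mod n"
  proof -
    show "(r ^ t) mod n = 1" using rt n1 by (simp only: cong_def mod_less)
    show "r \<noteq> 1" using r1 by auto
    show "units_check n t r" by (rule units_check_if[OF u n1])
    show "n mod l = 0" using ln by simp
    show "(l * r) mod n = l mod n" using lr by (simp only: cong_def)
  qed
  have "List.member (map fst iso_table) (n, t, l, r) \<or> witness_check n t l r"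
    by (rule ns(2)[unfolded candidates_check_def list_all_iff disj_not1, THEN bspec, OF ns(1), THEN bspec, OF rset,
          THEN mp, OF conjI[OF pre(2) conjI[OF pre(1,3)]], THEN bspec, OF lset, THEN mp, OF conjI[OF pre(4,5)]])
  moreover have "\<not> witness_check n t l r"
  proof
    assume "witness_check n t l r"
    then obtain x where x: "x \<in> set [(1, 0, 3), (1, 0, 5), (1, 0, 7), (1, 0, 11), (1, 1, 5), (1, 1, 7), (2, 1, 3), (2, 1, 7)]"
      "case x of (j, i, k) \<Rightarrow> j < t \<and> coprime k (n * t) \<and> \<not> semirational_at n t l r j i k"
      unfolding witness_check_def list_ex_iff by (elim bexE)
    obtain j i k where jik: "x = (j, i, k)" by (rule prod_cases3)
    have "i < 2" using x(1) unfolding jik by auto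
    then have "i < n" using n1 by simp
    then show False using x(2) isr unfolding jik prod.case P.inverse_semirational_iff[OF r] by blast
  qed
  ultimately have "(n, t, l, r) \<in> set (map fst iso_table)" by (simp only: List.member_iff simp_thms)
  then obtain row where row: "row \<in> set iso_table" "(n, t, l, r) = fst row" unfolding set_map by (elim imageE)
  obtain d x y p p' where row': "row = ((n, t, l, r), d, x, y, p, p')" using row(2) by (metis prod.collapse)
  from iso_table_checked row(1) have "iso_check (n, t, l, r) d x y p p'" "d \<in> set targets"
    unfolding row' by (auto simp only: list_all_iff List.member_iff prod.case dest: bspec)
  then have "pres (n, t, l, r) \<cong> pres d" "d \<in> set targets" by (simp_all only: iso_check_sound)
  then show ?thesis by (auto simp: pres_def)
qed

lemma group_pres: "group (pres d)"
  by (cases d) (simp add: pres_def metacyclic_pres_def group_presented_group)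

lemma classification:
  fixes n t l r :: nat
  assumes G: "group G" and comm: "\<not> comm_group G" and isr: "inverse_semirational G"
    and n: "n > 0" and t: "t > 0" and r: "r > 0" and l: "l > 0"
    and rt: "[r ^ t = 1] (mod n)" and lr: "[l * r = l] (mod n)" and ln: "l dvd n"
    and iso: "G \<cong> metacyclic_pres n t l r"
  shows "\<exists>d\<in>set targets. G \<cong> pres d"
proof -
  interpret P: metacyclic_normal "metacyclic_pres n t l r" "pres_gen n t l r Gen_a" "pres_gen n t l r Gen_b" n t l r
    by (rule metacyclic_pres_normal[OF n t rt lr])
  have nc: "\<not> comm_group H" if "G \<cong> H" "group H" for H :: "(gen \<times> bool) list set monoid"
  proof
    assume "comm_group H"
    then have "comm_group G"
      using group.iso_sym[OF G that(1)] group.is_monoid[OF G] by (rule comm_group.iso_imp_comm_group)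
    then show False using comm by simp
  qed
  have r1: "\<not> [r = 1] (mod n)"
    using nc[OF iso P.is_group] P.comm_group_if_r_cong_1 by blast
  define r' where "r' = r mod n"
  have rr: "[r = r'] (mod n)" by (simp add: r'_def cong_def)
  have iso': "G \<cong> metacyclic_pres n t l r'"
    using iso_trans[OF iso metacyclic_pres_cong[OF n t rt lr cong_refl rr]] .
  have rt': "[r' ^ t = 1] (mod n)" using cong_pow[OF rr, of t] rt by (metis cong_sym cong_trans)
  have lr': "[l * r' = l] (mod n)" using cong_scalar_left[OF rr, of l] lr by (metis cong_sym cong_trans)
  have "r' \<noteq> 0"
  proof
    assume "r' = 0"
    then have "[0 = (1::nat)] (mod n)" using rt' t by (simp only: zero_power)
    then have "n dvd 1" by (simp only: cong_sym_eq[of 0] cong_0_iff)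
    then show False using r1 by simp
  qed
  then have "\<exists>d\<in>set targets. metacyclic_pres n t l r' \<cong> pres d"
    using n t l rt' lr' ln inverse_semirational_iso[OF G _ iso' isr] nc[OF iso']
    by (intro classification_reduced) (auto simp: r'_def metacyclic_pres_def group_presented_group)
  then show ?thesis using iso_trans[OF iso'] by blast
qed

section \<open>Presentations with a primitive root as parameter\<close>

text \<open>In \<open>(n, t, e, a, b)\<close> the numbers \<open>a, b\<close> are the primitive roots modulo \<open>n\<close>; the presentation has
  \<open>r\<close> equal to the \<open>e\<close>-th power of a primitive root.\<close>

definition primroot_params :: "(nat \<times> nat \<times> nat \<times> nat \<times> nat) list" where
  "primroot_params =
    [(5, 4, 1, 2, 3), (7, 6, 1, 3, 5), (9, 6, 1, 2, 5), (10, 4, 1, 3, 7), (14, 6, 1, 3, 5), (18, 6, 1, 5, 11),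
     (7, 6, 2, 3, 5), (9, 6, 2, 2, 5), (14, 6, 2, 3, 5), (18, 6, 2, 5, 11),
     (7, 3, 2, 3, 5), (9, 3, 2, 2, 5), (14, 3, 2, 3, 5), (18, 3, 2, 5, 11)]"

lemma primroot_params_checked:
  "list_all (\<lambda>(n, t, e, a, b). consistent n t 0 (a ^ e mod n) \<and> consistent n t 0 (b ^ e mod n) \<and>
     list_ex (\<lambda>(s, d, _). s = (n, t, 0, b ^ e mod n) \<and> d = (n, t, 0, a ^ e mod n)) primroot_table \<and>
     list_all (\<lambda>g. \<not> coprime g n \<or> list_ex (\<lambda>i. g ^ i mod n = 1) [1..<totient n] \<or> g = a \<or> g = b) [0..<n])
   primroot_params"
  by code_simp

lemma primroot_pres_iso:
  assumes "(n, t, e, a, b) \<in> set primroot_params" and g: "residue_primroot n g"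
  shows "metacyclic_pres n t 0 (g ^ e) \<cong> pres (n, t, 0, a ^ e mod n)"
proof -
  have chk: "consistent n t 0 (a ^ e mod n)" "consistent n t 0 (b ^ e mod n)"
    "\<exists>x y p p'. ((n, t, 0, b ^ e mod n), (n, t, 0, a ^ e mod n), x, y, p, p') \<in> set primroot_table"
    and roots: "\<And>g. g < n \<Longrightarrow> coprime g n \<Longrightarrow> \<forall>i\<in>{1..<totient n}. g ^ i mod n \<noteq> 1 \<Longrightarrow> g = a \<or> g = b"
    using primroot_params_checked assms(1) unfolding list_all_iff list_ex_iff by fastforce+
  have n1: "n > 1" and t0: "t > 0" using chk(1) by (auto simp: consistent_def)
  have "g mod n = a \<or> g mod n = b"
  proof (rule roots)
    show "coprime (g mod n) n" using g n1 by (auto simp: residue_primroot_def coprime_commute)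
    show "\<forall>i\<in>{1..<totient n}. (g mod n) ^ i mod n \<noteq> 1"
    proof
      fix i assume i: "i \<in> {1..<totient n}"
      have "ord n g = totient n" using g by (simp add: residue_primroot_def)
      then have "\<not> ord n g dvd i" using i by (auto dest: dvd_imp_le)
      then have "\<not> [g ^ i = 1] (mod n)" using ord_divides[of g i n] by blast
      then show "(g mod n) ^ i mod n \<noteq> 1" using n1 by (simp add: cong_def power_mod)
    qed
  qed (use n1 in simp)
  then obtain c where c: "c = a \<or> c = b" "g mod n = c" by blast
  have ge: "[g ^ e = c ^ e mod n] (mod n)" using c(2) by (auto simp: cong_def power_mod)
  have con: "consistent n t 0 (c ^ e mod n)" using c(1) chk by auto
  have "[(g ^ e) ^ t = 1] (mod n)"
    using cong_pow[OF ge, of t] con n1 by (auto simp: consistent_def cong_def)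
  then have "metacyclic_pres n t 0 (g ^ e) \<cong> metacyclic_pres n t 0 (c ^ e mod n)"
    using n1 t0 ge by (intro metacyclic_pres_cong) auto
  moreover have "metacyclic_pres n t 0 (c ^ e mod n) \<cong> pres (n, t, 0, a ^ e mod n)"
  proof (cases "c = a")
    case True
    then show ?thesis by (simp add: pres_def iso_refl)
  next
    case False
    obtain x y p p' where "((n, t, 0, b ^ e mod n), (n, t, 0, a ^ e mod n), x, y, p, p') \<in> set primroot_table"
      using chk(3) by blast
    then have "iso_check (n, t, 0, b ^ e mod n) (n, t, 0, a ^ e mod n) x y p p'"
      using primroot_table_checked by (auto simp: list_all_iff)
    from iso_check_sound[OF this] show ?thesis using False c(1) by (simp add: pres_def)
  qed
  ultimately show ?thesis by (rule iso_trans)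
qed

lemma iso_pres_primroot:
  assumes "(n, t, e, a, b) \<in> set primroot_params" and "residue_primroot n g"
  shows "G \<cong> metacyclic_pres n t 0 (g ^ e) \<longleftrightarrow> G \<cong> pres (n, t, 0, a ^ e mod n)"
proof -
  note iso = primroot_pres_iso[OF assms]
  have grp: "group (metacyclic_pres n t 0 (g ^ e))" by (simp add: metacyclic_pres_def group_presented_group)
  show ?thesis using iso_trans iso group.iso_sym[OF grp iso] by blast
qed

section \<open>The metacyclic groups with the cut-property\<close>

theorem theorem5:
  fixes G :: "('a, 'm) monoid_scheme"
    and n t r l :: nat
    and lam :: "nat \<Rightarrow> nat"
  assumes "group G" and "finite (carrier G)" and "\<not> comm_group G" and "metacyclic G"
    and "n > 0" and "t > 0" and "r > 0" and "l > 0"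
    and "[r ^ t = 1] (mod n)" and "[l * r = l] (mod n)" and "l dvd n"
    and "G \<cong> metacyclic_pres n t l r"
    and "\<And>m. m \<in> {5, 7, 9, 10, 14, 18} \<Longrightarrow> residue_primroot m (lam m)"
  shows "cut_property G \<longleftrightarrow>
      (\<exists>t\<in>{2, 4, 6}. \<exists>n\<in>{3, 4, 6}. G \<cong> metacyclic_pres n t 0 (n - 1))
    \<or> (\<exists>t\<in>{2, 4, 6}. G \<cong> metacyclic_pres 4 t 2 3)
    \<or> G \<cong> metacyclic_pres 6 2 3 5
    \<or> (\<exists>n\<in>{5, 7, 9, 10, 14, 18}. G \<cong> metacyclic_pres n (totient n) 0 (lam n))
    \<or> (\<exists>j\<in>{1, 2}. \<exists>n\<in>{7, 9, 14, 18}.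
          G \<cong> metacyclic_pres n (totient n div j) 0 ((lam n)\<^sup>2))
    \<or> (\<exists>t\<in>{2, 4}. \<exists>r\<in>{3, 5}. G \<cong> metacyclic_pres 8 t 0 r)
    \<or> (\<exists>t\<in>{2, 4}. G \<cong> metacyclic_pres 12 t 0 5)
    \<or> (\<exists>t\<in>{2, 6}. \<exists>l\<in>{t, 12}. G \<cong> metacyclic_pres 12 t l 7)
    \<or> G \<cong> metacyclic_pres 15 4 0 2
    \<or> (\<exists>r\<in>{3, 5}. G \<cong> metacyclic_pres 16 4 0 r)
    \<or> (\<exists>r\<in>{3, 13}. G \<cong> metacyclic_pres 20 4 0 r)
    \<or> G \<cong> metacyclic_pres 20 4 10 3
    \<or> (\<exists>r\<in>{2, 10}. G \<cong> metacyclic_pres 21 6 0 r)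
    \<or> (\<exists>l\<in>{14, 28}. G \<cong> metacyclic_pres 28 6 l 11)
    \<or> G \<cong> metacyclic_pres 30 4 0 17
    \<or> (\<exists>l\<in>{6, 36}. G \<cong> metacyclic_pres 36 6 l 7)
    \<or> (\<exists>r\<in>{11, 19}. G \<cong> metacyclic_pres 42 6 0 r)"
proof -
  interpret finite_group G using assms(1,2) by (simp add: finite_group_def finite_group_axioms_def)
  have lam: "residue_primroot 5 (lam 5)" "residue_primroot 7 (lam 7)" "residue_primroot 9 (lam 9)"
    "residue_primroot 10 (lam 10)" "residue_primroot 14 (lam 14)" "residue_primroot 18 (lam 18)"
    using assms(13) by auto
  have tot: "totient 5 = 4" "totient 7 = 6" "totient 9 = 6" "totient 10 = 4" "totient 14 = 6" "totient 18 = 6"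
    by code_simp+
  have "cut_property G \<longleftrightarrow> (\<exists>d\<in>set targets. G \<cong> pres d)"
    unfolding cut_property_iff_inverse_semirational
  proof
    assume "inverse_semirational G"
    then show "\<exists>d\<in>set targets. G \<cong> pres d"
      by (rule classification[OF assms(1,3) _ assms(5-12)])
  next
    assume "\<exists>d\<in>set targets. G \<cong> pres d"
    then obtain d where d: "d \<in> set targets" "G \<cong> pres d" by blast
    show "inverse_semirational G"
      by (rule inverse_semirational_iso[OF group_pres assms(1) iso_sym[OF d(2)] pres_inverse_semirational[OF d(1)]])
  qed
  moreover have "(\<exists>d\<in>set fam1. G \<cong> pres d) \<longleftrightarrow> (\<exists>t\<in>{2, 4, 6}. \<exists>n\<in>{3, 4, 6}. G \<cong> metacyclic_pres n t 0 (n - 1))"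
    by (auto simp: fam1_def pres_def)
  moreover have "(\<exists>d\<in>set fam2. G \<cong> pres d) \<longleftrightarrow> (\<exists>t\<in>{2, 4, 6}. G \<cong> metacyclic_pres 4 t 2 3)"
    by (auto simp: fam2_def pres_def)
  moreover have "(\<exists>d\<in>set fam3. G \<cong> pres d) \<longleftrightarrow> G \<cong> metacyclic_pres 6 2 3 5"
    by (auto simp: fam3_def pres_def)
  moreover have "(\<exists>d\<in>set fam4. G \<cong> pres d) \<longleftrightarrow>
    (\<exists>n\<in>{5, 7, 9, 10, 14, 18}. G \<cong> metacyclic_pres n (totient n) 0 (lam n))"
    using iso_pres_primroot[of 5 4 1 2 3 "lam 5" G] iso_pres_primroot[of 7 6 1 3 5 "lam 7" G]
      iso_pres_primroot[of 9 6 1 2 5 "lam 9" G] iso_pres_primroot[of 10 4 1 3 7 "lam 10" G]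
      iso_pres_primroot[of 14 6 1 3 5 "lam 14" G] iso_pres_primroot[of 18 6 1 5 11 "lam 18" G]
    by (simp add: fam4_def primroot_params_def lam tot)
  moreover have "(\<exists>d\<in>set fam5. G \<cong> pres d) \<longleftrightarrow>
    (\<exists>j\<in>{1, 2}. \<exists>n\<in>{7, 9, 14, 18}. G \<cong> metacyclic_pres n (totient n div j) 0 ((lam n)\<^sup>2))"
    using iso_pres_primroot[of 7 6 2 3 5 "lam 7" G] iso_pres_primroot[of 9 6 2 2 5 "lam 9" G]
      iso_pres_primroot[of 14 6 2 3 5 "lam 14" G] iso_pres_primroot[of 18 6 2 5 11 "lam 18" G]
      iso_pres_primroot[of 7 3 2 3 5 "lam 7" G] iso_pres_primroot[of 9 3 2 2 5 "lam 9" G]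
      iso_pres_primroot[of 14 3 2 3 5 "lam 14" G] iso_pres_primroot[of 18 3 2 5 11 "lam 18" G]
    by (simp add: fam5_def primroot_params_def lam tot)
  moreover have "(\<exists>d\<in>set fam6. G \<cong> pres d) \<longleftrightarrow> (\<exists>t\<in>{2, 4}. \<exists>r\<in>{3, 5}. G \<cong> metacyclic_pres 8 t 0 r)"
    by (auto simp: fam6_def pres_def)
  moreover have "(\<exists>d\<in>set fam7. G \<cong> pres d) \<longleftrightarrow> (\<exists>t\<in>{2, 4}. G \<cong> metacyclic_pres 12 t 0 5)"
    by (auto simp: fam7_def pres_def)
  moreover have "(\<exists>d\<in>set fam8. G \<cong> pres d) \<longleftrightarrow> (\<exists>t\<in>{2, 6}. \<exists>l\<in>{t, 12}. G \<cong> metacyclic_pres 12 t l 7)"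
    by (auto simp: fam8_def pres_def)
  moreover have "(\<exists>d\<in>set fam9. G \<cong> pres d) \<longleftrightarrow> G \<cong> metacyclic_pres 15 4 0 2"
    by (auto simp: fam9_def pres_def)
  moreover have "(\<exists>d\<in>set fam10. G \<cong> pres d) \<longleftrightarrow> (\<exists>r\<in>{3, 5}. G \<cong> metacyclic_pres 16 4 0 r)"
    by (auto simp: fam10_def pres_def)
  moreover have "(\<exists>d\<in>set fam11. G \<cong> pres d) \<longleftrightarrow> (\<exists>r\<in>{3, 13}. G \<cong> metacyclic_pres 20 4 0 r)"
    by (auto simp: fam11_def pres_def)
  moreover have "(\<exists>d\<in>set fam12. G \<cong> pres d) \<longleftrightarrow> G \<cong> metacyclic_pres 20 4 10 3"
    by (auto simp: fam12_def pres_def)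
  moreover have "(\<exists>d\<in>set fam13. G \<cong> pres d) \<longleftrightarrow> (\<exists>r\<in>{2, 10}. G \<cong> metacyclic_pres 21 6 0 r)"
    by (auto simp: fam13_def pres_def)
  moreover have "(\<exists>d\<in>set fam14. G \<cong> pres d) \<longleftrightarrow> (\<exists>l\<in>{14, 28}. G \<cong> metacyclic_pres 28 6 l 11)"
    by (auto simp: fam14_def pres_def)
  moreover have "(\<exists>d\<in>set fam15. G \<cong> pres d) \<longleftrightarrow> G \<cong> metacyclic_pres 30 4 0 17"
    by (auto simp: fam15_def pres_def)
  moreover have "(\<exists>d\<in>set fam16. G \<cong> pres d) \<longleftrightarrow> (\<exists>l\<in>{6, 36}. G \<cong> metacyclic_pres 36 6 l 7)"
    by (auto simp: fam16_def pres_def)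
  moreover have "(\<exists>d\<in>set fam17. G \<cong> pres d) \<longleftrightarrow> (\<exists>r\<in>{11, 19}. G \<cong> metacyclic_pres 42 6 0 r)"
    by (auto simp: fam17_def pres_def)
  ultimately show ?thesis
    unfolding targets_def set_append bex_Un by (simp only:)
qed

end
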